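(* Let $(X_t)_{t\geq 0}$ be a spectrally negative Lévy process with $X_0=0$ that is not a pure drift, with Laplace exponent $$\psi(\theta)=c\theta+\tfrac12\sigma^2\theta^2+\int_{(0,\infty)}\left(e^{-\theta y}-1+\theta y\,\mathbf 1_{\{y<1\}}\right)\Pi(\mathrm dy),\qquad \theta\ge 0,$$ and for $x\ge 0$ let $\tau_x^-=\inf\{t>0: X_t<-x\}$. In all statements below the value $x=0$ is excluded if $X$ has paths of unbounded variation. (i) If $\psi'(0+)<0$, then for any $x\geq 0$ there exists $q^\ast>0$ such that $\mathbb{E}\big[e^{q^\ast \tau_x^-}\big]<\infty$, which implies $\mathbb{E}\left[(\tau_x^-)^\kappa\right]<\infty$ for any $x\ge 0$ and $\kappa\geq 0$. (ii) If $\psi'(0+)>0$, then for any $x\geq 0$ and $\kappa>0$, $$\mathbb{E}\left[(\tau_x^-)^\kappa\,\middle|\,\tau_x^-<\infty\right]<\infty\quad\text{if and only if}\quad \int_{[1,\infty)}y^{\kappa+1}\,\Pi(\mathrm dy)<\infty.$$ (iii) Assume $\psi'(0+)=0$. (a) If there exists $\kappa^*\in(0,1]$ such that $\int_{[1,\infty)}y^{\kappa^*+1}\,\Pi(\mathrm dy)=\infty$, then $\mathbb{E}\left[(\tau_x^-)^\kappa\right]=\infty$ for any $x\geq 0$ and $\kappa\geq\kappa^*$. (b) If $\psi''(0+)<\infty$, then $\mathbb{E}\left[(\tau_x^-)^\kappa\right]=\infty$ for any $x\geq 0$ and $\kappa>\tfrac12$. In particular, $\mathbb{E}\left[(\tau_x^-)^\kappa\right]=\infty$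 for any $x\geq 0$ and $\kappa\geq 1$.
   Context: A Lévy process is a càdlàg process with independent and stationary increments; it is spectrally negative if it has no positive jumps. Its Laplace exponent is $\psi(\theta)=\frac1t\log\mathbb{E}[e^{\theta X_t}]$, $\theta\ge0$, where $c\in\mathbb{R}$, $\sigma^2\ge 0$, and $\Pi$ is a measure on $(0,\infty)$ with $\int_{(0,\infty)}(1\wedge y^2)\,\Pi(\mathrm dy)<\infty$ (the image under $y\mapsto -y$ of the Lévy measure of $X$). Here $\psi'(0+)=\lim_{\theta\downarrow0}\psi'(\theta)=\mathbb{E}[X_1]\in[-\infty,\infty)$ and $\psi''(0+)=\lim_{\theta\downarrow 0}\psi''(\theta)\in[0,\infty]$. As usual $\inf\emptyset=\infty$. A pure drift is a process $X_t=ct$, $t\ge0$, with $c\in\mathbb R$. *)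

theory Defs
  imports "HOL-Probability.Probability"
begin

(* Every path is cadlag (not just almost every one), so that the passage times below are
   measurable without completing the probability space. Time is the half-line {0..} in real;
   the values X t for t < 0 are irrelevant. *)
locale levy_process = prob_space M for M :: "'a measure" +
  fixes X :: "real \<Rightarrow> 'a \<Rightarrow> real"
  assumes measurable_X: "\<And>t. 0 \<le> t \<Longrightarrow> X t \<in> borel_measurable M"
    and right_continuous:
      "\<And>\<omega> t. \<omega> \<in> space M \<Longrightarrow> 0 \<le> t \<Longrightarrow> ((\<lambda>s. X s \<omega>) \<longlongrightarrow> X t \<omega>) (at_right t)"
    and left_limits:
      "\<And>\<omega> t. \<omega> \<in> space M \<Longrightarrow> 0 < t \<Longrightarrow> \<exists>l. ((\<lambda>s. X s \<omega>) \<longlongrightarrow> l) (at_left t)"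
    and independent_increments:
      "\<And>(n::nat) u. 0 \<le> u 0 \<Longrightarrow> (\<forall>i<n. u i < u (Suc i)) \<Longrightarrow>
         indep_vars (\<lambda>_. borel) (\<lambda>i \<omega>. X (u (Suc i)) \<omega> - X (u i) \<omega>) {..<n}"
    and stationary_increments:
      "\<And>s h. 0 \<le> s \<Longrightarrow> 0 \<le> h \<Longrightarrow>
         distr M borel (\<lambda>\<omega>. X (s + h) \<omega> - X s \<omega>) = distr M borel (\<lambda>\<omega>. X h \<omega> - X 0 \<omega>)"

locale spectrally_negative_levy_process = levy_process +
  assumes no_positive_jumps:
    "AE \<omega> in M. \<forall>t>0. X t \<omega> \<le> Lim (at_left t) (\<lambda>s. X s \<omega>)"

definition pure_drift :: "'a measure \<Rightarrow> (real \<Rightarrow> 'a \<Rightarrow> real) \<Rightarrow> bool" where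
  "pure_drift M X \<longleftrightarrow> (\<exists>c::real. AE \<omega> in M. \<forall>t\<ge>0. X t \<omega> = c * t)"

definition bounded_variation_on_interval :: "(real \<Rightarrow> real) \<Rightarrow> real \<Rightarrow> real \<Rightarrow> bool" where
  "bounded_variation_on_interval f a b \<longleftrightarrow>
     (\<exists>B. \<forall>(n::nat) u. a \<le> u 0 \<and> u n \<le> b \<and> (\<forall>i<n. u i \<le> u (Suc i)) \<longrightarrow>
        (\<Sum>i<n. \<bar>f (u (Suc i)) - f (u i)\<bar>) \<le> B)"

definition unbounded_variation_paths :: "'a measure \<Rightarrow> (real \<Rightarrow> 'a \<Rightarrow> real) \<Rightarrow> bool" where
  "unbounded_variation_paths M X \<longleftrightarrow>
     \<not> (AE \<omega> in M. \<forall>t>0. bounded_variation_on_interval (\<lambda>s. X s \<omega>) 0 t)"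

(* psi(theta) = log E[exp(theta X_t)] / t for every t > 0. Integrability is part of the definition
   because a Bochner integral of a non-integrable function is 0 in HOL. *)
definition laplace_exponent ::
    "'a measure \<Rightarrow> (real \<Rightarrow> 'a \<Rightarrow> real) \<Rightarrow> (real \<Rightarrow> real) \<Rightarrow> bool" where
  "laplace_exponent M X \<psi> \<longleftrightarrow>
     (\<forall>\<theta>\<ge>0. \<forall>t>0. integrable M (\<lambda>\<omega>. exp (\<theta> * X t \<omega>)) \<and>
        \<psi> \<theta> = 1 / t * ln (\<integral>\<omega>. exp (\<theta> * X t \<omega>) \<partial>M))"

definition deriv_at_0plus :: "(real \<Rightarrow> real) \<Rightarrow> ereal" where
  "deriv_at_0plus \<psi> = Lim (at_right 0) (\<lambda>\<theta>. ereal (deriv \<psi> \<theta>))"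

definition deriv2_at_0plus :: "(real \<Rightarrow> real) \<Rightarrow> ereal" where
  "deriv2_at_0plus \<psi> = Lim (at_right 0) (\<lambda>\<theta>. ereal (deriv (deriv \<psi>) \<theta>))"

(* tau_x^-; the infimum of the empty set in ennreal is \<infinity>. *)
definition passage_below :: "(real \<Rightarrow> 'a \<Rightarrow> real) \<Rightarrow> real \<Rightarrow> 'a \<Rightarrow> ennreal" where
  "passage_below X x \<omega> = (INF t\<in>{t. 0 < t \<and> X t \<omega> < - x}. ennreal t)"

(* T^k for k \<ge> 0. The case k = 0 is separate because 0 powr 0 = 0 in HOL. *)
definition time_power :: "ennreal \<Rightarrow> real \<Rightarrow> ennreal" where
  "time_power T k =
     (if k = 0 then 1 else if T = \<infinity> then \<infinity> else ennreal (enn2real T powr k))"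

(* exp (q T) for q > 0 *)
definition exp_time :: "real \<Rightarrow> ennreal \<Rightarrow> ennreal" where
  "exp_time q T = (if T = \<infinity> then \<infinity> else ennreal (exp (q * enn2real T)))"

(* E[(tau_x^-)^k] *)
definition passage_moment ::
    "'a measure \<Rightarrow> (real \<Rightarrow> 'a \<Rightarrow> real) \<Rightarrow> real \<Rightarrow> real \<Rightarrow> ennreal" where
  "passage_moment M X x k = (\<integral>\<^sup>+\<omega>. time_power (passage_below X x \<omega>) k \<partial>M)"

(* E[(tau_x^-)^k | tau_x^- < \<infinity>]; uniform_measure M A is the conditional law M(. | A). *)
definition cond_passage_moment ::
    "'a measure \<Rightarrow> (real \<Rightarrow> 'a \<Rightarrow> real) \<Rightarrow> real \<Rightarrow> real \<Rightarrow> ennreal" where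
  "cond_passage_moment M X x k =
     (\<integral>\<^sup>+\<omega>. time_power (passage_below X x \<omega>) k
        \<partial>uniform_measure M {\<omega> \<in> space M. passage_below X x \<omega> < \<infinity>})"

definition admissible_level :: "'a measure \<Rightarrow> (real \<Rightarrow> 'a \<Rightarrow> real) \<Rightarrow> real \<Rightarrow> bool" where
  "admissible_level M X x \<longleftrightarrow> 0 \<le> x \<and> (x = 0 \<longrightarrow> \<not> unbounded_variation_paths M X)"

end

theory Submission
  imports Defs "HOL-Real_Asymp.Real_Asymp"
begin

text \<open>
  Everything is read off the dyadic skeleton of \<open>X\<close> with mesh \<open>h\<close>. Its depth after \<open>n\<close> steps,
  \<open>W\<^sub>n = max\<^sub>k\<^sub>\<le>\<^sub>n (- X\<^sub>k\<^sub>h)\<close>, obeys Lindley's recursion \<open>W\<^sub>n\<^sub>+\<^sub>1 = max 0 (W\<^sub>n - \<xi>)\<close> in law, whence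
  \<open>(exp (h \<psi>(\<theta>)) - 1) \<Sum>\<^sub>k\<^sub><\<^sub>n E[exp (- \<theta> W\<^sub>k)] = D\<^sub>n(\<theta>) - 1 + E[exp (- \<theta> W\<^sub>n)]\<close>, where \<open>D\<^sub>n(\<theta>)\<close> sums the
  exponential overshoots \<open>E[exp (\<theta> (\<xi> - W\<^sub>k)\<^sup>+) - 1]\<close> and \<open>D\<^sub>n(\<theta>) / \<theta>\<close> increases in \<open>\<theta>\<close>.

  If \<open>\<psi>'(0+) < 0\<close>, then \<open>\<psi>(\<theta>) < 0\<close> for some \<open>\<theta>\<close> and Markov's inequality for \<open>exp (\<theta> X\<^sub>t)\<close> gives an
  exponential tail.

  If \<open>\<psi>'(0+) = 0\<close>, comparing the identity at a large and at a small argument yields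
  \<open>E[min \<tau> t] \<ge> \<delta> t \<psi>(\<theta>) / (\<theta> (1 + t \<psi>(\<theta>))) - C\<close> uniformly in \<open>t > 0\<close> and \<open>0 < \<theta> \<le> 1\<close>. Taking
  \<open>t = 1 / \<psi>(\<theta>)\<close> and \<open>\<psi>(\<theta>) \<ge> \<psi>(1) \<theta>\<^sup>2\<close> excludes moments of order above 1/2, and integrating the bound with
  \<open>\<theta> = 1 / t\<close> against \<open>t powr (\<kappa> - 2)\<close> bounds the jump moment of order \<open>\<kappa> + 1\<close> by \<open>E[\<tau> powr \<kappa>]\<close>.

  If \<open>m = \<psi>'(0+) > 0\<close>, letting \<open>n \<rightarrow> \<infinity>\<close> and \<open>h \<rightarrow> 0\<close> gives \<open>E[exp (- \<theta> I)] = m \<theta> / \<psi>(\<theta>)\<close> for the all-time depth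
  \<open>I\<close> of \<open>X\<close>. Inverting the Laplace transform expresses the tail of \<open>I\<close> as a convolution with the ladder
  height measure, so that \<open>E[I powr \<kappa>]\<close> is finite iff the jump moment of order \<open>\<kappa> + 1\<close> is. On \<open>\<tau> < \<infinity>\<close> the
  passage time is at most \<open>2 / m\<close> times the depth of \<open>X\<^sub>t - m t / 2\<close>; conversely, with probability bounded
  away from 0 there is no passage before \<open>t\<close> and \<open>X\<^sub>t \<le> K t\<close>, and a later fall by more than \<open>x + K t\<close> then makes
  the passage happen after \<open>t\<close>.
\<close>

section \<open>The Laplace exponent\<close>

text \<open>Only independence of finitely many increments is used, neither the strong Markov
  property nor scale functions. The price is that the overshoots
  \<open>(\<xi> - W\<^sub>k)\<^sup>+\<close> have unknown transforms. They are eliminated by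
  evaluating the identity at two arguments: \<open>D\<^sub>n(\<theta>) / \<theta>\<close> increases
  because exp is convex, and it hardly depends on \<theta> while the overshoots are small. Since
  jumps only go downwards, overshoots become small on a fine mesh, and this turns an inequality into
  the exact formula for \<open>I\<close>. Truncated means of \<tau> appear because \<open>h\<close>
  times the sum of the probabilities of \<open>W\<^sub>k \<le> x\<close> is the expected grid time
  before passage. To read such probabilities off Laplace transforms, a multiple of the transform at
  1 is subtracted from the one at a large argument, which depends on \<open>x\<close>. Level 0 is
  reached from positive levels, so there the constant must be uniform in small \<open>x\<close>;
  this needs linear growth of \<psi>, which bounded variation supplies.\<close>

lemma exp_neg_compensated_nonneg: "0 \<le> exp (- u) - 1 + (u::real)"
  using exp_ge_add_one_self[of "- u"] by simp

text \<open>Convexity of exp on the segment between 0 and \<open>- u\<close>. The sign of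
  \<open>u\<close> is free; the overshoot estimates use negative \<open>u\<close>.\<close>

lemma one_minus_exp_neg_scale:
  fixes r u :: real
  assumes "0 \<le> r" "r \<le> 1"
  shows "r * (1 - exp (- u)) \<le> 1 - exp (- (r * u))"
proof -
  have "exp ((1 - r) *\<^sub>R 0 + r *\<^sub>R (- u)) \<le> (1 - r) * exp 0 + r * exp (- u)"
    using assms by (intro convex_onD[OF exp_convex]) auto
  then show ?thesis by (simp add: algebra_simps)
qed

lemma exp_neg_compensated_scale_le:
  fixes r u :: real
  assumes "0 \<le> r" "r \<le> 1"
  shows "exp (- (r * u)) - 1 + r * u \<le> r * (exp (- u) - 1 + u)"
  using one_minus_exp_neg_scale[OF assms, of u] by (simp add: algebra_simps)

text \<open>In other words, \<open>(exp (- u) - 1 + u) / u\<^sup>2\<close> decreases on the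
  half-line. Differentiating in \<open>u\<close> reduces the claim to the chord inequality.\<close>

lemma exp_neg_compensated_scale_ge:
  fixes r u :: real
  assumes "0 \<le> r" "r \<le> 1" "0 \<le> u"
  shows "r\<^sup>2 * (exp (- u) - 1 + u) \<le> exp (- (r * u)) - 1 + r * u"
proof -
  define F where "F = (\<lambda>u. exp (- (r * u)) - 1 + r * u - r\<^sup>2 * (exp (- u) - 1 + u))"
  have "F 0 \<le> F u"
  proof (rule DERIV_nonneg_imp_nondecreasing[OF assms(3)])
    fix x :: real assume "0 \<le> x" "x \<le> u"
    have "DERIV F x :> r * (1 - exp (- (r * x)) - r * (1 - exp (- x)))"
      unfolding F_def by (auto intro!: derivative_eq_intros simp: algebra_simps power2_eq_square)
    moreover have "0 \<le> r * (1 - exp (- (r * x)) - r * (1 - exp (- x)))"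
      using one_minus_exp_neg_scale[OF assms(1,2), of x] assms(1) by simp
    ultimately show "\<exists>y. DERIV F x :> y \<and> y \<ge> 0" by blast
  qed
  then show ?thesis by (simp add: F_def)
qed

lemma exp_neg_compensated_le_square:
  fixes u :: real
  assumes "0 \<le> u"
  shows "exp (- u) - 1 + u \<le> u\<^sup>2 / 2"
proof -
  define F where "F = (\<lambda>u::real. u\<^sup>2 / 2 - (exp (- u) - 1 + u))"
  have "F 0 \<le> F u"
  proof (rule DERIV_nonneg_imp_nondecreasing[OF assms])
    fix x :: real assume "0 \<le> x" "x \<le> u"
    have "DERIV F x :> exp (- x) - 1 + x"
      unfolding F_def by (auto intro!: derivative_eq_intros simp: algebra_simps)
    then show "\<exists>y. DERIV F x :> y \<and> y \<ge> 0"
      using exp_neg_compensated_nonneg[of x] by blast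
  qed
  then show ?thesis by (simp add: F_def)
qed

lemma min_one_square:
  fixes y :: real
  assumes "0 < y"
  shows "min 1 (y\<^sup>2) = (if y < 1 then y\<^sup>2 else 1)"
  using assms by (auto simp: min_def power2_eq_square not_le mult_le_one)
    (smt (verit) mult_le_cancel_left1 mult_less_cancel_left2)+

text \<open>The analytic hypotheses are kept apart from the process; \<open>drift_change\<close>
  instantiates them again with another linear coefficient and the same \<nu>.\<close>

locale levy_exponent =
  fixes c \<sigma> :: real and \<nu> :: "real measure" and \<psi> :: "real \<Rightarrow> real"
  assumes sets_nu: "sets \<nu> = sets (restrict_space borel {0<..})"
    and levy_measure: "(\<integral>\<^sup>+y. ennreal (min 1 (y\<^sup>2)) \<partial>\<nu>) < \<infinity>"
    and psi: "\<And>\<theta>. 0 \<le> \<theta> \<Longrightarrow>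
      \<psi> \<theta> = c * \<theta> + 1 / 2 * \<sigma>\<^sup>2 * \<theta>\<^sup>2
        + (\<integral>y. (exp (- \<theta> * y) - 1 + \<theta> * y * indicator {y. y < 1} y) \<partial>\<nu>)"
begin

abbreviation jump_moment :: "real \<Rightarrow> ennreal" where
  "jump_moment p \<equiv> (\<integral>\<^sup>+y\<in>{1..}. ennreal (y powr p) \<partial>\<nu>)"

lemma space_nu: "space \<nu> = {0<..}"
  using sets_eq_imp_space_eq[OF sets_nu] by (simp add: space_restrict_space)

lemma measurable_nu: "f \<in> measurable borel N \<Longrightarrow> f \<in> measurable \<nu> N"
  unfolding measurable_cong_sets[OF sets_nu refl] by (rule measurable_restrict_space1)

lemma sets_nu_borel: "A \<in> sets borel \<Longrightarrow> {y\<in>space \<nu>. y \<in> A} \<in> sets \<nu>"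
  using measurable_sets[OF measurable_nu[OF measurable_ident], of A]
  by (simp add: vimage_def Int_def conj_commute)

lemma integrable_min: "integrable \<nu> (\<lambda>y. min 1 (y\<^sup>2))"
  by (rule integrableI_bounded) (use levy_measure in \<open>auto intro!: measurable_nu\<close>)

lemma integrable_nu:
  fixes f :: "real \<Rightarrow> real"
  assumes "f \<in> borel_measurable borel" "\<And>y. 0 < y \<Longrightarrow> \<bar>f y\<bar> \<le> C * min 1 (y\<^sup>2)"
  shows "integrable \<nu> f"
proof (rule Bochner_Integration.integrable_bound)
  show "integrable \<nu> (\<lambda>y. C * min 1 (y\<^sup>2))"
    using integrable_min by (rule integrable_mult_right)
  show "f \<in> borel_measurable \<nu>" using assms(1) by (rule measurable_nu)
  show "AE y in \<nu>. norm (f y) \<le> norm (C * min 1 (y\<^sup>2))"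
    using assms(2) by (intro AE_I2) (fastforce simp: space_nu intro: order_trans[OF _ abs_ge_self])
qed

definition jump_part :: "real \<Rightarrow> real \<Rightarrow> real" where
  "jump_part \<theta> y = exp (- \<theta> * y) - 1 + \<theta> * y * indicator {y. y < 1} y"

definition jump_deriv :: "real \<Rightarrow> real \<Rightarrow> real" where
  "jump_deriv \<theta> y = y * (indicator {y. y < 1} y - exp (- \<theta> * y))"

definition psi' :: "real \<Rightarrow> real" where
  "psi' \<theta> = c + \<sigma>\<^sup>2 * \<theta> + (\<integral>y. jump_deriv \<theta> y \<partial>\<nu>)"

lemma measurable_jump [measurable]:
  "jump_part \<theta> \<in> borel_measurable borel" "jump_deriv \<theta> \<in> borel_measurable borel"
  unfolding jump_part_def[abs_def] jump_deriv_def[abs_def] by measurable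

text \<open>A dominating function for differentiation under the integral, uniform on
  \<open>{a..b}\<close>. The term \<open>1 / a\<close> comes from
  \<open>y * exp (- \<theta> * y) \<le> 1 / \<theta>\<close> for large \<open>y\<close>; it blows up
  at 0, where the limit of the derivative needs separate treatment.\<close>

lemma jump_deriv_bound:
  assumes "0 < a" "a \<le> \<theta>" "\<theta> \<le> b" "0 < y"
  shows "\<bar>jump_deriv \<theta> y\<bar> \<le> (b + 1 / a) * min 1 (y\<^sup>2)"
proof (cases "y < 1")
  case True
  have "0 \<le> 1 - exp (- \<theta> * y)" "1 - exp (- \<theta> * y) \<le> \<theta> * y"
    using assms exp_ge_add_one_self[of "- \<theta> * y"] by auto
  then have "\<bar>jump_deriv \<theta> y\<bar> \<le> y * (\<theta> * y)"
    using True assms by (simp add: jump_deriv_def abs_mult)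
  also have "\<dots> \<le> (b + 1 / a) * y\<^sup>2"
    using assms by (simp add: power2_eq_square algebra_simps)
      (smt (verit) divide_nonneg_nonneg mult_nonneg_nonneg mult_right_mono)
  also have "y\<^sup>2 = min 1 (y\<^sup>2)"
    using True assms by (simp add: min_one_square)
  finally show ?thesis .
next
  case False
  have "a * y \<le> \<theta> * y" using assms by simp
  also have "\<dots> \<le> exp (\<theta> * y)" using exp_ge_add_one_self[of "\<theta> * y"] by linarith
  finally have "y * exp (- \<theta> * y) \<le> 1 / a"
    using assms by (simp add: exp_minus field_simps)
  moreover have "min 1 (y\<^sup>2) = 1" using False assms by (simp add: min_one_square)
  ultimately show ?thesis using False assms by (simp add: jump_deriv_def abs_mult)
qed

lemma integrable_jump_deriv: "0 < \<theta> \<Longrightarrow> integrable \<nu> (jump_deriv \<theta>)"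
  by (rule integrable_nu[where C="\<theta> + 1 / \<theta>"]) (auto intro!: jump_deriv_bound)

lemma has_derivative_jump_part:
  "((\<lambda>\<theta>. jump_part \<theta> y) has_real_derivative jump_deriv \<theta> y) (at \<theta>)"
  unfolding jump_part_def jump_deriv_def
  by (auto intro!: derivative_eq_intros simp: algebra_simps)

lemma jump_part_upper:
  assumes "1 \<le> \<theta>" "0 < y"
  shows "jump_part \<theta> y \<le> \<theta>\<^sup>2 * min 1 (y\<^sup>2)"
proof (cases "y < 1")
  case True
  have "exp (- (\<theta> * y)) - 1 + \<theta> * y \<le> (\<theta> * y)\<^sup>2 / 2"
    using assms by (intro exp_neg_compensated_le_square) auto
  also have "\<dots> \<le> (\<theta> * y)\<^sup>2" by simp
  finally have "exp (- (\<theta> * y)) - 1 + \<theta> * y \<le> \<theta>\<^sup>2 * y\<^sup>2" by (simp add: power_mult_distrib)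
  moreover have "y\<^sup>2 = min 1 (y\<^sup>2)"
    using True assms by (simp add: min_one_square)
  ultimately show ?thesis using True by (simp add: jump_part_def)
next
  case False
  have "exp (- \<theta> * y) \<le> 1" using assms by simp
  then have "jump_part \<theta> y \<le> 0" using False by (simp add: jump_part_def)
  also have "0 \<le> \<theta>\<^sup>2 * min 1 (y\<^sup>2)" by simp
  finally show ?thesis .
qed

lemma integrable_jump_part:
  assumes "0 \<le> \<theta>" shows "integrable \<nu> (jump_part \<theta>)"
proof (rule integrable_nu[where C="\<theta>\<^sup>2 + 1"])
  fix y :: real assume y: "0 < y"
  show "\<bar>jump_part \<theta> y\<bar> \<le> (\<theta>\<^sup>2 + 1) * min 1 (y\<^sup>2)"
  proof (cases "y < 1")
    case True
    have "exp (- (\<theta> * y)) - 1 + \<theta> * y \<le> (\<theta> * y)\<^sup>2 / 2"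
      using assms y by (intro exp_neg_compensated_le_square) auto
    also have "\<dots> \<le> (\<theta>\<^sup>2 + 1) * y\<^sup>2" by (simp add: power_mult_distrib algebra_simps)
    finally have "exp (- (\<theta> * y)) - 1 + \<theta> * y \<le> (\<theta>\<^sup>2 + 1) * y\<^sup>2" .
    moreover have "y\<^sup>2 = min 1 (y\<^sup>2)"
      using True y by (simp add: min_one_square)
    ultimately show ?thesis
      using True exp_neg_compensated_nonneg[of "\<theta> * y"] by (simp add: jump_part_def)
  next
    case False
    have "exp (- \<theta> * y) \<le> 1" using assms y by simp
    moreover have "min 1 (y\<^sup>2) = 1" using False y by (simp add: min_one_square)
    ultimately show ?thesis using False
      by (simp add: jump_part_def abs_if) (smt (verit) exp_gt_zero zero_le_power2)
  qed
qed measurable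

lemma psi_eq: "0 \<le> \<theta> \<Longrightarrow> \<psi> \<theta> = c * \<theta> + 1 / 2 * \<sigma>\<^sup>2 * \<theta>\<^sup>2 + (\<integral>y. jump_part \<theta> y \<partial>\<nu>)"
  using psi by (simp add: jump_part_def)

text \<open>Quadratic growth controls the upper tail of \<open>X h\<close> for small
  \<open>h\<close>, and at a level \<open>x > 0\<close> it is beaten by
  \<open>exp (- \<theta> * x)\<close>.\<close>

lemma psi_upper: "\<exists>C>0. \<forall>\<theta>\<ge>1. \<psi> \<theta> \<le> C * \<theta>\<^sup>2"
proof -
  define V where "V = (\<integral>y. min 1 (y\<^sup>2) \<partial>\<nu>)"
  have V: "0 \<le> V" unfolding V_def by (rule Bochner_Integration.integral_nonneg) auto
  have "\<psi> \<theta> \<le> (\<bar>c\<bar> + \<sigma>\<^sup>2 + V + 1) * \<theta>\<^sup>2" if "1 \<le> \<theta>" for \<theta>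
  proof -
    have "(\<integral>y. jump_part \<theta> y \<partial>\<nu>) \<le> (\<integral>y. \<theta>\<^sup>2 * min 1 (y\<^sup>2) \<partial>\<nu>)"
      using that integrable_min
      by (intro integral_mono_AE integrable_jump_part AE_I2 jump_part_upper integrable_mult_right) (auto simp: space_nu)
    then have "(\<integral>y. jump_part \<theta> y \<partial>\<nu>) \<le> \<theta>\<^sup>2 * V" by (simp add: V_def)
    moreover have "c * \<theta> \<le> \<bar>c\<bar> * \<theta>\<^sup>2"
      using that by (smt (verit) mult_left_mono mult_right_mono power2_eq_square mult_le_cancel_left1)
    ultimately have "\<psi> \<theta> \<le> \<bar>c\<bar> * \<theta>\<^sup>2 + 1/2 * \<sigma>\<^sup>2 * \<theta>\<^sup>2 + \<theta>\<^sup>2 * V"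
      using that by (simp add: psi_eq)
    also have "\<dots> \<le> (\<bar>c\<bar> + \<sigma>\<^sup>2 + V + 1) * \<theta>\<^sup>2"
      by (simp add: algebra_simps)
    finally show ?thesis .
  qed
  then show ?thesis using V by (intro exI[of _ "\<bar>c\<bar> + \<sigma>\<^sup>2 + V + 1"]) (auto intro!: add_nonneg_pos)
qed

lemma psi_has_derivative:
  assumes "0 < \<theta>"
  shows "(\<psi> has_real_derivative psi' \<theta>) (at \<theta>)"
proof -
  have "((\<lambda>t. (\<integral>y. (jump_part t y - jump_part \<theta> y) / (t - \<theta>) \<partial>\<nu>)) \<longlongrightarrow> (\<integral>y. jump_deriv \<theta> y \<partial>\<nu>)) (at \<theta>)"
    unfolding tendsto_at_iff_sequentially
  proof (intro allI impI, unfold comp_def)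
    fix T assume T: "\<forall>i. T i \<in> UNIV - {\<theta>}" "T \<longlonglongrightarrow> \<theta>"
    have "\<forall>\<^sub>F n in sequentially. \<theta> / 2 < T n" "\<forall>\<^sub>F n in sequentially. T n < 2 * \<theta>"
      using order_tendstoD(1)[OF T(2), of "\<theta> / 2"] order_tendstoD(2)[OF T(2), of "2 * \<theta>"] assms by linarith+
    then have "\<forall>\<^sub>F n in sequentially. \<theta> / 2 < T n \<and> T n < 2 * \<theta>" by eventually_elim auto
    then obtain N where N: "\<And>n. N \<le> n \<Longrightarrow> \<theta> / 2 < T n \<and> T n < 2 * \<theta>"
      by (auto simp: eventually_sequentially)
    have "(\<lambda>n. (\<integral>y. (jump_part (T (n + N)) y - jump_part \<theta> y) / (T (n + N) - \<theta>) \<partial>\<nu>)) \<longlonglongrightarrow> (\<integral>y. jump_deriv \<theta> y \<partial>\<nu>)"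
    proof (rule integral_dominated_convergence)
      show "integrable \<nu> (\<lambda>y. (2 * \<theta> + 1 / (\<theta> / 2)) * min 1 (y\<^sup>2))"
        using integrable_min by (rule integrable_mult_right)
      show "AE y in \<nu>. (\<lambda>i. (jump_part (T (i + N)) y - jump_part \<theta> y) / (T (i + N) - \<theta>)) \<longlonglongrightarrow> jump_deriv \<theta> y"
      proof (rule AE_I2)
        fix y
        have "((\<lambda>t. (jump_part t y - jump_part \<theta> y) / (t - \<theta>)) \<longlongrightarrow> jump_deriv \<theta> y) (at \<theta>)"
          using has_derivative_jump_part[of y \<theta>] by (simp add: has_field_derivative_iff)
        then have "(\<lambda>i. (jump_part (T i) y - jump_part \<theta> y) / (T i - \<theta>)) \<longlonglongrightarrow> jump_deriv \<theta> y"
          using T unfolding tendsto_at_iff_sequentially comp_def by blast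
        then show "(\<lambda>i. (jump_part (T (i + N)) y - jump_part \<theta> y) / (T (i + N) - \<theta>)) \<longlonglongrightarrow> jump_deriv \<theta> y"
          by (rule LIMSEQ_ignore_initial_segment)
      qed
      show "AE y in \<nu>. norm ((jump_part (T (n + N)) y - jump_part \<theta> y) / (T (n + N) - \<theta>))
          \<le> (2 * \<theta> + 1 / (\<theta> / 2)) * min 1 (y\<^sup>2)" for n
      proof (rule AE_I2)
        fix y assume "y \<in> space \<nu>"
        then have y: "0 < y" by (simp add: space_nu)
        let ?t = "T (n + N)"
        have t: "\<theta> / 2 < ?t" "?t < 2 * \<theta>" "?t \<noteq> \<theta>" using N[of "n + N"] T(1) by auto
        \<comment> \<open>The mean value theorem turns the quotient into
          \<open>jump_deriv z y\<close> with \<open>z\<close> between \<theta>/2 and 2\<theta>,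
          where one dominating function serves all \<open>n\<close>.\<close>
        obtain z where z: "min ?t \<theta> < z" "z < max ?t \<theta>"
          "jump_part (max ?t \<theta>) y - jump_part (min ?t \<theta>) y = (max ?t \<theta> - min ?t \<theta>) * jump_deriv z y"
        proof -
          have "min ?t \<theta> < max ?t \<theta>" using t(3) by auto
          from MVT2[OF this, of "\<lambda>t. jump_part t y" "\<lambda>t. jump_deriv t y"] that
          show thesis using has_derivative_jump_part by blast
        qed
        have "(jump_part ?t y - jump_part \<theta> y) / (?t - \<theta>) = jump_deriv z y"
          using z(3) t(3) by (auto simp: min_def max_def field_simps split: if_splits)
        moreover have "\<bar>jump_deriv z y\<bar> \<le> (2 * \<theta> + 1 / (\<theta> / 2)) * min 1 (y\<^sup>2)"
          using z(1,2) t assms y by (intro jump_deriv_bound) (auto simp: min_def max_def split: if_splits)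
        ultimately show "norm ((jump_part ?t y - jump_part \<theta> y) / (?t - \<theta>))
          \<le> (2 * \<theta> + 1 / (\<theta> / 2)) * min 1 (y\<^sup>2)" by simp
      qed
    qed (auto intro!: measurable_nu)
    then show "(\<lambda>n. (\<integral>y. (jump_part (T n) y - jump_part \<theta> y) / (T n - \<theta>) \<partial>\<nu>)) \<longlonglongrightarrow> (\<integral>y. jump_deriv \<theta> y \<partial>\<nu>)"
      by (rule LIMSEQ_offset)
  qed
  moreover have "\<forall>\<^sub>F t in at \<theta>. (\<integral>y. (jump_part t y - jump_part \<theta> y) / (t - \<theta>) \<partial>\<nu>) =
    ((\<integral>y. jump_part t y \<partial>\<nu>) - (\<integral>y. jump_part \<theta> y \<partial>\<nu>)) / (t - \<theta>)"
  proof -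
    have "\<forall>\<^sub>F t in at \<theta>. 0 < t"
      using order_tendstoD(1)[OF tendsto_ident_at assms] .
    then show ?thesis
      using assms by (auto elim!: eventually_mono simp: integrable_jump_part)
  qed
  ultimately have "((\<lambda>t. (\<integral>y. jump_part t y \<partial>\<nu>)) has_real_derivative (\<integral>y. jump_deriv \<theta> y \<partial>\<nu>)) (at \<theta>)"
    unfolding has_field_derivative_iff by (rule Lim_transform_eventually)
  then have "((\<lambda>\<theta>. c * \<theta> + 1 / 2 * \<sigma>\<^sup>2 * \<theta>\<^sup>2 + (\<integral>y. jump_part \<theta> y \<partial>\<nu>)) has_real_derivative psi' \<theta>) (at \<theta>)"
    unfolding psi'_def by (auto intro!: derivative_eq_intros)
  moreover have "\<forall>\<^sub>F t in nhds \<theta>. c * t + 1 / 2 * \<sigma>\<^sup>2 * t\<^sup>2 + (\<integral>y. jump_part t y \<partial>\<nu>) = \<psi> t"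
    using eventually_nhds_in_open[of "{0<..}" \<theta>] assms by (auto elim!: eventually_mono simp: psi_eq)
  ultimately show ?thesis
    by (subst (asm) DERIV_cong_ev) auto
qed

text \<open>\<open>jump_deriv\<close> equals \<open>small_jumps - big_jumps\<close>. As \<theta>
  decreases to 0 the first part is dominated and vanishes, while the second increases to a limit
  that may be infinite.\<close>

definition small_jumps :: "real \<Rightarrow> real \<Rightarrow> real" where
  "small_jumps \<theta> y = y * (1 - exp (- \<theta> * y)) * indicator {y. y < 1} y"

definition big_jumps :: "real \<Rightarrow> real \<Rightarrow> real" where
  "big_jumps \<theta> y = y * exp (- \<theta> * y) * indicator {y. 1 \<le> y} y"

definition big_jump_mean :: ennreal where
  "big_jump_mean = (\<integral>\<^sup>+y. ennreal (y * indicator {y. 1 \<le> y} y) \<partial>\<nu>)"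

lemma measurable_small_big [measurable]:
  "small_jumps \<theta> \<in> borel_measurable borel" "big_jumps \<theta> \<in> borel_measurable borel"
  unfolding small_jumps_def[abs_def] big_jumps_def[abs_def] by measurable

lemma small_jumps_bound:
  assumes "0 \<le> \<theta>" "\<theta> \<le> b" "0 < y" shows "\<bar>small_jumps \<theta> y\<bar> \<le> b * min 1 (y\<^sup>2)"
proof -
  have "1 - exp (- \<theta> * y) \<le> \<theta> * y" using exp_ge_add_one_self[of "- \<theta> * y"] by auto
  also have "\<dots> \<le> b * y" using assms by simp
  finally have "y * (1 - exp (- \<theta> * y)) \<le> b * y\<^sup>2"
    using assms by (simp add: power2_eq_square)
  moreover have "0 \<le> 1 - exp (- \<theta> * y)" using assms by simp
  ultimately show ?thesis using assms
    by (auto simp: small_jumps_def min_one_square indicator_def abs_mult)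
qed

lemma integrable_small_jumps: "0 \<le> \<theta> \<Longrightarrow> integrable \<nu> (small_jumps \<theta>)"
  by (rule integrable_nu[where C=\<theta>]) (auto intro!: small_jumps_bound)

lemma big_jumps_eq: "big_jumps \<theta> y = small_jumps \<theta> y - jump_deriv \<theta> y"
  by (auto simp: big_jumps_def small_jumps_def jump_deriv_def algebra_simps indicator_def)

lemma integrable_big_jumps: "0 < \<theta> \<Longrightarrow> integrable \<nu> (big_jumps \<theta>)"
  unfolding big_jumps_eq by (intro Bochner_Integration.integrable_diff integrable_small_jumps integrable_jump_deriv) auto

lemma psi'_eq:
  "0 < \<theta> \<Longrightarrow> psi' \<theta> = c + \<sigma>\<^sup>2 * \<theta> + (\<integral>y. small_jumps \<theta> y \<partial>\<nu>) - (\<integral>y. big_jumps \<theta> y \<partial>\<nu>)"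
  using integrable_small_jumps[of \<theta>] integrable_jump_deriv[of \<theta>]
  by (simp add: big_jumps_eq psi'_def)

lemma small_jumps_tendsto:
  assumes "\<And>n. 0 < T n" "\<And>n. T n < 1" "T \<longlonglongrightarrow> 0"
  shows "(\<lambda>n. \<integral>y. small_jumps (T n) y \<partial>\<nu>) \<longlonglongrightarrow> 0"
proof -
  have "(\<lambda>n. \<integral>y. small_jumps (T n) y \<partial>\<nu>) \<longlonglongrightarrow> (\<integral>y. 0 \<partial>\<nu>)"
  proof (rule integral_dominated_convergence)
    show "integrable \<nu> (\<lambda>y. 1 * min 1 (y\<^sup>2))" using integrable_min by simp
    show "AE y in \<nu>. (\<lambda>n. small_jumps (T n) y) \<longlonglongrightarrow> 0"
    proof (rule AE_I2)
      fix y
      have "(\<lambda>n. y * (1 - exp (- T n * y)) * indicator {y. y < 1} y) \<longlonglongrightarrow> y * (1 - exp (- 0 * y)) * indicator {y. y < 1} y"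
        by (intro tendsto_intros assms)
      then show "(\<lambda>n. small_jumps (T n) y) \<longlonglongrightarrow> 0" by (simp add: small_jumps_def)
    qed
    show "AE y in \<nu>. norm (small_jumps (T n) y) \<le> 1 * min 1 (y\<^sup>2)" for n
      using small_jumps_bound[of "T n" 1] assms(1,2)[of n] by (intro AE_I2) (auto simp: space_nu)
  qed (auto intro!: measurable_nu)
  then show ?thesis by simp
qed

lemma big_jumps_tendsto:
  assumes "\<And>n. 0 < T n" "decseq T" "T \<longlonglongrightarrow> 0"
  shows "(\<lambda>n. ennreal (\<integral>y. big_jumps (T n) y \<partial>\<nu>)) \<longlonglongrightarrow> big_jump_mean"
proof -
  have "(\<lambda>n. \<integral>\<^sup>+y. ennreal (big_jumps (T n) y) \<partial>\<nu>) \<longlonglongrightarrow> big_jump_mean"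
    unfolding big_jump_mean_def
  proof (rule nn_integral_LIMSEQ)
    show "(\<lambda>y. ennreal (big_jumps (T n) y)) \<in> borel_measurable \<nu>" for n
      by (rule measurable_nu) measurable
    show "incseq (\<lambda>n y. ennreal (big_jumps (T n) y))"
    proof (intro incseq_SucI le_funI ennreal_leI)
      fix n y
      show "big_jumps (T n) y \<le> big_jumps (T (Suc n)) y"
        using decseq_SucD[OF assms(2), of n]
        by (auto simp: big_jumps_def indicator_def intro!: mult_left_mono)
    qed
    show "(\<lambda>n. ennreal (big_jumps (T n) y)) \<longlonglongrightarrow> ennreal (y * indicator {y. 1 \<le> y} y)" for y
    proof -
      have "(\<lambda>n. y * exp (- T n * y) * indicator {y. 1 \<le> y} y) \<longlonglongrightarrow> y * exp (- 0 * y) * indicator {y. 1 \<le> y} y"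
        by (intro tendsto_intros assms)
      then show ?thesis unfolding big_jumps_def by (intro tendsto_ennrealI) simp
    qed
  qed
  moreover have "(\<integral>\<^sup>+y. ennreal (big_jumps (T n) y) \<partial>\<nu>) = ennreal (\<integral>y. big_jumps (T n) y \<partial>\<nu>)" for n
    by (rule nn_integral_eq_integral[OF integrable_big_jumps[OF assms(1)]])
      (auto simp: big_jumps_def indicator_def space_nu)
  ultimately show ?thesis by simp
qed

lemma psi'_tendsto_finite:
  assumes "big_jump_mean = ennreal K" "0 \<le> K"
  shows "(psi' \<longlongrightarrow> c - K) (at_right 0)"
proof (rule tendsto_at_right_sequentially[where b=1])
  fix T :: "nat \<Rightarrow> real" assume T: "\<And>n. 0 < T n" "\<And>n. T n < 1" "decseq T" "T \<longlonglongrightarrow> 0"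
  have "(\<lambda>n. ennreal (\<integral>y. big_jumps (T n) y \<partial>\<nu>)) \<longlonglongrightarrow> ennreal K"
    using big_jumps_tendsto[OF T(1,3,4)] assms by simp
  then have "(\<lambda>n. \<integral>y. big_jumps (T n) y \<partial>\<nu>) \<longlonglongrightarrow> K"
    by (rule tendsto_ennrealD) (use assms(2) in \<open>auto intro!: Bochner_Integration.integral_nonneg simp: big_jumps_def indicator_def\<close>)
  then have "(\<lambda>n. c + \<sigma>\<^sup>2 * T n + (\<integral>y. small_jumps (T n) y \<partial>\<nu>) - (\<integral>y. big_jumps (T n) y \<partial>\<nu>))
     \<longlonglongrightarrow> c + \<sigma>\<^sup>2 * 0 + 0 - K"
    by (intro tendsto_intros small_jumps_tendsto T)
  then show "(\<lambda>n. psi' (T n)) \<longlonglongrightarrow> c - K" by (simp add: psi'_eq T)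
qed simp

lemma psi'_tendsto_infinite:
  assumes "big_jump_mean = \<infinity>"
  shows "((\<lambda>\<theta>. ereal (psi' \<theta>)) \<longlongrightarrow> -\<infinity>) (at_right 0)"
proof (rule tendsto_at_right_sequentially[where b=1])
  fix T :: "nat \<Rightarrow> real" assume T: "\<And>n. 0 < T n" "\<And>n. T n < 1" "decseq T" "T \<longlonglongrightarrow> 0"
  have "(\<lambda>n. ennreal (\<integral>y. big_jumps (T n) y \<partial>\<nu>)) \<longlonglongrightarrow> \<infinity>"
    using big_jumps_tendsto[OF T(1,3,4)] assms by simp
  then have big: "\<forall>\<^sub>F n in sequentially. B < (\<integral>y. big_jumps (T n) y \<partial>\<nu>)" for B :: real
  proof -
    have "\<forall>\<^sub>F n in sequentially. ennreal B < ennreal (\<integral>y. big_jumps (T n) y \<partial>\<nu>)"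
      using \<open>_ \<longlonglongrightarrow> \<infinity>\<close> by (rule order_tendstoD) simp
    then show ?thesis by eventually_elim (metis ennreal_leI leD not_less)
  qed
  have "(\<lambda>n. c + \<sigma>\<^sup>2 * T n + (\<integral>y. small_jumps (T n) y \<partial>\<nu>)) \<longlonglongrightarrow> c + \<sigma>\<^sup>2 * 0 + 0"
    by (intro tendsto_intros small_jumps_tendsto T)
  then have small: "\<forall>\<^sub>F n in sequentially. c + \<sigma>\<^sup>2 * T n + (\<integral>y. small_jumps (T n) y \<partial>\<nu>) < c + 1"
    by (rule order_tendstoD) simp
  show "(\<lambda>n. ereal (psi' (T n))) \<longlonglongrightarrow> -\<infinity>"
    unfolding tendsto_MInfty
  proof
    fix r :: real
    show "\<forall>\<^sub>F n in sequentially. ereal (psi' (T n)) < ereal r"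
      using small big[of "c + 1 - r"] by eventually_elim (simp add: psi'_eq T)
  qed
qed simp

lemma deriv_psi: "0 < \<theta> \<Longrightarrow> deriv \<psi> \<theta> = psi' \<theta>"
  by (rule DERIV_imp_deriv[OF psi_has_derivative])

lemma deriv_psi_tendsto:
  "((\<lambda>\<theta>. ereal (psi' \<theta>)) \<longlongrightarrow> L) (at_right 0) \<Longrightarrow> ((\<lambda>\<theta>. ereal (deriv \<psi> \<theta>)) \<longlongrightarrow> L) (at_right 0)"
  by (erule Lim_transform_eventually) (auto simp: eventually_at_right_field deriv_psi intro!: exI[of _ 1])

text \<open>\<open>deriv_at_0plus\<close> is defined by \<open>Lim\<close> and is meaningful only
  once the limit is known to exist. Existence follows by cases on whether the jumps of size at least
  1 have finite mean.\<close>

lemma deriv_psi_tendsto_at_0plus: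
  "((\<lambda>\<theta>. ereal (psi' \<theta>)) \<longlongrightarrow> deriv_at_0plus \<psi>) (at_right 0)"
proof -
  obtain L where L: "((\<lambda>\<theta>. ereal (psi' \<theta>)) \<longlongrightarrow> L) (at_right 0)"
  proof (cases big_jump_mean)
    case (real K)
    then show ?thesis using psi'_tendsto_finite[of K] that[of "ereal (c - K)"] by auto
  next
    case top
    then show ?thesis using psi'_tendsto_infinite that by auto
  qed
  then have "deriv_at_0plus \<psi> = L"
    unfolding deriv_at_0plus_def by (intro tendsto_Lim deriv_psi_tendsto) simp_all
  with L show ?thesis by simp
qed

lemma jump_part_bound:
  assumes "0 \<le> \<theta>" "\<theta> \<le> 1" "0 < y"
  shows "\<bar>jump_part \<theta> y\<bar> \<le> min 1 (y\<^sup>2)"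
proof (cases "y < 1")
  case True
  have "exp (- (\<theta> * y)) - 1 + \<theta> * y \<le> (\<theta> * y)\<^sup>2 / 2"
    using assms by (intro exp_neg_compensated_le_square) auto
  also have "\<dots> \<le> (1 * y)\<^sup>2 / 2" using assms by (intro divide_right_mono power_mono mult_right_mono) auto
  finally have "exp (- (\<theta> * y)) - 1 + \<theta> * y \<le> y\<^sup>2 / 2" by simp
  moreover have "0 \<le> y\<^sup>2" by simp
  ultimately show ?thesis
    using True assms exp_neg_compensated_nonneg[of "\<theta> * y"] by (simp add: jump_part_def min_one_square)
next
  case False
  have "exp (- \<theta> * y) \<le> 1" using assms by simp
  then have "\<bar>exp (- \<theta> * y) - 1\<bar> \<le> 1" using exp_gt_zero[of "- \<theta> * y"] by linarith
  then show ?thesis using False assms by (simp add: jump_part_def min_one_square)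
qed

lemma psi_tendsto_0: "(\<psi> \<longlongrightarrow> 0) (at_right 0)"
proof (rule tendsto_at_right_sequentially[where b=1])
  fix T :: "nat \<Rightarrow> real" assume T: "\<And>n. 0 < T n" "\<And>n. T n < 1" "decseq T" "T \<longlonglongrightarrow> 0"
  have "(\<lambda>n. \<integral>y. jump_part (T n) y \<partial>\<nu>) \<longlonglongrightarrow> (\<integral>y. 0 \<partial>\<nu>)"
  proof (rule integral_dominated_convergence)
    show "integrable \<nu> (\<lambda>y. min 1 (y\<^sup>2))" using integrable_min by simp
    show "AE y in \<nu>. (\<lambda>n. jump_part (T n) y) \<longlonglongrightarrow> 0"
    proof (rule AE_I2)
      fix y
      have "(\<lambda>n. exp (- T n * y) - 1 + T n * y * indicator {y. y < 1} y) \<longlonglongrightarrow> exp (- 0 * y) - 1 + 0 * y * indicator {y. y < 1} y"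
        by (intro tendsto_intros T)
      then show "(\<lambda>n. jump_part (T n) y) \<longlonglongrightarrow> 0" by (simp add: jump_part_def)
    qed
    show "AE y in \<nu>. norm (jump_part (T n) y) \<le> min 1 (y\<^sup>2)" for n
      using jump_part_bound[of "T n"] T(1,2)[of n] by (intro AE_I2) (auto simp: space_nu less_imp_le)
  qed (auto intro!: measurable_nu)
  then have "(\<lambda>n. c * T n + 1 / 2 * \<sigma>\<^sup>2 * (T n)\<^sup>2 + (\<integral>y. jump_part (T n) y \<partial>\<nu>)) \<longlonglongrightarrow> c * 0 + 1 / 2 * \<sigma>\<^sup>2 * 0\<^sup>2 + (\<integral>y. 0 \<partial>\<nu>)"
    by (intro tendsto_intros T)
  then show "(\<lambda>n. \<psi> (T n)) \<longlonglongrightarrow> 0" using T(1) by (simp add: psi_eq less_imp_le)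
qed simp

text \<open>\<psi> is strictly decreasing on some interval (0, b) and tends to 0 at 0. Hence it is
  at most 0 at b/4 and negative at b/2.\<close>

lemma psi_neg:
  assumes "deriv_at_0plus \<psi> < 0"
  shows "\<exists>\<theta>>0. \<psi> \<theta> < 0"
proof -
  have "\<forall>\<^sub>F \<theta> in at_right 0. ereal (psi' \<theta>) < 0"
    using deriv_psi_tendsto_at_0plus assms by (rule order_tendstoD)
  then obtain b where b: "0 < b" "\<And>\<theta>. 0 < \<theta> \<Longrightarrow> \<theta> < b \<Longrightarrow> psi' \<theta> < 0"
    by (auto simp: eventually_at_right_field zero_ereal_def)
  have less: "\<psi> t < \<psi> s" if "0 < s" "s < t" "t < b" for s t
    using that b by (intro DERIV_neg_imp_decreasing[OF that(2)]) (auto intro!: psi_has_derivative exI)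
  have "\<psi> (b / 4) \<le> 0"
  proof (rule tendsto_lowerbound[OF psi_tendsto_0])
    show "\<forall>\<^sub>F s in at_right 0. \<psi> (b / 4) \<le> \<psi> s"
      unfolding eventually_at_right_field using b(1) less[of _ "b / 4"] by (auto intro!: exI[of _ "b / 4"] less_imp_le)
  qed simp
  with less[of "b / 4" "b / 2"] b(1) show ?thesis by (intro exI[of _ "b / 2"]) auto
qed

definition compensated_part :: "real \<Rightarrow> real" where
  "compensated_part \<theta> = (\<integral>y. (exp (- (\<theta> * y)) - 1 + \<theta> * y) \<partial>\<nu>)"

text \<open>An infinite mean of the large jumps would make the slope minus infinity. With finite
  mean \<open>K\<close>, moving \<open>\<theta> * K\<close> from the linear term into the integral
  compensates all jumps, and the slope becomes \<open>m = c - K\<close>.\<close>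

lemma psi_nonneg_deriv:
  assumes "0 \<le> deriv_at_0plus \<psi>"
  obtains m where "deriv_at_0plus \<psi> = ereal m" "big_jump_mean < \<infinity>"
    "\<And>\<theta>. 0 \<le> \<theta> \<Longrightarrow> integrable \<nu> (\<lambda>y. exp (- (\<theta> * y)) - 1 + \<theta> * y)"
    "\<And>\<theta>. 0 \<le> \<theta> \<Longrightarrow> \<psi> \<theta> = m * \<theta> + 1 / 2 * \<sigma>\<^sup>2 * \<theta>\<^sup>2 + compensated_part \<theta>"
proof (cases big_jump_mean)
  case top
  then have "deriv_at_0plus \<psi> = -\<infinity>"
    using tendsto_unique[OF _ deriv_psi_tendsto_at_0plus psi'_tendsto_infinite] by simp
  with assms show ?thesis by simp
next
  case (real K)
  have m: "deriv_at_0plus \<psi> = ereal (c - K)"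
    using tendsto_unique[OF _ deriv_psi_tendsto_at_0plus] psi'_tendsto_finite[of K] real by simp
  have int: "integrable \<nu> (\<lambda>y. y * indicator {y. 1 \<le> y} y)"
    and K: "(\<integral>y. y * indicator {y. 1 \<le> y} y \<partial>\<nu>) = K"
  proof -
    have "integrable \<nu> (\<lambda>y. y * indicator {y. 1 \<le> y} y) \<and> (\<integral>y. y * indicator {y. 1 \<le> y} y \<partial>\<nu>) = K"
    proof (subst nn_integral_eq_integrable[symmetric])
      show "(\<lambda>y. y * indicator {y. 1 \<le> y} y) \<in> borel_measurable \<nu>" by (rule measurable_nu) measurable
      show "(\<integral>\<^sup>+ y. ennreal (y * indicator {y. 1 \<le> y} y) \<partial>\<nu>) = ennreal K"
        using real by (simp add: big_jump_mean_def)
    qed (use real in \<open>auto simp: indicator_def\<close>)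
    then show "integrable \<nu> (\<lambda>y. y * indicator {y. 1 \<le> y} y)"
      "(\<integral>y. y * indicator {y. 1 \<le> y} y \<partial>\<nu>) = K" by auto
  qed
  have eq: "exp (- (\<theta> * y)) - 1 + \<theta> * y = jump_part \<theta> y + \<theta> * (y * indicator {y. 1 \<le> y} y)" for \<theta> y
    by (auto simp: jump_part_def indicator_def)
  show ?thesis
  proof (rule that[OF m])
    fix \<theta> :: real assume \<theta>: "0 \<le> \<theta>"
    show "integrable \<nu> (\<lambda>y. exp (- (\<theta> * y)) - 1 + \<theta> * y)"
      unfolding eq using int integrable_jump_part[OF \<theta>] by (intro Bochner_Integration.integrable_add integrable_mult_right)
    show "\<psi> \<theta> = (c - K) * \<theta> + 1 / 2 * \<sigma>\<^sup>2 * \<theta>\<^sup>2 + compensated_part \<theta>"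
    proof -
      have "compensated_part \<theta> = (\<integral>y. jump_part \<theta> y \<partial>\<nu>) + \<theta> * K"
        unfolding compensated_part_def eq using int integrable_jump_part[OF \<theta>] K by simp
      then show ?thesis using \<theta> by (simp add: psi_eq algebra_simps)
    qed
  qed (use real in simp)
qed

end

section \<open>Convexity estimates for an exponent with finite non-negative slope at 0\<close>

locale levy_exponent_mean = levy_exponent +
  fixes m :: real
  assumes m_nonneg: "0 \<le> m"
    and big_jump_mean_finite: "big_jump_mean < \<infinity>"
    and integrable_compensated: "\<And>\<theta>. 0 \<le> \<theta> \<Longrightarrow> integrable \<nu> (\<lambda>y. exp (- (\<theta> * y)) - 1 + \<theta> * y)"
    and psi_mean: "\<And>\<theta>. 0 \<le> \<theta> \<Longrightarrow> \<psi> \<theta> = m * \<theta> + 1 / 2 * \<sigma>\<^sup>2 * \<theta>\<^sup>2 + compensated_part \<theta>"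
    and deriv_psi_0plus: "deriv_at_0plus \<psi> = ereal m"
begin

lemma compensated_part_nonneg: "0 \<le> compensated_part \<theta>"
  unfolding compensated_part_def
  by (rule Bochner_Integration.integral_nonneg) (simp add: exp_neg_compensated_nonneg)

lemma psi_ge: "0 \<le> \<theta> \<Longrightarrow> m * \<theta> \<le> \<psi> \<theta>"
  using compensated_part_nonneg[of \<theta>] by (simp add: psi_mean)

lemma psi_nonneg: "0 \<le> \<theta> \<Longrightarrow> 0 \<le> \<psi> \<theta>"
  using psi_ge[of \<theta>] mult_nonneg_nonneg[OF m_nonneg, of \<theta>] by linarith

lemma psi_scale_le:
  assumes "0 \<le> r" "r \<le> 1" "0 \<le> \<theta>"
  shows "\<psi> (r * \<theta>) \<le> r * \<psi> \<theta>"
proof -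
  have "compensated_part (r * \<theta>) \<le> (\<integral>y. r * (exp (- (\<theta> * y)) - 1 + \<theta> * y) \<partial>\<nu>)"
    unfolding compensated_part_def
    using assms exp_neg_compensated_scale_le[of r "\<theta> * _"]
    by (intro integral_mono integrable_compensated integrable_mult_right) (auto simp: mult.assoc)
  also have "\<dots> = r * compensated_part \<theta>" by (simp add: compensated_part_def)
  finally have "compensated_part (r * \<theta>) \<le> r * compensated_part \<theta>" .
  moreover have "r\<^sup>2 \<le> r" using assms by (simp add: power2_eq_square mult_left_le)
  then have "\<sigma>\<^sup>2 * \<theta>\<^sup>2 * r\<^sup>2 \<le> \<sigma>\<^sup>2 * \<theta>\<^sup>2 * r" by (intro mult_left_mono) auto
  ultimately show ?thesis using assms by (simp add: psi_mean power_mult_distrib algebra_simps)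
qed

text \<open>\<open>\<psi> \<theta> / \<theta>\<^sup>2\<close> decreases, so \<psi> vanishes at most
  quadratically at 0. This is the source of the critical order 1/2.\<close>

lemma psi_scale_ge:
  assumes "m = 0" "0 \<le> r" "r \<le> 1" "0 \<le> \<theta>"
  shows "r\<^sup>2 * \<psi> \<theta> \<le> \<psi> (r * \<theta>)"
proof -
  have "(\<integral>y. r\<^sup>2 * (exp (- (\<theta> * y)) - 1 + \<theta> * y) \<partial>\<nu>) \<le> compensated_part (r * \<theta>)"
    unfolding compensated_part_def
    using assms exp_neg_compensated_scale_ge[of r "\<theta> * _"]
    by (intro integral_mono integrable_compensated integrable_mult_right) (auto simp: mult.assoc space_nu)
  moreover have "(\<integral>y. r\<^sup>2 * (exp (- (\<theta> * y)) - 1 + \<theta> * y) \<partial>\<nu>) = r\<^sup>2 * compensated_part \<theta>"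
    by (simp add: compensated_part_def)
  ultimately show ?thesis using assms by (simp add: psi_mean power_mult_distrib algebra_simps)
qed

lemma psi_ratio_mono: "0 < \<theta> \<Longrightarrow> \<theta> \<le> \<theta>' \<Longrightarrow> \<psi> \<theta> / \<theta> \<le> \<psi> \<theta>' / \<theta>'"
  using psi_scale_le[of "\<theta> / \<theta>'" \<theta>'] by (simp add: field_simps)

lemma psi_ratio_tendsto: "((\<lambda>\<theta>. \<psi> \<theta> / \<theta>) \<longlongrightarrow> m) (at_right 0)"
proof (rule tendsto_at_right_sequentially[where b=1])
  fix T :: "nat \<Rightarrow> real" assume T: "\<And>n. 0 < T n" "\<And>n. T n < 1" "decseq T" "T \<longlonglongrightarrow> 0"
  have deriv: "((\<lambda>\<theta>. psi' \<theta>) \<longlongrightarrow> m) (at_right 0)"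
    using deriv_psi_tendsto_at_0plus by (simp add: deriv_psi_0plus)
  \<comment> \<open>Monotonicity of \<open>\<psi> \<theta> / \<theta>\<close> makes every secant
    slope on the left of \<open>t\<close> at least \<open>\<psi> t / t\<close>, and the derivative
    is their limit. The ratio is thus squeezed between \<open>m\<close> and
    \<open>psi'\<close>.\<close>
  have le: "\<psi> t / t \<le> psi' t" if "0 < t" for t
  proof -
    have "((\<lambda>s. (\<psi> s - \<psi> t) / (s - t)) \<longlongrightarrow> psi' t) (at_left t)"
      using psi_has_derivative[OF that] unfolding has_field_derivative_iff
      by (rule filterlim_mono[OF _ order_refl at_le]) auto
    moreover have "\<forall>\<^sub>F s in at_left t. \<psi> t / t \<le> (\<psi> s - \<psi> t) / (s - t)"
    proof -
      have "\<psi> t / t \<le> (\<psi> s - \<psi> t) / (s - t)" if s: "0 < s" "s < t" for s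
      proof -
        have "\<psi> s * t \<le> \<psi> t * s" using psi_ratio_mono[of s t] s by (simp add: field_simps)
        then have "\<psi> t * (t - s) \<le> (\<psi> t - \<psi> s) * t" by (simp add: algebra_simps)
        then have "\<psi> t / t \<le> (\<psi> t - \<psi> s) / (t - s)" using s by (simp add: field_simps)
        also have "\<dots> = (\<psi> s - \<psi> t) / (s - t)" using s by (simp add: field_simps)
        finally show ?thesis .
      qed
      then show ?thesis unfolding eventually_at_left_field using that by (auto intro!: exI[of _ 0])
    qed
    ultimately show ?thesis by (rule tendsto_lowerbound) simp
  qed
  show "(\<lambda>n. \<psi> (T n) / T n) \<longlonglongrightarrow> m"
  proof (rule real_tendsto_sandwich[where f="\<lambda>_. m" and h="\<lambda>n. psi' (T n)"])
    show "\<forall>\<^sub>F n in sequentially. m \<le> \<psi> (T n) / T n"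
      using psi_ge[OF less_imp_le[OF T(1)]] T(1) by (intro always_eventually allI) (simp add: pos_le_divide_eq)
    show "\<forall>\<^sub>F n in sequentially. \<psi> (T n) / T n \<le> psi' (T n)"
      using le T(1) by (intro always_eventually allI) auto
    show "(\<lambda>n. psi' (T n)) \<longlonglongrightarrow> m"
      using T(1,4) by (intro filterlim_compose[OF deriv]) (auto simp: filterlim_at less_imp_neq[symmetric] intro!: always_eventually)
  qed simp
qed simp

end

section \<open>Depth of a random walk\<close>

text \<open>\<open>walk_low x j n\<close> is the maximum over \<open>k \<le> n\<close> of \<open>- (x\<^sub>j + \<dots> + x\<^sub>j\<^sub>+\<^sub>k\<^sub>-\<^sub>1)\<close>. Recursion on the first
  step separates it from the depth of the remaining walk, of which it is independent (Lindley).\<close>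

fun walk_low :: "(nat \<Rightarrow> real) \<Rightarrow> nat \<Rightarrow> nat \<Rightarrow> real" where
  "walk_low x j 0 = 0"
| "walk_low x j (Suc n) = max 0 (walk_low x (Suc j) n - x j)"

lemma walk_low_nonneg: "0 \<le> walk_low x j n"
  by (cases n) auto

lemma walk_low_cong: "(\<And>i. j \<le> i \<Longrightarrow> i < j + n \<Longrightarrow> x i = y i) \<Longrightarrow> walk_low x j n = walk_low y j n"
  by (induction n arbitrary: j) auto

lemma walk_low_le_iff:
  "0 \<le> a \<Longrightarrow> walk_low x j n \<le> a \<longleftrightarrow> (\<forall>k\<le>n. - (\<Sum>i<k. x (j + i)) \<le> a)"
proof (induction n arbitrary: j a)
  case (Suc n)
  have "walk_low x j (Suc n) \<le> a \<longleftrightarrow> walk_low x (Suc j) n \<le> a + x j"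
    using Suc.prems by auto
  also have "\<dots> \<longleftrightarrow> (\<forall>k\<le>n. - (\<Sum>i<k. x (Suc j + i)) \<le> a + x j)"
  proof (cases "0 \<le> a + x j")
    case True
    then show ?thesis by (rule Suc.IH)
  next
    case False
    \<comment> \<open>Here both sides are false: the depth is non-negative, and \<open>k = 0\<close>
      gives the empty sum.\<close>
    then show ?thesis using walk_low_nonneg[of x "Suc j" n] by (auto intro!: exI[of _ 0])
  qed
  also have "\<dots> \<longleftrightarrow> (\<forall>k\<le>n. - (\<Sum>i<Suc k. x (j + i)) \<le> a)"
  proof -
    have "(\<Sum>i<Suc k. x (j + i)) = x j + (\<Sum>i<k. x (Suc j + i))" for k
      by (simp add: sum.lessThan_Suc_shift del: sum.lessThan_Suc)
    then have "- (\<Sum>i<k. x (Suc j + i)) \<le> a + x j \<longleftrightarrow> - (\<Sum>i<Suc k. x (j + i)) \<le> a" for k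
      unfolding \<open>(\<Sum>i<Suc k. x (j + i)) = x j + (\<Sum>i<k. x (Suc j + i))\<close> by linarith
    then show ?thesis by simp
  qed
  also have "\<dots> \<longleftrightarrow> (\<forall>k\<le>Suc n. - (\<Sum>i<k. x (j + i)) \<le> a)"
    using Suc.prems unfolding less_Suc_eq_le[symmetric] All_less_Suc2[of "Suc n"] by simp
  finally show ?case .
qed simp

lemma walk_low_mono: "n \<le> n' \<Longrightarrow> walk_low x j n \<le> walk_low x j n'"
  using walk_low_le_iff[of "walk_low x j n'" x j n] walk_low_le_iff[of "walk_low x j n'" x j n']
    walk_low_nonneg[of x j n'] by auto

text \<open>Independence is asked of finitely many steps at a time, the form in which the increments
  of \<open>X\<close> supply it. Exponential moments are asked only for \<theta> \<ge> 0, since the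
  left tail of a step may be heavy.\<close>

locale walk = prob_space M for M :: "'a measure" +
  fixes \<xi> :: "nat \<Rightarrow> 'a \<Rightarrow> real" and \<mu> :: "real measure"
  assumes indep_steps: "\<And>N. indep_vars (\<lambda>_. borel) \<xi> {..<N}"
    and distr_step: "\<And>i. distr M borel (\<xi> i) = \<mu>"
    and integrable_exp_step: "\<And>\<theta>. 0 \<le> \<theta> \<Longrightarrow> integrable M (\<lambda>\<omega>. exp (\<theta> * \<xi> 0 \<omega>))"
begin

lemma measurable_step [measurable]: "\<xi> i \<in> borel_measurable M"
  using indep_steps[of "Suc i"] by (auto simp: indep_vars_def2)

definition low :: "nat \<Rightarrow> nat \<Rightarrow> 'a \<Rightarrow> real" where
  "low j n \<omega> = walk_low (\<lambda>i. \<xi> i \<omega>) j n"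

lemma low_simps: "low j 0 \<omega> = 0" "low j (Suc n) \<omega> = max 0 (low (Suc j) n \<omega> - \<xi> j \<omega>)"
  by (simp_all add: low_def)

lemma low_nonneg: "0 \<le> low j n \<omega>"
  by (simp add: low_def walk_low_nonneg)

lemma low_mono: "n \<le> n' \<Longrightarrow> low j n \<omega> \<le> low j n' \<omega>"
  by (simp add: low_def walk_low_mono)

lemma measurable_walk_low:
  "{j..<j+n} \<subseteq> I \<Longrightarrow> (\<lambda>x. walk_low x j n) \<in> borel_measurable (PiM I (\<lambda>_. borel))"
proof (induction n arbitrary: j)
  case (Suc n)
  have [measurable]: "(\<lambda>x. x j) \<in> borel_measurable (PiM I (\<lambda>_. borel :: real measure))"
    using Suc.prems by (intro measurable_component_singleton) auto
  have [measurable]: "(\<lambda>x. walk_low x (Suc j) n) \<in> borel_measurable (PiM I (\<lambda>_. borel))"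
    using Suc.prems by (intro Suc.IH) auto
  show ?case by simp
qed simp

lemma measurable_low [measurable]: "low j n \<in> borel_measurable M"
proof (induction n arbitrary: j)
  case (Suc n)
  note Suc.IH[of "Suc j", measurable]
  show ?case by (simp add: low_simps(2)[abs_def])
qed (simp add: low_simps(1)[abs_def])

lemma indep_step_low: "indep_var borel (\<xi> j) borel (low (Suc j) n)"
proof -
  define N where "N = j + 1 + n"
  have "indep_var (PiM {j} (\<lambda>_. borel)) (\<lambda>\<omega>. restrict (\<lambda>i. \<xi> i \<omega>) {j})
      (PiM {Suc j..<Suc j + n} (\<lambda>_. borel)) (\<lambda>\<omega>. restrict (\<lambda>i. \<xi> i \<omega>) {Suc j..<Suc j + n})"
    by (rule indep_var_restrict[OF indep_steps[of N]]) (auto simp: N_def)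
  then have "indep_var borel ((\<lambda>x. x j) \<circ> (\<lambda>\<omega>. restrict (\<lambda>i. \<xi> i \<omega>) {j}))
      borel ((\<lambda>x. walk_low x (Suc j) n) \<circ> (\<lambda>\<omega>. restrict (\<lambda>i. \<xi> i \<omega>) {Suc j..<Suc j + n}))"
    by (rule indep_var_compose) (auto intro!: measurable_component_singleton measurable_walk_low)
  moreover have "(\<lambda>x. x j) \<circ> (\<lambda>\<omega>. restrict (\<lambda>i. \<xi> i \<omega>) {j}) = \<xi> j" by auto
  moreover have "(\<lambda>x. walk_low x (Suc j) n) \<circ> (\<lambda>\<omega>. restrict (\<lambda>i. \<xi> i \<omega>) {Suc j..<Suc j + n}) = low (Suc j) n"
    by (auto simp: low_def fun_eq_iff intro!: walk_low_cong)
  ultimately show ?thesis by simp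
qed

text \<open>By independence and induction the law is the image of \<open>\<mu>\<close> times the law
  of \<open>low 0 n\<close> under \<open>(x, y) \<mapsto> max 0 (y - x)\<close>, in which
  \<open>j\<close> no longer occurs.\<close>

lemma distr_low: "distr M borel (low j n) = distr M borel (low 0 n)"
proof (induction n arbitrary: j)
  case (Suc n)
  have *: "distr M borel (low j (Suc n)) =
    distr (\<mu> \<Otimes>\<^sub>M distr M borel (low 0 n)) borel (\<lambda>(x, y). max 0 (y - x))" for j
  proof -
    have "\<mu> \<Otimes>\<^sub>M distr M borel (low 0 n) = distr M borel (\<xi> j) \<Otimes>\<^sub>M distr M borel (low (Suc j) n)"
      using Suc.IH[of "Suc j"] by (simp add: distr_step)
    also have "\<dots> = distr M (borel \<Otimes>\<^sub>M borel) (\<lambda>\<omega>. (\<xi> j \<omega>, low (Suc j) n \<omega>))"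
      using indep_step_low[of j n] by (simp add: indep_var_distribution_eq)
    finally show ?thesis
      by (simp add: distr_distr comp_def low_simps(2)[abs_def])
  qed
  show ?case unfolding *[of j] *[of 0] ..
qed (simp add: low_simps(1)[abs_def])

lemma expectation_low:
  fixes f :: "real \<Rightarrow> real"
  assumes [measurable]: "f \<in> borel_measurable borel"
  shows "expectation (\<lambda>\<omega>. f (low j n \<omega>)) = expectation (\<lambda>\<omega>. f (low 0 n \<omega>))"
proof -
  have "expectation (\<lambda>\<omega>. f (low j n \<omega>)) = integral\<^sup>L (distr M borel (low j n)) f"
    by (simp add: integral_distr)
  also have "\<dots> = integral\<^sup>L (distr M borel (low 0 n)) f" by (subst distr_low) simp
  also have "\<dots> = expectation (\<lambda>\<omega>. f (low 0 n \<omega>))" by (simp add: integral_distr)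
  finally show ?thesis .
qed

definition mgf :: "real \<Rightarrow> real" where "mgf \<theta> = expectation (\<lambda>\<omega>. exp (\<theta> * \<xi> 0 \<omega>))"

definition low_lap :: "real \<Rightarrow> nat \<Rightarrow> real" where "low_lap \<theta> n = expectation (\<lambda>\<omega>. exp (- \<theta> * low 0 n \<omega>))"

text \<open>What the cut at 0 in Lindley's recursion discards:
  \<open>low 1 n - \<xi> 0 = low 0 (Suc n) - over n\<close>.\<close>

definition over :: "nat \<Rightarrow> 'a \<Rightarrow> real" where "over n \<omega> = max 0 (\<xi> 0 \<omega> - low 1 n \<omega>)"

definition over_lap :: "real \<Rightarrow> nat \<Rightarrow> real" where "over_lap \<theta> n = expectation (\<lambda>\<omega>. exp (\<theta> * over n \<omega>) - 1)"

lemma measurable_over [measurable]: "over n \<in> borel_measurable M"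
  unfolding over_def[abs_def] by measurable

lemma over_nonneg: "0 \<le> over n \<omega>"
  by (simp add: over_def)

lemma over_le: "over n \<omega> \<le> max 0 (\<xi> 0 \<omega>)"
  using low_nonneg[of 1 n \<omega>] by (simp add: over_def)

lemma integrable_exp_low: "0 \<le> \<theta> \<Longrightarrow> integrable M (\<lambda>\<omega>. exp (- \<theta> * low j n \<omega>))"
  by (rule integrable_const_bound[where B=1]) (auto simp: low_nonneg)

lemma integrable_exp_over: "0 \<le> \<theta> \<Longrightarrow> integrable M (\<lambda>\<omega>. exp (\<theta> * over n \<omega>))"
proof (rule Bochner_Integration.integrable_bound)
  assume \<theta>: "0 \<le> \<theta>"
  show "integrable M (\<lambda>\<omega>. 1 + exp (\<theta> * \<xi> 0 \<omega>))" using integrable_exp_step[OF \<theta>] by simp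
  show "AE \<omega> in M. norm (exp (\<theta> * over n \<omega>)) \<le> norm (1 + exp (\<theta> * \<xi> 0 \<omega>))"
  proof (rule AE_I2)
    fix \<omega>
    have "exp (\<theta> * over n \<omega>) \<le> exp (\<theta> * max 0 (\<xi> 0 \<omega>))" using over_le[of n \<omega>] \<theta> by (simp add: mult_left_mono)
    also have "\<dots> \<le> 1 + exp (\<theta> * \<xi> 0 \<omega>)" by (auto simp: max_def)
    finally show "norm (exp (\<theta> * over n \<omega>)) \<le> norm (1 + exp (\<theta> * \<xi> 0 \<omega>))" by simp
  qed
qed simp

lemma low_lap_le_1: "0 \<le> \<theta> \<Longrightarrow> low_lap \<theta> n \<le> 1"
  unfolding low_lap_def using integral_mono[OF integrable_exp_low[of \<theta> 0 n], of "\<lambda>_. 1"]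
  by (simp add: low_nonneg prob_space)

lemma low_lap_nonneg: "0 \<le> low_lap \<theta> n"
  unfolding low_lap_def by (rule Bochner_Integration.integral_nonneg) simp

lemma low_lap_antimono: "0 \<le> \<theta> \<Longrightarrow> n \<le> n' \<Longrightarrow> low_lap \<theta> n' \<le> low_lap \<theta> n"
  unfolding low_lap_def by (intro integral_mono integrable_exp_low) (auto simp: low_mono mult_left_mono)

lemma low_lap_zero: "low_lap \<theta> 0 = 1"
  by (simp add: low_lap_def low_simps prob_space)

text \<open>For fixed \<open>z\<close> the chord slope
  \<open>(exp (\<theta> * z) - 1) / \<theta>\<close> increases in \<theta> by convexity.\<close>

lemma over_lap_ratio_mono:
  assumes "0 < \<theta>'" "\<theta>' \<le> \<theta>"
  shows "over_lap \<theta>' n / \<theta>' \<le> over_lap \<theta> n / \<theta>"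
proof -
  have "exp (\<theta>' * z) - 1 \<le> (\<theta>' / \<theta>) * (exp (\<theta> * z) - 1)" for z :: real
    using one_minus_exp_neg_scale[of "\<theta>' / \<theta>" "- (\<theta> * z)"] assms by (simp add: algebra_simps)
  then have "over_lap \<theta>' n \<le> expectation (\<lambda>\<omega>. (\<theta>' / \<theta>) * (exp (\<theta> * over n \<omega>) - 1))"
    unfolding over_lap_def using assms
    by (intro integral_mono integrable_mult_right Bochner_Integration.integrable_diff integrable_exp_over) auto
  also have "\<dots> = (\<theta>' / \<theta>) * over_lap \<theta> n" by (simp add: over_lap_def)
  finally show ?thesis using assms by (simp add: field_simps)
qed

text \<open>A converse to \<open>over_lap_ratio_mono\<close>. Up to \<epsilon> both transforms are
  nearly linear: \<open>exp (\<theta> * z) - 1 \<le> \<theta> * z * exp (\<theta> *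
  \<epsilon>)\<close> and \<open>\<theta>' * z \<le> exp (\<theta>' * z) - 1\<close>. An overshoot
  beyond \<epsilon> requires a step beyond \<epsilon>, which is negligible on a fine mesh.\<close>

lemma over_lap_ratio_upper:
  assumes "0 < \<theta>'" "\<theta>' \<le> \<theta>" "0 < \<epsilon>"
  shows "over_lap \<theta> n \<le> \<theta> * exp (\<theta> * \<epsilon>) * (over_lap \<theta>' n / \<theta>')
     + expectation (\<lambda>\<omega>. exp (\<theta> * \<xi> 0 \<omega>) * indicator {x. \<epsilon> < x} (\<xi> 0 \<omega>))"
proof -
  have int: "integrable M (\<lambda>\<omega>. exp (\<theta> * \<xi> 0 \<omega>) * indicator {x. \<epsilon> < x} (\<xi> 0 \<omega>))"
    using assms integrable_exp_step[of \<theta>]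
    by (rule_tac Bochner_Integration.integrable_bound[of _ "\<lambda>\<omega>. exp (\<theta> * \<xi> 0 \<omega>)"]) (auto simp: indicator_def)
  have "exp (\<theta> * over n \<omega>) - 1 \<le> \<theta> * exp (\<theta> * \<epsilon>) / \<theta>' * (exp (\<theta>' * over n \<omega>) - 1)
     + exp (\<theta> * \<xi> 0 \<omega>) * indicator {x. \<epsilon> < x} (\<xi> 0 \<omega>)" for \<omega>
  proof (cases "over n \<omega> \<le> \<epsilon>")
    case True
    let ?o = "over n \<omega>"
    have "exp (\<theta> * ?o) * (1 - \<theta> * ?o) \<le> exp (\<theta> * ?o) * exp (- (\<theta> * ?o))"
      using exp_ge_add_one_self[of "- (\<theta> * ?o)"] by (intro mult_left_mono) auto
    then have "exp (\<theta> * ?o) - 1 \<le> \<theta> * ?o * exp (\<theta> * ?o)"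
      by (simp add: algebra_simps exp_minus)
    also have "\<dots> \<le> \<theta> * ?o * exp (\<theta> * \<epsilon>)"
      using True assms over_nonneg[of n \<omega>] by (intro mult_left_mono) auto
    also have "?o \<le> (exp (\<theta>' * ?o) - 1) / \<theta>'"
      using exp_ge_add_one_self[of "\<theta>' * ?o"] assms by (simp add: field_simps)
    then have "\<theta> * ?o * exp (\<theta> * \<epsilon>) \<le> \<theta> * ((exp (\<theta>' * ?o) - 1) / \<theta>') * exp (\<theta> * \<epsilon>)"
      using assms by (intro mult_left_mono mult_right_mono) auto
    also have "\<dots> = \<theta> * exp (\<theta> * \<epsilon>) / \<theta>' * (exp (\<theta>' * ?o) - 1)" by simp
    finally show ?thesis by (simp add: add_increasing2)
  next
    case False
    then have "over n \<omega> \<le> \<xi> 0 \<omega>" "\<epsilon> < \<xi> 0 \<omega>"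
      using over_le[of n \<omega>] assms by (auto simp: max_def split: if_splits)
    then have "exp (\<theta> * over n \<omega>) - 1 \<le> exp (\<theta> * \<xi> 0 \<omega>)"
      using assms by (smt (verit) exp_le_cancel_iff mult_left_mono)
    then show ?thesis using \<open>\<epsilon> < \<xi> 0 \<omega>\<close> assms over_nonneg[of n \<omega>]
      by (simp add: add_increasing)
  qed
  then have "over_lap \<theta> n \<le> expectation (\<lambda>\<omega>. \<theta> * exp (\<theta> * \<epsilon>) / \<theta>' * (exp (\<theta>' * over n \<omega>) - 1)
     + exp (\<theta> * \<xi> 0 \<omega>) * indicator {x. \<epsilon> < x} (\<xi> 0 \<omega>))"
    unfolding over_lap_def using assms int
    by (intro integral_mono integrable_mult_right Bochner_Integration.integrable_diff
       Bochner_Integration.integrable_add integrable_exp_over) auto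
  also have "\<dots> = expectation (\<lambda>\<omega>. \<theta> * exp (\<theta> * \<epsilon>) / \<theta>' * (exp (\<theta>' * over n \<omega>) - 1))
     + expectation (\<lambda>\<omega>. exp (\<theta> * \<xi> 0 \<omega>) * indicator {x. \<epsilon> < x} (\<xi> 0 \<omega>))"
    using assms int
    by (intro Bochner_Integration.integral_add integrable_mult_right Bochner_Integration.integrable_diff integrable_exp_over) auto
  also have "expectation (\<lambda>\<omega>. \<theta> * exp (\<theta> * \<epsilon>) / \<theta>' * (exp (\<theta>' * over n \<omega>) - 1)) = \<theta> * exp (\<theta> * \<epsilon>) * (over_lap \<theta>' n / \<theta>')"
    unfolding over_lap_def by (subst integral_mult_right_zero) simp
  finally show ?thesis .
qed

lemma low_lap_Suc:
  assumes "0 \<le> \<theta>"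
  shows "low_lap \<theta> (Suc n) = mgf \<theta> * low_lap \<theta> n - over_lap \<theta> n"
proof -
  have ind: "indep_var borel (\<lambda>\<omega>. exp (\<theta> * \<xi> 0 \<omega>)) borel (\<lambda>\<omega>. exp (- \<theta> * low 1 n \<omega>))"
    using indep_var_compose[OF indep_step_low[of 0 n], of "\<lambda>x. exp (\<theta> * x)" borel "\<lambda>x. exp (- \<theta> * x)" borel]
    by (simp add: comp_def)
  have "expectation (\<lambda>\<omega>. exp (\<theta> * \<xi> 0 \<omega>) * exp (- \<theta> * low 1 n \<omega>)) = mgf \<theta> * low_lap \<theta> n"
    using indep_var_lebesgue_integral[OF ind integrable_exp_step integrable_exp_low] assms
      expectation_low[of "\<lambda>x. exp (- \<theta> * x)" 1 n] by (simp add: mgf_def low_lap_def)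
  moreover have "integrable M (\<lambda>\<omega>. exp (\<theta> * \<xi> 0 \<omega>) * exp (- \<theta> * low 1 n \<omega>))"
    using indep_var_integrable[OF ind integrable_exp_step integrable_exp_low] assms by simp
  \<comment> \<open>Put \<open>z = \<xi> 0 \<omega> - low 1 n \<omega>\<close>. For
    \<open>z \<le> 0\<close> the correction vanishes; for \<open>z > 0\<close> both sides equal
    1.\<close>
  moreover have "exp (- \<theta> * low 0 (Suc n) \<omega>) = exp (\<theta> * \<xi> 0 \<omega>) * exp (- \<theta> * low 1 n \<omega>) - (exp (\<theta> * over n \<omega>) - 1)" for \<omega>
    by (auto simp: low_simps over_def max_def algebra_simps simp flip: exp_add)
  ultimately show ?thesis
    using integrable_exp_over[OF assms, of n] by (simp add: low_lap_def over_lap_def)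
qed

definition low_lap_sum :: "real \<Rightarrow> nat \<Rightarrow> real" where "low_lap_sum \<theta> n = (\<Sum>k<n. low_lap \<theta> k)"

definition over_lap_sum :: "real \<Rightarrow> nat \<Rightarrow> real" where "over_lap_sum \<theta> n = (\<Sum>k<n. over_lap \<theta> k)"

lemma low_lap_sum_eq: "0 \<le> \<theta> \<Longrightarrow> (mgf \<theta> - 1) * low_lap_sum \<theta> n = over_lap_sum \<theta> n - 1 + low_lap \<theta> n"
  by (induction n) (simp_all add: low_lap_sum_def over_lap_sum_def low_lap_zero low_lap_Suc algebra_simps)

lemma over_lap_sum_ratio_mono: "0 < \<theta>' \<Longrightarrow> \<theta>' \<le> \<theta> \<Longrightarrow> over_lap_sum \<theta>' n / \<theta>' \<le> over_lap_sum \<theta> n / \<theta>"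
  unfolding over_lap_sum_def sum_divide_distrib by (intro sum_mono over_lap_ratio_mono)

text \<open>With \<open>b = low_lap \<theta>' n\<close>, the identity gives
  \<open>D \<ge> 1 - b\<close>, and since \<open>low_lap\<close> decreases in \<open>n\<close> also
  \<open>D \<ge> s * b\<close>. Adding \<open>s\<close> times the first bound to the second
  eliminates \<open>b\<close>.\<close>

lemma over_lap_sum_lower:
  assumes "0 < \<theta>'" "\<theta>' \<le> \<theta>" "0 \<le> s" "s \<le> n * (mgf \<theta>' - 1)"
  shows "s / (1 + s) / \<theta>' \<le> over_lap_sum \<theta> n / \<theta>"
proof -
  have D: "over_lap_sum \<theta>' n = 1 - low_lap \<theta>' n + (mgf \<theta>' - 1) * low_lap_sum \<theta>' n" using low_lap_sum_eq[of \<theta>' n] assms by simp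
  have 1: "n * low_lap \<theta>' n \<le> low_lap_sum \<theta>' n"
    unfolding low_lap_sum_def using sum_mono[of "{..<n}" "\<lambda>_. low_lap \<theta>' n" "low_lap \<theta>'"] low_lap_antimono[of \<theta>' _ n] assms by simp
  have "0 \<le> n * (mgf \<theta>' - 1)" using assms(3,4) by linarith
  then have mgf: "0 \<le> mgf \<theta>' - 1 \<or> n = 0" by (auto simp: zero_le_mult_iff)
  have "s * low_lap \<theta>' n \<le> (mgf \<theta>' - 1) * (n * low_lap \<theta>' n)"
    using mult_right_mono[OF assms(4) low_lap_nonneg[of \<theta>' n]] by (simp add: algebra_simps)
  also have "\<dots> \<le> (mgf \<theta>' - 1) * low_lap_sum \<theta>' n"
    using mgf 1 by (auto intro: mult_left_mono simp: low_lap_sum_def)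
  finally have "1 - low_lap \<theta>' n + s * low_lap \<theta>' n \<le> over_lap_sum \<theta>' n" "0 \<le> (mgf \<theta>' - 1) * low_lap_sum \<theta>' n"
    using D assms low_lap_nonneg[of \<theta>' n] by (auto intro: order_trans[OF mult_nonneg_nonneg])
  then have *: "1 - low_lap \<theta>' n \<le> over_lap_sum \<theta>' n" "s * low_lap \<theta>' n \<le> over_lap_sum \<theta>' n" 
    using D low_lap_le_1[of \<theta>' n] assms by auto
  have "s / (1 + s) \<le> over_lap_sum \<theta>' n"
  proof -
    have "s * (1 - low_lap \<theta>' n) \<le> s * over_lap_sum \<theta>' n" using * assms by (intro mult_left_mono) auto
    then have "s \<le> (1 + s) * over_lap_sum \<theta>' n" using * by (simp add: algebra_simps)
    then show ?thesis using assms by (simp add: field_simps)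
  qed
  then have "s / (1 + s) / \<theta>' \<le> over_lap_sum \<theta>' n / \<theta>'" using assms by (intro divide_right_mono) auto
  also have "\<dots> \<le> over_lap_sum \<theta> n / \<theta>" using assms by (intro over_lap_sum_ratio_mono)
  finally show ?thesis .
qed

text \<open>Pointwise, \<open>exp (- \<theta> * w)\<close> is at most 1 for \<open>w \<le> x\<close>
  and at most \<open>exp (- (\<theta> - 1) * x) * exp (- w)\<close> beyond. Subtracting the
  transform at 1 with this weight removes the depths above \<open>x\<close>.\<close>

lemma prob_low_lower:
  assumes "0 \<le> x" "1 \<le> \<theta>"
  shows "low_lap \<theta> k - exp (- (\<theta> - 1) * x) * low_lap 1 k \<le> prob {\<omega>\<in>space M. low 0 k \<omega> \<le> x}"
proof -
  have "exp (- \<theta> * low 0 k \<omega>) \<le> indicator {\<omega>\<in>space M. low 0 k \<omega> \<le> x} \<omega> + exp (- (\<theta> - 1) * x) * exp (- 1 * low 0 k \<omega>)"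
    if "\<omega> \<in> space M" for \<omega>
  proof (cases "low 0 k \<omega> \<le> x")
    case True
    then show ?thesis using that assms low_nonneg[of 0 k \<omega>] by (simp add: add_increasing2)
  next
    case False
    then have "(\<theta> - 1) * x \<le> (\<theta> - 1) * low 0 k \<omega>" using assms by (intro mult_left_mono) auto
    then show ?thesis using False by (simp add: algebra_simps flip: exp_add)
  qed
  then have "low_lap \<theta> k \<le> expectation (\<lambda>\<omega>. indicator {\<omega>\<in>space M. low 0 k \<omega> \<le> x} \<omega> + exp (- (\<theta> - 1) * x) * exp (- 1 * low 0 k \<omega>))"
    unfolding low_lap_def using assms
    by (intro integral_mono integrable_exp_low Bochner_Integration.integrable_add integrable_mult_right integrable_real_indicator) (auto simp: emeasure_eq_measure)
  also have "\<dots> = prob {\<omega>\<in>space M. low 0 k \<omega> \<le> x} + exp (- (\<theta> - 1) * x) * low_lap 1 k"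
    using integrable_exp_low[of 1 0 k] by (simp add: low_lap_def emeasure_eq_measure)
  finally show ?thesis by simp
qed

text \<open>The identity bounds \<open>low_lap_sum\<close> from below at \<theta> and from above at
  1, both in terms of the one unknown \<open>over_lap_sum 1 n\<close>. It enters with a non-negative
  coefficient, so its lower bound \<open>L\<close> may be inserted.\<close>

lemma occupation_lower:
  assumes "0 \<le> x" "1 \<le> \<theta>" "1 < mgf \<theta>" "1 < mgf 1" "0 \<le> L" "L \<le> over_lap_sum 1 n"
    and c: "0 \<le> h * \<theta> / (mgf \<theta> - 1) - h * exp (- (\<theta> - 1) * x) / (mgf 1 - 1)" and h: "0 < h"
  shows "(h * \<theta> / (mgf \<theta> - 1) - h * exp (- (\<theta> - 1) * x) / (mgf 1 - 1)) * L - h / (mgf \<theta> - 1)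
    \<le> (\<Sum>k<n. h * prob {\<omega>\<in>space M. low 0 k \<omega> \<le> x})"
proof -
  have "\<theta> * over_lap_sum 1 n \<le> over_lap_sum \<theta> n" using over_lap_sum_ratio_mono[of 1 \<theta> n] assms by (simp add: field_simps)
  then have "\<theta> * over_lap_sum 1 n - 1 \<le> (mgf \<theta> - 1) * low_lap_sum \<theta> n" using low_lap_sum_eq[of \<theta> n] low_lap_nonneg[of \<theta> n] assms by simp
  then have 1: "(\<theta> * over_lap_sum 1 n - 1) / (mgf \<theta> - 1) \<le> low_lap_sum \<theta> n" using assms by (simp add: field_simps)
  have "(mgf 1 - 1) * low_lap_sum 1 n \<le> over_lap_sum 1 n" using low_lap_sum_eq[of 1 n] low_lap_le_1[of 1 n] by simp
  then have "low_lap_sum 1 n \<le> over_lap_sum 1 n / (mgf 1 - 1)" using assms by (simp add: field_simps)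
  then have 2: "exp (- (\<theta> - 1) * x) * low_lap_sum 1 n \<le> exp (- (\<theta> - 1) * x) * (over_lap_sum 1 n / (mgf 1 - 1))" by (intro mult_left_mono) auto
  have "low_lap_sum \<theta> n - exp (- (\<theta> - 1) * x) * low_lap_sum 1 n = (\<Sum>k<n. low_lap \<theta> k - exp (- (\<theta> - 1) * x) * low_lap 1 k)"
    by (simp add: low_lap_sum_def sum_subtractf sum_distrib_left)
  also have "\<dots> \<le> (\<Sum>k<n. prob {\<omega>\<in>space M. low 0 k \<omega> \<le> x})"
    using assms by (intro sum_mono prob_low_lower)
  finally have 3: "(\<theta> * over_lap_sum 1 n - 1) / (mgf \<theta> - 1) - exp (- (\<theta> - 1) * x) * (over_lap_sum 1 n / (mgf 1 - 1)) \<le> (\<Sum>k<n. prob {\<omega>\<in>space M. low 0 k \<omega> \<le> x})"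
    using 1 2 by linarith
  have "(h * \<theta> / (mgf \<theta> - 1) - h * exp (- (\<theta> - 1) * x) / (mgf 1 - 1)) * L - h / (mgf \<theta> - 1)
    \<le> (h * \<theta> / (mgf \<theta> - 1) - h * exp (- (\<theta> - 1) * x) / (mgf 1 - 1)) * over_lap_sum 1 n - h / (mgf \<theta> - 1)"
    using assms by (intro diff_right_mono mult_left_mono)
  also have "\<dots> = h * ((\<theta> * over_lap_sum 1 n - 1) / (mgf \<theta> - 1) - exp (- (\<theta> - 1) * x) * (over_lap_sum 1 n / (mgf 1 - 1)))"
    by (simp add: diff_divide_distrib algebra_simps)
  also have "\<dots> \<le> h * (\<Sum>k<n. prob {\<omega>\<in>space M. low 0 k \<omega> \<le> x})" using 3 h by (intro mult_left_mono) auto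
  finally show ?thesis by (simp add: sum_distrib_left)
qed

end

section \<open>Passage times and the dyadic skeleton\<close>

context levy_process begin

text \<open>Right-continuity keeps the path below \<open>y\<close> on an interval to the right of
  \<open>s\<close>, and a fine enough grid has a point there.\<close>

lemma grid_dense:
  assumes "\<omega> \<in> space M" "0 < t" "0 \<le> s" "X s \<omega> < y" "0 < e"
  obtains n k where "0 < k" "s < real k * (t / 2 ^ n)" "real k * (t / 2 ^ n) < s + e" "X (real k * (t / 2 ^ n)) \<omega> < y"
proof -
  have "\<forall>\<^sub>F u in at_right s. X u \<omega> < y"
    using right_continuous[OF assms(1,3)] assms(4) by (rule order_tendstoD)
  then obtain b where b: "s < b" "\<And>u. s < u \<Longrightarrow> u < b \<Longrightarrow> X u \<omega> < y"
    by (auto simp: eventually_at_right_field)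
  define r where "r = min (b - s) e"
  have r: "0 < r" using b assms by (simp add: r_def)
  obtain n where n: "t / r < 2 ^ n" using real_arch_pow[of 2 "t / r"] by auto
  define h where "h = t / 2 ^ n"
  have h: "0 < h" "h < r" using n r assms(2) by (auto simp: h_def field_simps)
  \<comment> \<open>The index of the first grid point strictly after \<open>s\<close>.\<close>
  define k where "k = nat \<lfloor>s / h\<rfloor> + 1"
  have k: "s / h < real k" "real k \<le> s / h + 1"
    using assms(3) h by (auto simp: k_def of_nat_nat) linarith+
  have "s < real k * h" "real k * h \<le> s + h" using k h by (auto simp: field_simps)
  then show thesis
    using that[of k n] h b(2)[of "real k * h"] by (auto simp: h_def k_def r_def)
qed

text \<open>Dyadic times suffice, so an uncountable infimum reduces to countably many events and the
  passage time is measurable.\<close>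

lemma passage_below_less_iff:
  assumes "\<omega> \<in> space M"
  shows "passage_below X x \<omega> < y \<longleftrightarrow> (\<exists>n k. 0 < k \<and> ennreal (real k / 2 ^ n) < y \<and> X (real k / 2 ^ n) \<omega> < - x)"
proof
  assume "passage_below X x \<omega> < y"
  then obtain s where s: "0 < s" "X s \<omega> < - x" "ennreal s < y"
    by (auto simp: passage_below_def INF_less_iff)
  obtain e where e: "0 < e" "ennreal (s + e) < y"
  proof (cases y)
    case (real r)
    then show ?thesis using s that[of "(r - s) / 2"] by (auto simp: ennreal_less_iff field_simps)
  next
    case top
    then show ?thesis using that[of 1] by simp
  qed
  obtain n k where nk: "0 < k" "s < real k * (1 / 2 ^ n)" "real k * (1 / 2 ^ n) < s + e" "X (real k * (1 / 2 ^ n)) \<omega> < - x"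
    using grid_dense[OF assms zero_less_one less_imp_le[OF s(1)] s(2) e(1)] by blast
  have "ennreal (real k / 2 ^ n) \<le> ennreal (s + e)"
    by (rule ennreal_leI) (use nk(3) in simp)
  then have "ennreal (real k / 2 ^ n) < y" using e(2) by (rule le_less_trans)
  with nk show "\<exists>n k. 0 < k \<and> ennreal (real k / 2 ^ n) < y \<and> X (real k / 2 ^ n) \<omega> < - x"
    by (intro exI[of _ n] exI[of _ k]) simp
next
  assume "\<exists>n k. 0 < k \<and> ennreal (real k / 2 ^ n) < y \<and> X (real k / 2 ^ n) \<omega> < - x"
  then obtain n k :: nat where "0 < k" "ennreal (real k / 2 ^ n) < y" "X (real k / 2 ^ n) \<omega> < - x" by blast
  then show "passage_below X x \<omega> < y"
    unfolding passage_below_def INF_less_iff by (intro bexI[of _ "real k / 2 ^ n"]) auto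
qed

lemma measurable_passage_below [measurable]: "passage_below X x \<in> borel_measurable M"
proof (rule borel_measurableI_less)
  fix y
  have "{\<omega> \<in> space M. passage_below X x \<omega> < y} =
    (\<Union>n. \<Union>k\<in>{k. 0 < k \<and> ennreal (real k / 2 ^ n) < y}. {\<omega> \<in> space M. X (real k / 2 ^ n) \<omega> < - x})"
    (is "?A = ?B")
  proof (intro equalityI subsetI)
    fix \<omega> assume "\<omega> \<in> ?A"
    then obtain n k where "\<omega> \<in> space M" "0 < k" "ennreal (real k / 2 ^ n) < y" "X (real k / 2 ^ n) \<omega> < - x"
      using passage_below_less_iff[of \<omega> x y] by blast
    then show "\<omega> \<in> ?B" by (intro UN_I[of n] UN_I[of k]) auto
  next
    fix \<omega> assume "\<omega> \<in> ?B"
    then obtain n k :: nat where "\<omega> \<in> space M" "0 < k" "ennreal (real k / 2 ^ n) < y" "X (real k / 2 ^ n) \<omega> < - x"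
      by auto
    then have "passage_below X x \<omega> < y" unfolding passage_below_less_iff[OF \<open>\<omega> \<in> space M\<close>] by blast
    with \<open>\<omega> \<in> space M\<close> show "\<omega> \<in> ?A" by simp
  qed
  also have "\<dots> \<in> sets M"
  proof (intro sets.countable_UN'')
    show "countable {k. 0 < k \<and> ennreal (real k / 2 ^ n) < y}" for n
      by (rule countable_subset[OF subset_UNIV countableI_type])
    fix n k :: nat
    have [measurable]: "X (real k / 2 ^ n) \<in> borel_measurable M" by (rule measurable_X) simp
    show "{\<omega> \<in> space M. X (real k / 2 ^ n) \<omega> < - x} \<in> sets M" by measurable
  qed (rule countableI_type)
  finally show "{\<omega> \<in> space M. passage_below X x \<omega> < y} \<in> sets M" .
qed

lemma passage_below_antimono: "x \<le> x' \<Longrightarrow> passage_below X x \<omega> \<le> passage_below X x' \<omega>"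
  unfolding passage_below_def by (rule INF_superset_mono) auto

lemma passage_below_le: "0 < t \<Longrightarrow> X t \<omega> < - x \<Longrightarrow> passage_below X x \<omega> \<le> ennreal t"
  unfolding passage_below_def by (rule INF_lower) simp

text \<open>The strict inequality in the definition matters: a negative value of the path is already
  below \<open>- 1 / real (Suc k)\<close> for some \<open>k\<close>.\<close>

lemma passage_below_tendsto_0:
  "(\<lambda>k. passage_below X (1 / real (Suc k)) \<omega>) \<longlonglongrightarrow> passage_below X 0 \<omega>"
proof -
  have "decseq (\<lambda>k. passage_below X (1 / real (Suc k)) \<omega>)"
    by (intro decseq_SucI passage_below_antimono) (simp add: field_simps)
  then have "(\<lambda>k. passage_below X (1 / real (Suc k)) \<omega>) \<longlonglongrightarrow> (INF k. passage_below X (1 / real (Suc k)) \<omega>)"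
    by (rule LIMSEQ_INF)
  moreover have "(INF k. passage_below X (1 / real (Suc k)) \<omega>) = passage_below X 0 \<omega>"
  proof (rule antisym)
    show "passage_below X 0 \<omega> \<le> (INF k. passage_below X (1 / real (Suc k)) \<omega>)"
      by (intro INF_greatest passage_below_antimono) simp
    show "(INF k. passage_below X (1 / real (Suc k)) \<omega>) \<le> passage_below X 0 \<omega>"
      unfolding passage_below_def[of X 0]
    proof (rule INF_greatest)
      fix t assume "t \<in> {t. 0 < t \<and> X t \<omega> < - 0}"
      then have t: "0 < t" "0 < - X t \<omega>" by auto
      then obtain k where "inverse (real (Suc k)) < - X t \<omega>" using reals_Archimedean by blast
      then have "X t \<omega> < - (1 / real (Suc k))" by (simp add: inverse_eq_divide)
      then show "(INF k. passage_below X (1 / real (Suc k)) \<omega>) \<le> ennreal t"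
        by (intro INF_lower2[of k] passage_below_le t) auto
    qed
  qed
  ultimately show ?thesis by simp
qed

end

section \<open>Skeleton walks and the truncated mean of the passage time\<close>

locale levy_laplace = levy_process M X + levy_exponent c \<sigma> \<nu> \<psi>
  for M :: "'a measure" and X c \<sigma> \<nu> \<psi> +
  assumes start: "AE \<omega> in M. X 0 \<omega> = 0"
    and exponent: "laplace_exponent M X \<psi>"
begin

lemma integrable_exp: "0 \<le> \<theta> \<Longrightarrow> 0 < t \<Longrightarrow> integrable M (\<lambda>\<omega>. exp (\<theta> * X t \<omega>))"
  using exponent by (simp add: laplace_exponent_def)

text \<open>\<open>laplace_exponent\<close> provides only a logarithm. Inverting it needs strict
  positivity of the expectation, which holds since exp vanishes nowhere.\<close>

lemma expectation_exp:
  assumes "0 \<le> \<theta>" "0 < t"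
  shows "expectation (\<lambda>\<omega>. exp (\<theta> * X t \<omega>)) = exp (t * \<psi> \<theta>)"
proof -
  have "\<psi> \<theta> = 1 / t * ln (expectation (\<lambda>\<omega>. exp (\<theta> * X t \<omega>)))"
    using exponent assms by (simp add: laplace_exponent_def)
  moreover have "0 < expectation (\<lambda>\<omega>. exp (\<theta> * X t \<omega>))"
  proof -
    have "0 \<le> expectation (\<lambda>\<omega>. exp (\<theta> * X t \<omega>))" by (rule Bochner_Integration.integral_nonneg) simp
    moreover have "expectation (\<lambda>\<omega>. exp (\<theta> * X t \<omega>)) \<noteq> 0"
    proof
      assume "expectation (\<lambda>\<omega>. exp (\<theta> * X t \<omega>)) = 0"
      then have "AE \<omega> in M. exp (\<theta> * X t \<omega>) = 0"
        using integral_nonneg_eq_0_iff_AE[OF integrable_exp[OF assms]] by simp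
      then have "AE \<omega> in M. False" by simp
      then show False by simp
    qed
    ultimately show ?thesis by linarith
  qed
  ultimately show ?thesis using assms by simp
qed

lemma distr_increment:
  assumes "0 \<le> s" "0 \<le> h"
  shows "distr M borel (\<lambda>\<omega>. X (s + h) \<omega> - X s \<omega>) = distr M borel (X h)"
proof -
  have [measurable]: "X h \<in> borel_measurable M" "X 0 \<in> borel_measurable M" using assms by (auto intro: measurable_X)
  have "distr M borel (\<lambda>\<omega>. X h \<omega> - X 0 \<omega>) = distr M borel (X h)"
    using start by (intro distr_cong_AE) auto
  then show ?thesis using stationary_increments[OF assms] by simp
qed

definition steps :: "real \<Rightarrow> nat \<Rightarrow> 'a \<Rightarrow> real" where
  "steps h i \<omega> = X (real (Suc i) * h) \<omega> - X (real i * h) \<omega>"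

lemma sum_steps: "(\<Sum>i<k. steps h (j + i) \<omega>) = X (real (j + k) * h) \<omega> - X (real j * h) \<omega>"
  by (induction k) (simp_all add: steps_def algebra_simps)

lemma walk_steps:
  assumes h: "0 < h"
  shows "walk M (steps h) (distr M borel (X h))"
proof
  have [measurable]: "X h \<in> borel_measurable M" using h by (auto intro: measurable_X)
  show "indep_vars (\<lambda>_. borel) (steps h) {..<N}" for N
    using independent_increments[of "\<lambda>i. real i * h" N] h
    unfolding steps_def[abs_def] by (simp add: algebra_simps)
  show eq: "distr M borel (steps h i) = distr M borel (X h)" for i
    using distr_increment[of "real i * h" h] h unfolding steps_def[abs_def] by (simp add: algebra_simps)
  have [measurable]: "steps h 0 \<in> borel_measurable M"
    unfolding steps_def[abs_def] using h by (intro borel_measurable_diff measurable_X) auto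
  fix \<theta> :: real assume "0 \<le> \<theta>"
  then have "integrable (distr M borel (X h)) (\<lambda>x. exp (\<theta> * x))"
    using h integrable_exp by (subst integrable_distr_eq) auto
  then show "integrable M (\<lambda>\<omega>. exp (\<theta> * steps h 0 \<omega>))"
    unfolding eq[of 0, symmetric] by (subst (asm) integrable_distr_eq) auto
qed

lemma distr_steps: "0 < h \<Longrightarrow> distr M borel (steps h i) = distr M borel (X h)"
  using walk.distr_step[OF walk_steps] .

lemma expectation_steps:
  assumes "0 < h" and [measurable]: "f \<in> borel_measurable borel"
  shows "expectation (\<lambda>\<omega>. f (steps h i \<omega>) :: real) = expectation (\<lambda>\<omega>. f (X h \<omega>))"
proof -
  have [measurable]: "X h \<in> borel_measurable M" "steps h i \<in> borel_measurable M"
    using assms walk.measurable_step[OF walk_steps] by (auto intro: measurable_X)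
  have "expectation (\<lambda>\<omega>. f (steps h i \<omega>)) = integral\<^sup>L (distr M borel (steps h i)) f" by (simp add: integral_distr)
  also have "\<dots> = expectation (\<lambda>\<omega>. f (X h \<omega>))" using assms by (simp add: distr_steps integral_distr)
  finally show ?thesis .
qed

lemma mgf_steps: "0 < h \<Longrightarrow> 0 \<le> \<theta> \<Longrightarrow> walk.mgf M (steps h) \<theta> = exp (h * \<psi> \<theta>)"
  using expectation_steps[of h "\<lambda>x. exp (\<theta> * x)" 0] expectation_exp[of \<theta> h]
  by (simp add: walk.mgf_def[OF walk_steps])

abbreviation grid_low :: "real \<Rightarrow> nat \<Rightarrow> nat \<Rightarrow> 'a \<Rightarrow> real" where
  "grid_low h \<equiv> walk.low (steps h)"

lemma grid_low_le_iff:
  assumes "0 < h" "0 \<le> x"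
  shows "grid_low h j n \<omega> \<le> x \<longleftrightarrow> (\<forall>k\<le>n. X (real j * h) \<omega> - x \<le> X (real (j + k) * h) \<omega>)"
  unfolding walk.low_def[OF walk_steps[OF assms(1)]] walk_low_le_iff[OF assms(2)] sum_steps
  by (simp add: algebra_simps)

definition truncated_passage_mean :: "real \<Rightarrow> real \<Rightarrow> real" where
  "truncated_passage_mean x t = expectation (\<lambda>\<omega>. enn2real (min (passage_below X x \<omega>) (ennreal t)))"

text \<open>The sum is the expectation of \<open>f n\<close>, the grid time up to \<open>t\<close>
  at which the skeleton has not yet been below \<open>- x\<close>. Only the asymptotic upper bound
  of \<open>f\<close> by \<open>g\<close> is needed; taking \<open>max\<close> with \<open>g\<close>
  turns it into convergence, so that dominated convergence applies.\<close>

lemma occupation_le_truncated_passage_mean: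
  assumes t: "0 < t" and x: "0 \<le> x"
    and B: "\<And>n. N0 \<le> n \<Longrightarrow> B \<le> (\<Sum>k<(2::nat) ^ n. t / 2 ^ n * prob {\<omega>\<in>space M. grid_low (t / 2 ^ n) 0 k \<omega> \<le> x})"
  shows "B \<le> truncated_passage_mean x t"
proof -
  define h where "h n = t / 2 ^ n" for n :: nat
  have h: "0 < h n" for n using t by (simp add: h_def)
  define f where "f n \<omega> = (\<Sum>k<(2::nat) ^ n. h n * indicator {\<omega>\<in>space M. grid_low (h n) 0 k \<omega> \<le> x} \<omega>)" for n \<omega>
  define g where "g \<omega> = enn2real (min (passage_below X x \<omega>) (ennreal t))" for \<omega>
  note [measurable] = walk.measurable_low[OF walk_steps[OF h]]
  have f_meas [measurable]: "f n \<in> borel_measurable M" for n unfolding f_def[abs_def] by measurable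
  have g_meas [measurable]: "g \<in> borel_measurable M" unfolding g_def[abs_def] by measurable
  have f_nonneg: "0 \<le> f n \<omega>" for n \<omega> unfolding f_def using h by (intro sum_nonneg) (simp add: less_imp_le)
  have f_le: "f n \<omega> \<le> t" for n \<omega>
  proof -
    have "f n \<omega> \<le> (\<Sum>k<(2::nat) ^ n. h n)" unfolding f_def using h[of n] by (intro sum_mono) (simp add: indicator_def)
    then show ?thesis by (simp add: h_def)
  qed
  have g: "0 \<le> g \<omega>" "g \<omega> \<le> t" for \<omega>
    using t enn2real_mono[of "min (passage_below X x \<omega>) (ennreal t)" "ennreal t"] by (simp_all add: g_def)
  have lim: "(\<lambda>n. max (f n \<omega>) (g \<omega>)) \<longlonglongrightarrow> g \<omega>" if \<omega>: "\<omega> \<in> space M" "X 0 \<omega> = 0" for \<omega>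
  proof (rule LIMSEQ_I)
    fix r :: real assume r: "0 < r"
    have "\<exists>N. \<forall>n\<ge>N. f n \<omega> < g \<omega> + r"
    proof (cases "passage_below X x \<omega> < ennreal t")
      case False
      then have "g \<omega> = t" using t by (simp add: g_def min_def)
      then show ?thesis using f_le r by (auto intro!: exI[of _ 0] le_less_trans[OF f_le])
    next
      case True
      then obtain T where T: "passage_below X x \<omega> = ennreal T" "0 \<le> T" "T < t"
        by (cases "passage_below X x \<omega>") (auto simp: ennreal_less_iff)
      have "passage_below X x \<omega> < ennreal (T + r / 2)" using T r by (simp add: ennreal_less_iff)
      then obtain s where s: "0 < s" "X s \<omega> < - x" "ennreal s < ennreal (T + r / 2)"
        by (auto simp: passage_below_def INF_less_iff)
      have sT: "s < T + r / 2" using s(1,3) by (simp add: ennreal_less_iff del: ennreal_plus)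
      obtain N k where k: "0 < k" "s < real k * (t / 2 ^ N)" "real k * (t / 2 ^ N) < s + r / 2" "X (real k * (t / 2 ^ N)) \<omega> < - x"
        by (rule grid_dense[OF \<omega>(1) t less_imp_le[OF s(1)] s(2) half_gt_zero[OF r]])
      have "f n \<omega> < g \<omega> + r" if n: "N \<le> n" for n
      proof -
        \<comment> \<open>The witness time of the \<open>N\<close>-th mesh is the
          \<open>K\<close>-th point of the finer mesh.\<close>
        define K where "K = k * 2 ^ (n - N)"
        have K: "real K * h n = real k * (t / 2 ^ N)"
        proof -
          have "(2::real) ^ n = 2 ^ N * 2 ^ (n - N)" using n by (simp flip: power_add)
          then show ?thesis by (simp add: K_def h_def)
        qed
        have "\<not> grid_low (h n) 0 i \<omega> \<le> x" if "K \<le> i" for i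
          using that k(4) K \<omega> x unfolding grid_low_le_iff[OF h x] by (auto intro!: exI[of _ K])
        then have "f n \<omega> \<le> (\<Sum>i<(2::nat) ^ n. if i < K then h n else 0)"
          unfolding f_def using h[of n] by (intro sum_mono) (auto simp: indicator_def not_less)
        also have "\<dots> = (\<Sum>i\<in>{..<(2::nat) ^ n} \<inter> {..<K}. h n)"
          by (subst sum.inter_restrict) (auto intro!: sum.cong)
        also have "\<dots> \<le> real K * h n"
          using h[of n] card_mono[of "{..<K}" "{..<(2::nat) ^ n} \<inter> {..<K}"] by (simp add: mult_right_mono)
        also have "\<dots> < s + r / 2" using K k by simp
        also have "\<dots> < T + r" using sT by simp
        also have "T = g \<omega>"
        proof -
          have "min (passage_below X x \<omega>) (ennreal t) = ennreal T"
            unfolding T(1) by (intro min.absorb1 ennreal_leI less_imp_le T)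
          then show ?thesis using T(2) by (simp add: g_def)
        qed
        finally show ?thesis .
      qed
      then show ?thesis by blast
    qed
    then obtain N where "\<forall>n\<ge>N. f n \<omega> < g \<omega> + r" ..
    then show "\<exists>no. \<forall>n\<ge>no. norm (max (f n \<omega>) (g \<omega>) - g \<omega>) < r"
      using r by (intro exI[of _ N]) (auto simp: max_def)
  qed
  have "(\<lambda>n. expectation (\<lambda>\<omega>. max (f n \<omega>) (g \<omega>))) \<longlonglongrightarrow> expectation g"
  proof (rule integral_dominated_convergence[where w="\<lambda>_. t"])
    show "AE \<omega> in M. (\<lambda>n. max (f n \<omega>) (g \<omega>)) \<longlonglongrightarrow> g \<omega>"
      using start by (rule AE_mp) (auto intro!: AE_I2 lim)
    show "AE \<omega> in M. norm (max (f n \<omega>) (g \<omega>)) \<le> t" for n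
      using f_le f_nonneg g by (intro AE_I2) (simp add: max_def)
  qed auto
  moreover have "B \<le> expectation (\<lambda>\<omega>. max (f n \<omega>) (g \<omega>))" if n: "N0 \<le> n" for n
  proof -
    have "B \<le> expectation (f n)"
    proof -
      have "expectation (f n) = (\<Sum>k<(2::nat) ^ n. h n * prob {\<omega>\<in>space M. grid_low (h n) 0 k \<omega> \<le> x})"
        unfolding f_def by (subst Bochner_Integration.integral_sum) (auto simp: emeasure_eq_measure)
      then show ?thesis using B[OF n] by (simp only: h_def)
    qed
    also have "\<dots> \<le> expectation (\<lambda>\<omega>. max (f n \<omega>) (g \<omega>))"
    proof (rule integral_mono)
      show "integrable M (f n)"
        by (rule integrable_const_bound[where B=t]) (simp_all add: f_le f_nonneg)
      show "integrable M (\<lambda>\<omega>. max (f n \<omega>) (g \<omega>))"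
      proof (rule integrable_const_bound[where B=t])
        show "AE \<omega> in M. norm (max (f n \<omega>) (g \<omega>)) \<le> t"
          using f_le f_nonneg g by (intro AE_I2) (simp add: max_def)
      qed simp
    qed simp
    finally show ?thesis .
  qed
  then have "\<forall>\<^sub>F n in sequentially. B \<le> expectation (\<lambda>\<omega>. max (f n \<omega>) (g \<omega>))"
    unfolding eventually_sequentially by blast
  ultimately have "B \<le> expectation g"
    by (rule tendsto_lowerbound) simp
  then show ?thesis unfolding truncated_passage_mean_def g_def[abs_def] .
qed

text \<open>A bound at level 0 follows from bounds at positive levels, provided that
  \<open>B\<close> does not depend on the level.\<close>

lemma truncated_passage_mean_zero:
  assumes t: "0 < t" and B: "\<And>x. 0 < x \<Longrightarrow> B \<le> truncated_passage_mean x t"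
  shows "B \<le> truncated_passage_mean 0 t"
proof -
  have "(\<lambda>k. truncated_passage_mean (1 / real (Suc k)) t) \<longlonglongrightarrow> truncated_passage_mean 0 t"
    unfolding truncated_passage_mean_def
  proof (rule integral_dominated_convergence[where w="\<lambda>_. t"])
    show "AE \<omega> in M. (\<lambda>k. enn2real (min (passage_below X (1 / real (Suc k)) \<omega>) (ennreal t))) \<longlonglongrightarrow> enn2real (min (passage_below X 0 \<omega>) (ennreal t))"
    proof (rule AE_I2)
      fix \<omega>
      have "min (passage_below X 0 \<omega>) (ennreal t) < \<infinity>" by (simp add: min_less_iff_disj)
      then have "ennreal (enn2real (min (passage_below X 0 \<omega>) (ennreal t))) = min (passage_below X 0 \<omega>) (ennreal t)"
        by (intro ennreal_enn2real) auto
      moreover have "(\<lambda>k. min (passage_below X (1 / real (Suc k)) \<omega>) (ennreal t)) \<longlonglongrightarrow> min (passage_below X 0 \<omega>) (ennreal t)"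
        by (intro tendsto_min passage_below_tendsto_0 tendsto_const)
      ultimately show "(\<lambda>k. enn2real (min (passage_below X (1 / real (Suc k)) \<omega>) (ennreal t))) \<longlonglongrightarrow> enn2real (min (passage_below X 0 \<omega>) (ennreal t))"
        by (intro tendsto_enn2real) auto
    qed
    show "AE \<omega> in M. norm (enn2real (min (passage_below X (1 / real (Suc k)) \<omega>) (ennreal t))) \<le> t" for k
      by (intro AE_I2) (simp add: enn2real_leI t less_imp_le)
  qed auto
  moreover have "\<forall>\<^sub>F k in sequentially. B \<le> truncated_passage_mean (1 / real (Suc k)) t"
    using B by (intro always_eventually allI) simp
  ultimately show ?thesis by (rule tendsto_lowerbound) simp
qed

end

lemma exp_le_one_plus_double:
  fixes u :: real
  assumes "0 \<le> u" "u \<le> 1"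
  shows "exp u - 1 \<le> 2 * u"
  using exp_bound[of u] assms mult_left_le[of u u] by (simp add: power2_eq_square)

lemma ratio_exp_minus_one:
  fixes u h :: real
  assumes "0 < u" "0 < h"
  shows "h / (exp (h * u) - 1) \<le> 1 / u" "h * u \<le> 1 \<Longrightarrow> 1 / (2 * u) \<le> h / (exp (h * u) - 1)"
proof -
  have pos: "0 < exp (h * u) - 1" using assms by simp
  have "h * u \<le> exp (h * u) - 1" using exp_ge_add_one_self[of "h * u"] by linarith
  then show "h / (exp (h * u) - 1) \<le> 1 / u"
    using assms pos by (simp add: field_simps)
  assume "h * u \<le> 1"
  then have "exp (h * u) - 1 \<le> 2 * (h * u)" using assms by (intro exp_le_one_plus_double) auto
  then show "1 / (2 * u) \<le> h / (exp (h * u) - 1)"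
    using assms pos by (simp add: field_simps)
qed

section \<open>The upper tail of the process at small times\<close>

context levy_laplace begin

abbreviation exp_right_part :: "real \<Rightarrow> real \<Rightarrow> real \<Rightarrow> real" where
  "exp_right_part \<theta> \<epsilon> h \<equiv> expectation (\<lambda>\<omega>. exp (\<theta> * X h \<omega>) * indicator {x. \<epsilon> < x} (X h \<omega>))"

text \<open>Beyond \<epsilon> one has
  \<open>1 \<le> exp (\<beta> * (X h \<omega> - \<epsilon>))\<close>; the parameter \<beta> stays
  free so that it can grow as \<open>h\<close> decreases.\<close>

lemma exp_right_tail:
  assumes "0 < \<theta>" "0 < \<epsilon>" "0 \<le> \<beta>" "0 < h"
  shows "exp_right_part \<theta> \<epsilon> h \<le> exp (h * \<psi> (\<theta> + \<beta>) - \<beta> * \<epsilon>)"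
proof -
  have [measurable]: "X h \<in> borel_measurable M" using assms by (auto intro: measurable_X)
  have "exp_right_part \<theta> \<epsilon> h \<le> expectation (\<lambda>\<omega>. exp (- \<beta> * \<epsilon>) * exp ((\<theta> + \<beta>) * X h \<omega>))"
  proof (rule integral_mono)
    show "integrable M (\<lambda>\<omega>. exp (- \<beta> * \<epsilon>) * exp ((\<theta> + \<beta>) * X h \<omega>))"
      using assms by (intro integrable_mult_right integrable_exp) auto
    show "integrable M (\<lambda>\<omega>. exp (\<theta> * X h \<omega>) * indicator {x. \<epsilon> < x} (X h \<omega>))"
      by (rule Bochner_Integration.integrable_bound[OF integrable_exp[of \<theta> h]])
        (use assms in \<open>auto simp: indicator_def\<close>)
    fix \<omega>
    show "exp (\<theta> * X h \<omega>) * indicator {x. \<epsilon> < x} (X h \<omega>) \<le> exp (- \<beta> * \<epsilon>) * exp ((\<theta> + \<beta>) * X h \<omega>)"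
    proof (cases "\<epsilon> < X h \<omega>")
      case True
      then have "\<beta> * \<epsilon> \<le> \<beta> * X h \<omega>" using assms by (intro mult_left_mono) auto
      then show ?thesis using True by (simp add: algebra_simps flip: exp_add)
    qed simp
  qed
  also have "\<dots> = exp (- \<beta> * \<epsilon>) * exp (h * \<psi> (\<theta> + \<beta>))"
    using assms by (simp add: expectation_exp)
  also have "\<dots> = exp (h * \<psi> (\<theta> + \<beta>) - \<beta> * \<epsilon>)" by (simp flip: exp_add)
  finally show ?thesis .
qed

text \<open>Markov's inequality with \<open>\<lambda> = h powr (- 1 / 2)\<close> suffices because \<open>\<psi>\<close> grows at most
  quadratically; this is how the absence of positive jumps is used.\<close>

lemma exp_right_tail_small:
  assumes "0 < \<theta>" "0 < \<epsilon>"
  shows "((\<lambda>h. exp_right_part \<theta> \<epsilon> h / h) \<longlongrightarrow> 0) (at_right 0)"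
proof -
  obtain C where C: "0 < C" "\<And>t. 1 \<le> t \<Longrightarrow> \<psi> t \<le> C * t\<^sup>2" using psi_upper by auto
  show ?thesis
  proof (rule tendsto_sandwich[where f="\<lambda>_. 0"])
    show "\<forall>\<^sub>F h in at_right 0. 0 \<le> exp_right_part \<theta> \<epsilon> h / h"
      using eventually_at_right_less[of "0::real"]
    proof eventually_elim
      case (elim h)
      have "0 \<le> exp_right_part \<theta> \<epsilon> h"
        by (rule Bochner_Integration.integral_nonneg) simp
      then show ?case using elim by simp
    qed
    show "\<forall>\<^sub>F h in at_right 0. exp_right_part \<theta> \<epsilon> h / h
       \<le> exp (h * (C * (\<theta> + h powr (-1/2))\<^sup>2) - h powr (-1/2) * \<epsilon>) / h"
      unfolding eventually_at_right_field
    proof (intro exI[of _ 1] conjI allI impI)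
      fix h :: real assume h: "0 < h" "h < 1"
      have "1 \<le> h powr (-1/2)" using h powr_mono2'[of "- 1 / 2" h 1] by simp
      then have "\<psi> (\<theta> + h powr (-1/2)) \<le> C * (\<theta> + h powr (-1/2))\<^sup>2" using assms by (intro C) auto
      then have "exp (h * \<psi> (\<theta> + h powr (-1/2)) - h powr (-1/2) * \<epsilon>) \<le> exp (h * (C * (\<theta> + h powr (-1/2))\<^sup>2) - h powr (-1/2) * \<epsilon>)"
        using h by (simp add: mult_left_mono)
      with exp_right_tail[OF assms, of "h powr (-1/2)" h] h
      have "exp_right_part \<theta> \<epsilon> h
         \<le> exp (h * (C * (\<theta> + h powr (-1/2))\<^sup>2) - h powr (-1/2) * \<epsilon>)"
        by (intro order_trans[OF exp_right_tail[OF assms, of "h powr (-1/2)" h]]) auto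
      then show "exp_right_part \<theta> \<epsilon> h / h
       \<le> exp (h * (C * (\<theta> + h powr (-1/2))\<^sup>2) - h powr (-1/2) * \<epsilon>) / h"
        using h by (intro divide_right_mono) auto
    qed simp
    show "((\<lambda>h. exp (h * (C * (\<theta> + h powr (-1/2))\<^sup>2) - h powr (-1/2) * \<epsilon>) / h) \<longlongrightarrow> 0) (at_right 0)"
      using C(1) assms by real_asymp
  qed simp
qed

end

lemma filterlim_dyadic_mesh: "0 < (t::real) \<Longrightarrow> filterlim (\<lambda>n. t / 2 ^ n) (at_right 0) sequentially"
  by real_asymp

section \<open>Bounded variation and linear growth of the exponent\<close>

context levy_laplace begin

text \<open>If \<open>V\<close> is the variation along the \<open>n\<close>-th dyadic partition of \<open>[0, 1]\<close>, then \<open>E[exp (- V)]\<close> is the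
  \<open>2\<^sup>n\<close>-th power of \<open>E[exp (- \<bar>X\<^sub>h\<bar>)]\<close> with \<open>h = 2\<^sup>-\<^sup>n\<close>, and it stays away from 0.\<close>

lemma variation_bound:
  assumes "\<not> unbounded_variation_paths M X"
  obtains K where "0 \<le> K" "\<And>n. 1 - expectation (\<lambda>\<omega>. exp (- \<bar>X (1 / 2 ^ n) \<omega>\<bar>)) \<le> K * (1 / 2 ^ n)"
proof -
  define h where "h n = (1 / 2 ^ n :: real)" for n :: nat
  have h: "0 < h n" for n by (simp add: h_def)
  define V where "V n \<omega> = (\<Sum>i<(2::nat) ^ n. \<bar>steps (h n) i \<omega>\<bar>)" for n \<omega>
  note [measurable] = walk.measurable_step[OF walk_steps[OF h]]
  have [measurable]: "V n \<in> borel_measurable M" for n unfolding V_def[abs_def] by measurable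
  define S where "S B = {\<omega>\<in>space M. \<forall>n. V n \<omega> \<le> real B}" for B :: nat
  have S [measurable]: "S B \<in> sets M" for B unfolding S_def by measurable
  have "AE \<omega> in M. bounded_variation_on_interval (\<lambda>s. X s \<omega>) 0 1"
    using assms unfolding unbounded_variation_paths_def not_not by eventually_elim simp
  then have "AE \<omega> in M. \<omega> \<in> (\<Union>B. S B)" using AE_space
  proof eventually_elim
    case (elim \<omega>)
    from elim(1) obtain B where B: "\<And>(n::nat) u. 0 \<le> u 0 \<and> u n \<le> 1 \<and> (\<forall>i<n. u i \<le> u (Suc i)) \<Longrightarrow>
        (\<Sum>i<n. \<bar>X (u (Suc i)) \<omega> - X (u i) \<omega>\<bar>) \<le> B"
      unfolding bounded_variation_on_interval_def by blast
    obtain B' where B': "B \<le> real B'" using real_arch_simple by blast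
    have "V n \<omega> \<le> real B'" for n
      using B[of "\<lambda>i. real i * h n" "2 ^ n"] h[of n] B' unfolding V_def steps_def
      by (simp add: h_def mult_right_mono divide_right_mono)
    then show ?case using elim(2) by (auto simp: S_def)
  qed
  then have "prob (\<Union>B. S B) = 1" by (subst prob_eq_1) auto
  moreover have "incseq S" unfolding S_def by (intro incseq_SucI) (auto intro: order_trans)
  then have "(\<lambda>B. prob (S B)) \<longlonglongrightarrow> prob (\<Union>B. S B)" by (intro finite_Lim_measure_incseq) auto
  ultimately have "\<forall>\<^sub>F B in sequentially. 1 / 2 < prob (S B)" by (intro order_tendstoD(1)) auto
  then obtain B where B: "1 / 2 < prob (S B)" by (auto simp: eventually_sequentially)
  \<comment> \<open>With probability above 1/2 all dyadic variations are at most \<open>B\<close>,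
    so \<open>\<rho>\<close> bounds the expectation of \<open>exp (- V n)\<close> from below for
    every \<open>n\<close>.\<close>
  define \<rho> where "\<rho> = exp (- real B) / 2"
  have \<rho>: "0 < \<rho>" by (simp add: \<rho>_def)
  define b where "b n = expectation (\<lambda>\<omega>. exp (- \<bar>X (h n) \<omega>\<bar>))" for n
  have b: "0 \<le> b n" for n unfolding b_def by (rule Bochner_Integration.integral_nonneg) simp
  have pow: "\<rho> \<le> b n ^ (2 ^ n)" for n
  proof -
    have "\<rho> \<le> exp (- real B) * prob (S B)" using B by (simp add: \<rho>_def)
    also have "\<dots> = expectation (\<lambda>\<omega>. exp (- real B) * indicator (S B) \<omega>)" by (simp add: emeasure_eq_measure)
    also have "\<dots> \<le> expectation (\<lambda>\<omega>. exp (- V n \<omega>))"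
    proof (rule integral_mono)
      show "integrable M (\<lambda>\<omega>. exp (- V n \<omega>))"
        by (rule integrable_const_bound[where B=1]) (auto simp: V_def sum_nonneg)
      show "exp (- real B) * indicator (S B) \<omega> \<le> exp (- V n \<omega>)" for \<omega>
        by (auto simp: indicator_def S_def)
    qed (simp add: emeasure_eq_measure)
    also have "\<dots> = expectation (\<lambda>\<omega>. \<Prod>i<(2::nat) ^ n. exp (- \<bar>steps (h n) i \<omega>\<bar>))"
      by (simp add: V_def exp_sum flip: sum_negf)
    also have "\<dots> = (\<Prod>i<(2::nat) ^ n. expectation (\<lambda>\<omega>. exp (- \<bar>steps (h n) i \<omega>\<bar>)))"
    proof (rule indep_vars_lebesgue_integral)
      show "indep_vars (\<lambda>_. borel) (\<lambda>i \<omega>. exp (- \<bar>steps (h n) i \<omega>\<bar>)) {..<2 ^ n}"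
        by (rule indep_vars_compose2[OF walk.indep_steps[OF walk_steps[OF h]], where Y="\<lambda>_ x. exp (- \<bar>x\<bar>)"]) simp
      show "integrable M (\<lambda>\<omega>. exp (- \<bar>steps (h n) i \<omega>\<bar>))" for i
        by (rule integrable_const_bound[where B=1]) auto
    qed simp
    also have "\<dots> = b n ^ (2 ^ n)"
      using expectation_steps[OF h, of "\<lambda>x. exp (- \<bar>x\<bar>)"] by (simp add: b_def)
    finally show ?thesis .
  qed
  have "1 - b n \<le> - ln \<rho> * h n" for n
  proof -
    \<comment> \<open>From \<open>b \<le> exp (- (1 - b))\<close>: taking logarithms in
      \<open>\<rho> \<le> b n ^ (2 ^ n)\<close> shows that \<open>1 - b n\<close> is of the order of
      the mesh.\<close>
    have "b n ^ (2 ^ n) \<le> exp (- (1 - b n)) ^ (2 ^ n)"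
      using exp_ge_add_one_self[of "- (1 - b n)"] b by (intro power_mono) auto
    also have "\<dots> = exp (2 ^ n * - (1 - b n))" by (simp add: exp_of_nat_mult[symmetric])
    finally have "\<rho> \<le> exp (2 ^ n * - (1 - b n))" using pow[of n] by linarith
    then have "ln \<rho> \<le> 2 ^ n * - (1 - b n)" using \<rho> by (metis ln_exp ln_le_cancel_iff exp_gt_zero)
    then show ?thesis by (simp add: h_def field_simps)
  qed
  moreover have "0 \<le> - ln \<rho>"
  proof -
    have "exp (- real B) \<le> 1" by simp
    then have "\<rho> \<le> 1" unfolding \<rho>_def by linarith
    then show ?thesis using \<rho> by simp
  qed
  ultimately show thesis using that[of "- ln \<rho>"] by (simp add: b_def h_def)
qed

text \<open>The expectation of \<open>1 - exp (- \<bar>x\<bar>)\<close> at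
  \<open>x = X h \<omega>\<close> is of order \<open>h\<close> and controls
  \<open>exp (\<theta> * x) - 1\<close> up to a right tail that is negligible against
  \<open>h\<close>. Dividing by \<open>h\<close> and refining the mesh gives the bound.\<close>

lemma psi_linear_bound:
  assumes "\<not> unbounded_variation_paths M X"
  obtains C where "\<And>\<theta>. 1 \<le> \<theta> \<Longrightarrow> \<psi> \<theta> \<le> C * \<theta>"
proof -
  obtain K where K: "0 \<le> K" "\<And>n. 1 - expectation (\<lambda>\<omega>. exp (- \<bar>X (1 / 2 ^ n) \<omega>\<bar>)) \<le> K * (1 / 2 ^ n)"
    using variation_bound[OF assms] by blast
  have "\<psi> \<theta> \<le> (4 * K) * \<theta>" if \<theta>: "1 \<le> \<theta>" for \<theta>
  proof -
    define R where "R h = exp_right_part \<theta> (1 / \<theta>) h" for h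
    have "\<psi> \<theta> \<le> 4 * \<theta> * K + R (1 / 2 ^ n) / (1 / 2 ^ n)" for n :: nat
    proof -
      define h where "h = (1 / 2 ^ n :: real)"
      have h: "0 < h" by (simp add: h_def)
      have [measurable]: "X h \<in> borel_measurable M" using h by (auto intro: measurable_X)
      have int1: "integrable M (\<lambda>\<omega>. exp (- \<bar>X h \<omega>\<bar>))"
        by (rule integrable_const_bound[where B=1]) auto
      have int2: "integrable M (\<lambda>\<omega>. exp (\<theta> * X h \<omega>) * indicator {x. 1 / \<theta> < x} (X h \<omega>))"
        by (rule Bochner_Integration.integrable_bound[OF integrable_exp[of \<theta> h]])
          (use h \<theta> in \<open>auto simp: indicator_def\<close>)
      \<comment> \<open>The constant 4 is 2 times 2: \<open>exp u - 1 \<le> 2 * u\<close> for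
        \<open>u = \<theta> * x \<le> 1\<close>, and \<open>x / 2 \<le> 1 - exp (- x)\<close> for
        \<open>x \<le> 1\<close>.\<close>
      have pt: "exp (\<theta> * x) - 1 \<le> 4 * \<theta> * (1 - exp (- \<bar>x\<bar>)) + exp (\<theta> * x) * indicator {x. 1 / \<theta> < x} x" for x
      proof -
        consider "x \<le> 0" | "0 < x" "x \<le> 1 / \<theta>" | "0 < x" "1 / \<theta> < x" by linarith
        then show ?thesis
        proof cases
          case 1
          then have "exp (\<theta> * x) \<le> 1" using \<theta> by (simp add: mult_nonneg_nonpos)
          moreover have "0 \<le> 4 * \<theta> * (1 - exp (- \<bar>x\<bar>))" using \<theta> by simp
          moreover have "0 \<le> exp (\<theta> * x) * indicator {x. 1 / \<theta> < x} x" by simp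
          ultimately show ?thesis by linarith
        next
          case 2
          have "x \<le> 1" using 2 \<theta> by (smt (verit) divide_le_eq_1_pos)
          have "x * x \<le> x" using 2 \<open>x \<le> 1\<close> by (simp add: mult_left_le)
          moreover have "exp (- x) - 1 + x \<le> x * x / 2"
            using exp_neg_compensated_le_square[of x] 2 by (simp only: power2_eq_square)
          ultimately have "exp (- x) \<le> 1 - x / 2" by linarith
          moreover have "\<theta> * x \<le> 1" using 2 \<theta> by (simp add: field_simps)
          then have "exp (\<theta> * x) - 1 \<le> 2 * (\<theta> * x)" using 2 \<theta> by (intro exp_le_one_plus_double) auto
          ultimately have "exp (\<theta> * x) - 1 \<le> 4 * \<theta> * (x / 2)" "4 * \<theta> * (x / 2) \<le> 4 * \<theta> * (1 - exp (- x))"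
            using \<theta> by auto
          then show ?thesis using 2 by simp
        next
          case 3
          have "0 \<le> 4 * \<theta> * (1 - exp (- \<bar>x\<bar>))" using \<theta> by simp
          then show ?thesis using 3 by simp
        qed
      qed
      have "h * \<psi> \<theta> \<le> exp (h * \<psi> \<theta>) - 1" using exp_ge_add_one_self[of "h * \<psi> \<theta>"] by linarith
      also have "\<dots> = expectation (\<lambda>\<omega>. exp (\<theta> * X h \<omega>) - 1)"
        using h \<theta> by (simp add: expectation_exp integrable_exp prob_space)
      also have "\<dots> \<le> expectation (\<lambda>\<omega>. 4 * \<theta> * (1 - exp (- \<bar>X h \<omega>\<bar>)) + exp (\<theta> * X h \<omega>) * indicator {x. 1 / \<theta> < x} (X h \<omega>))"
        using pt int1 int2 integrable_exp[of \<theta> h] h \<theta>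
        by (intro integral_mono Bochner_Integration.integrable_add integrable_mult_right Bochner_Integration.integrable_diff) auto
      also have "\<dots> = 4 * \<theta> * (1 - expectation (\<lambda>\<omega>. exp (- \<bar>X h \<omega>\<bar>))) + R h"
        using int1 int2 by (simp add: R_def prob_space)
      also have "\<dots> \<le> 4 * \<theta> * (K * h) + R h"
        using K(2)[of n] \<theta> unfolding h_def by (intro add_right_mono mult_left_mono) auto
      finally have "\<psi> \<theta> \<le> 4 * \<theta> * K + R h / h" using h by (simp add: field_simps)
      then show ?thesis by (simp add: h_def)
    qed
    moreover have "(\<lambda>n. 4 * \<theta> * K + R (1 / 2 ^ n) / (1 / 2 ^ n)) \<longlonglongrightarrow> 4 * \<theta> * K + 0"
      unfolding R_def
      by (intro tendsto_add tendsto_const filterlim_compose[OF exp_right_tail_small filterlim_dyadic_mesh]) (use \<theta> in auto)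
    ultimately have "\<psi> \<theta> \<le> 4 * \<theta> * K + 0" by (intro LIMSEQ_le_const) auto
    then show ?thesis by (simp add: mult_ac)
  qed
  then show thesis by (rule that)
qed

end

section \<open>Lower bounds for the truncated mean of the passage time\<close>

locale levy_laplace_mean = levy_laplace M X c \<sigma> \<nu> \<psi> + levy_exponent_mean c \<sigma> \<nu> \<psi> m
  for M :: "'a measure" and X c \<sigma> \<nu> \<psi> m
begin

lemma psi_ge_psi_1: "1 \<le> \<theta> \<Longrightarrow> \<psi> 1 \<le> \<psi> \<theta>"
  using psi_ratio_mono[of 1 \<theta>] psi_nonneg[of \<theta>] divide_left_mono[of 1 \<theta> "\<psi> \<theta>"] by simp

lemma over_lap_sum_lower_levy:
  assumes "0 < h" "0 < \<theta>'" "\<theta>' \<le> \<theta>"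
  shows "(n * h * \<psi> \<theta>') / (1 + n * h * \<psi> \<theta>') / \<theta>' \<le> walk.over_lap_sum M (steps h) \<theta> n / \<theta>"
proof (rule walk.over_lap_sum_lower[OF walk_steps])
  show "real n * h * \<psi> \<theta>' \<le> real n * (walk.mgf M (steps h) \<theta>' - 1)"
  proof -
    have "h * \<psi> \<theta>' \<le> exp (h * \<psi> \<theta>') - 1" using exp_ge_add_one_self[of "h * \<psi> \<theta>'"] by linarith
    from mult_left_mono[OF this, of "real n"] show ?thesis using assms by (simp add: mgf_steps mult.assoc)
  qed
qed (use assms psi_nonneg in \<open>auto intro!: mult_nonneg_nonneg\<close>)

text \<open>The large \<theta> is fixed and resolves the level \<open>x\<close>; the small \<theta>'
  stays free to be matched with \<open>t\<close>. The number \<delta> bounds the coefficient in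
  \<open>occupation_lower\<close> from below on all fine meshes.\<close>

lemma truncated_passage_mean_lower:
  assumes t: "0 < t" and x: "0 \<le> x" and \<theta>: "1 \<le> \<theta>" and \<theta>': "0 < \<theta>'" "\<theta>' \<le> 1"
    and psi1: "0 < \<psi> 1"
    and \<delta>: "0 \<le> \<delta>" "\<delta> \<le> \<theta> / (2 * \<psi> \<theta>) - exp (- (\<theta> - 1) * x) / \<psi> 1"
  shows "\<delta> * ((t * \<psi> \<theta>') / (1 + t * \<psi> \<theta>') / \<theta>') - 1 / \<psi> 1 \<le> truncated_passage_mean x t"
proof -
  define L where "L = (t * \<psi> \<theta>') / (1 + t * \<psi> \<theta>') / \<theta>'"
  have L: "0 \<le> L" unfolding L_def using t \<theta>' psi_nonneg[of \<theta>'] by simp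
  have psi\<theta>: "\<psi> 1 \<le> \<psi> \<theta>" "0 < \<psi> \<theta>" using psi_ge_psi_1[OF \<theta>] psi1 by auto
  \<comment> \<open>From this mesh on \<open>h * \<psi> \<theta> \<le> 1\<close>, so that
    \<open>exp (h * \<psi> \<theta>) - 1\<close> is at most twice its linear part.\<close>
  obtain N0 where N0: "t * \<psi> \<theta> < 2 ^ N0" using real_arch_pow[of 2 "t * \<psi> \<theta>"] by auto
  have "\<delta> * L - 1 / \<psi> 1 \<le> truncated_passage_mean x t"
  proof (rule occupation_le_truncated_passage_mean[OF t x, of N0])
    fix n assume n: "N0 \<le> n"
    define h where "h = t / 2 ^ n"
    have h: "0 < h" using t by (simp add: h_def)
    have "(2::real) ^ N0 \<le> 2 ^ n" using n by (intro power_increasing) auto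
    with N0 have "t * \<psi> \<theta> \<le> 2 ^ n" by linarith
    then have hpsi: "h * \<psi> \<theta> \<le> 1" by (simp add: h_def)
    interpret w: walk M "steps h" "distr M borel (X h)" by (rule walk_steps[OF h])
    have mgf: "w.mgf \<theta> = exp (h * \<psi> \<theta>)" "w.mgf 1 = exp (h * \<psi> 1)" using h \<theta> by (simp_all add: mgf_steps)
    define co where "co = h * \<theta> / (w.mgf \<theta> - 1) - h * exp (- (\<theta> - 1) * x) / (w.mgf 1 - 1)"
    have co: "\<delta> \<le> co"
    proof -
      have "\<theta> * (1 / (2 * \<psi> \<theta>)) \<le> \<theta> * (h / (w.mgf \<theta> - 1))"
        unfolding mgf using ratio_exp_minus_one(2)[OF psi\<theta>(2) h hpsi] \<theta> by (intro mult_left_mono) auto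
      moreover have "exp (- (\<theta> - 1) * x) * (h / (w.mgf 1 - 1)) \<le> exp (- (\<theta> - 1) * x) * (1 / \<psi> 1)"
        unfolding mgf using ratio_exp_minus_one(1)[OF psi1 h] by (intro mult_left_mono) auto
      ultimately show ?thesis using \<delta>(2) unfolding co_def by (simp add: mult.commute)
    qed
    have "\<delta> * L - 1 / \<psi> 1 \<le> co * L - h / (w.mgf \<theta> - 1)"
    proof -
      have "h / (w.mgf \<theta> - 1) \<le> 1 / \<psi> \<theta>" unfolding mgf by (rule ratio_exp_minus_one(1)[OF psi\<theta>(2) h])
      also have "\<dots> \<le> 1 / \<psi> 1" using psi\<theta> psi1 by (simp add: frac_le)
      finally show ?thesis using mult_right_mono[OF co L] by linarith
    qed
    also have "\<dots> \<le> (\<Sum>k<(2::nat) ^ n. h * prob {\<omega>\<in>space M. w.low 0 k \<omega> \<le> x})"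
      unfolding co_def
    proof (rule w.occupation_lower[OF x \<theta> _ _ L])
      show "1 < w.mgf \<theta>" "1 < w.mgf 1" unfolding mgf using psi\<theta> psi1 h by auto
      show "L \<le> w.over_lap_sum 1 (2 ^ n)"
        using over_lap_sum_lower_levy[OF h \<theta>', of "2 ^ n"] by (simp add: L_def h_def)
      show "0 \<le> h * \<theta> / (w.mgf \<theta> - 1) - h * exp (- (\<theta> - 1) * x) / (w.mgf 1 - 1)"
        using co \<delta>(1) unfolding co_def by linarith
    qed (rule h)
    finally show "\<delta> * L - 1 / \<psi> 1 \<le> (\<Sum>k<(2::nat) ^ n. t / 2 ^ n * prob {\<omega>\<in>space M. grid_low (t / 2 ^ n) 0 k \<omega> \<le> x})"
      by (simp add: h_def)
  qed
  then show ?thesis by (simp add: L_def)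
qed

text \<open>With quadratic growth the main term of the coefficient is at least
  \<open>1 / (2 * C * \<theta>)\<close>. The exponential term is at most half of this once \<theta>
  is large, which leaves \<open>\<delta> = 1 / (4 * C * \<theta>)\<close>.\<close>

lemma truncated_passage_mean_lower_pos:
  assumes x: "0 < x" and psi1: "0 < \<psi> 1"
  obtains \<delta> where "0 < \<delta>" "\<And>t \<theta>'. 0 < t \<Longrightarrow> 0 < \<theta>' \<Longrightarrow> \<theta>' \<le> 1 \<Longrightarrow>
    \<delta> * ((t * \<psi> \<theta>') / (1 + t * \<psi> \<theta>') / \<theta>') - 1 / \<psi> 1 \<le> truncated_passage_mean x t"
proof -
  obtain C where C: "0 < C" "\<And>t. 1 \<le> t \<Longrightarrow> \<psi> t \<le> C * t\<^sup>2" using psi_upper by auto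
  have "((\<lambda>\<theta>. \<theta> * exp (- (\<theta> - 1) * x)) \<longlongrightarrow> 0) at_top" using x by real_asymp
  then have "\<forall>\<^sub>F \<theta> in at_top. \<theta> * exp (- (\<theta> - 1) * x) < \<psi> 1 / (4 * C)"
    using psi1 C(1) by (intro order_tendstoD(2)) auto
  then obtain N where N: "\<And>\<theta>. N \<le> \<theta> \<Longrightarrow> \<theta> * exp (- (\<theta> - 1) * x) < \<psi> 1 / (4 * C)"
    by (auto simp: eventually_at_top_linorder)
  define \<theta> where "\<theta> = max N 1"
  have \<theta>: "1 \<le> \<theta>" "\<theta> * exp (- (\<theta> - 1) * x) < \<psi> 1 / (4 * C)" using N[of \<theta>] by (auto simp: \<theta>_def)
  have "0 < \<psi> \<theta>" using psi_ge_psi_1[OF \<theta>(1)] psi1 by auto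
  have "exp (- (\<theta> - 1) * x) / \<psi> 1 \<le> 1 / (4 * C * \<theta>)"
    using \<theta> psi1 C(1) by (simp add: field_simps)
  moreover have "1 / (2 * C * \<theta>) \<le> \<theta> / (2 * \<psi> \<theta>)"
    using C(2)[OF \<theta>(1)] \<theta>(1) C(1) \<open>0 < \<psi> \<theta>\<close> by (simp add: field_simps power2_eq_square)
  moreover have "1 / (2 * C * \<theta>) = 1 / (4 * C * \<theta>) + 1 / (4 * C * \<theta>)" by (simp add: field_simps)
  ultimately have "1 / (4 * C * \<theta>) \<le> \<theta> / (2 * \<psi> \<theta>) - exp (- (\<theta> - 1) * x) / \<psi> 1" by linarith
  then show thesis
    using that[of "1 / (4 * C * \<theta>)"] truncated_passage_mean_lower[OF _ _ \<theta>(1) _ _ psi1, of _ x _ "1 / (4 * C * \<theta>)"] x C(1) \<theta>(1)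
    by auto
qed

text \<open>Under linear growth the main term is at least \<open>1 / (2 * C)\<close> for every
  \<theta>. Hence \<open>\<delta> = 1 / (4 * C)\<close> works at each \<open>x > 0\<close>, although
  \<theta> depends on \<open>x\<close>, and the bound survives the limit to level 0.\<close>

lemma truncated_passage_mean_lower_zero:
  assumes C: "\<And>\<theta>. 1 \<le> \<theta> \<Longrightarrow> \<psi> \<theta> \<le> C * \<theta>" and psi1: "0 < \<psi> 1"
  obtains \<delta> where "0 < \<delta>" "\<And>t \<theta>'. 0 < t \<Longrightarrow> 0 < \<theta>' \<Longrightarrow> \<theta>' \<le> 1 \<Longrightarrow>
    \<delta> * ((t * \<psi> \<theta>') / (1 + t * \<psi> \<theta>') / \<theta>') - 1 / \<psi> 1 \<le> truncated_passage_mean 0 t"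
proof -
  have C0: "0 < C" using C[of 1] psi1 by simp
  have "1 / (4 * C) * ((t * \<psi> \<theta>') / (1 + t * \<psi> \<theta>') / \<theta>') - 1 / \<psi> 1 \<le> truncated_passage_mean x t"
    if t: "0 < t" "0 < \<theta>'" "\<theta>' \<le> 1" and x: "0 < x" for t \<theta>' x
  proof -
    have "((\<lambda>\<theta>. exp (- (\<theta> - 1) * x)) \<longlongrightarrow> 0) at_top" using x by real_asymp
    then have "\<forall>\<^sub>F \<theta> in at_top. exp (- (\<theta> - 1) * x) < \<psi> 1 / (4 * C)"
      using psi1 C0 by (intro order_tendstoD(2)) auto
    then obtain N where N: "\<And>\<theta>. N \<le> \<theta> \<Longrightarrow> exp (- (\<theta> - 1) * x) < \<psi> 1 / (4 * C)"
      by (auto simp: eventually_at_top_linorder)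
    define \<theta> where "\<theta> = max N 1"
    have \<theta>: "1 \<le> \<theta>" "exp (- (\<theta> - 1) * x) < \<psi> 1 / (4 * C)" using N[of \<theta>] by (auto simp: \<theta>_def)
    have "0 < \<psi> \<theta>" using psi_ge_psi_1[OF \<theta>(1)] psi1 by auto
    have "exp (- (\<theta> - 1) * x) / \<psi> 1 \<le> 1 / (4 * C)" using \<theta> psi1 C0 by (simp add: field_simps)
    moreover have "1 / (2 * C) \<le> \<theta> / (2 * \<psi> \<theta>)"
      using C[OF \<theta>(1)] \<theta>(1) C0 \<open>0 < \<psi> \<theta>\<close> by (simp add: field_simps)
    moreover have "1 / (2 * C) = 1 / (4 * C) + 1 / (4 * C)" by (simp add: field_simps)
    ultimately have "1 / (4 * C) \<le> \<theta> / (2 * \<psi> \<theta>) - exp (- (\<theta> - 1) * x) / \<psi> 1" by linarith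
    then show ?thesis
      using truncated_passage_mean_lower[OF t(1) _ \<theta>(1) t(2,3) psi1, of x "1 / (4 * C)"] x C0 by auto
  qed
  then have "1 / (4 * C) * ((t * \<psi> \<theta>') / (1 + t * \<psi> \<theta>') / \<theta>') - 1 / \<psi> 1 \<le> truncated_passage_mean 0 t"
    if "0 < t" "0 < \<theta>'" "\<theta>' \<le> 1" for t \<theta>'
    using that by (intro truncated_passage_mean_zero) auto
  then show thesis using that[of "1 / (4 * C)"] C0 by auto
qed

lemma truncated_passage_mean_lower_admissible:
  assumes x: "admissible_level M X x" and psi1: "0 < \<psi> 1"
  obtains \<delta> where "0 < \<delta>" "\<And>t \<theta>'. 0 < t \<Longrightarrow> 0 < \<theta>' \<Longrightarrow> \<theta>' \<le> 1 \<Longrightarrow>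
    \<delta> * ((t * \<psi> \<theta>') / (1 + t * \<psi> \<theta>') / \<theta>') - 1 / \<psi> 1 \<le> truncated_passage_mean x t"
proof (cases "x = 0")
  case True
  with x have "\<not> unbounded_variation_paths M X" by (simp add: admissible_level_def)
  then obtain C where "\<And>\<theta>. 1 \<le> \<theta> \<Longrightarrow> \<psi> \<theta> \<le> C * \<theta>" using psi_linear_bound by blast
  with truncated_passage_mean_lower_zero[OF _ psi1] that True show thesis by blast
next
  case False
  with x have "0 < x" by (simp add: admissible_level_def)
  with truncated_passage_mean_lower_pos[OF _ psi1] that show thesis by blast
qed

end

section \<open>Moments of the passage time\<close>

lemma ennreal_le_suminf: "f n \<le> (\<Sum>n. f n)" for f :: "nat \<Rightarrow> ennreal"
  using sum_le_suminf[of f "{n}"] by simp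

lemma measurable_time_power [measurable]: "(\<lambda>T. time_power T k) \<in> borel_measurable borel"
  unfolding time_power_def by measurable

lemma measurable_exp_time [measurable]: "exp_time q \<in> borel_measurable borel"
  unfolding exp_time_def[abs_def] by measurable

lemma time_power_le_exp_time:
  assumes "0 < q" "0 \<le> k"
  obtains C :: real where "\<And>T. time_power T k \<le> ennreal C * exp_time q T"
proof (cases "k = 0")
  case True
  have "time_power T k \<le> ennreal 1 * exp_time q T" for T
    using True assms by (simp add: time_power_def exp_time_def one_ennreal_def[symmetric] flip: ennreal_1) (auto simp: ennreal_leI)
  then show thesis by (rule that)
next
  case False
  \<comment> \<open>From \<open>u \<le> exp u\<close> at \<open>u = q * t / k\<close>, raised to the
    power \<open>k\<close>.\<close>
  define C where "C = (k / q) powr k"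
  have C: "0 < C" using False assms by (simp add: C_def)
  have "time_power T k \<le> ennreal C * exp_time q T" for T
  proof (cases T)
    case (real t)
    have "q * t / k \<le> exp (q * t / k)" using exp_ge_add_one_self[of "q * t / k"] by linarith
    then have "(q * t / k) powr k \<le> exp (q * t / k) powr k"
      using real assms by (intro powr_mono2) auto
    also have "\<dots> = exp (q * t)" using False by (simp add: exp_powr_real)
    finally have "C * (q * t / k) powr k \<le> C * exp (q * t)" using C by simp
    moreover have "C * (q * t / k) powr k = t powr k"
      unfolding C_def using real assms False by (subst powr_mult[symmetric]) auto
    ultimately have "t powr k \<le> C * exp (q * t)" by simp
    then show ?thesis using real False C
      by (simp add: time_power_def exp_time_def ennreal_leI flip: ennreal_mult)
  next
    case top
    then show ?thesis using C False by (simp add: time_power_def exp_time_def ennreal_mult_top)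
  qed
  then show thesis by (rule that)
qed

context levy_laplace begin

lemma prob_level_bound:
  assumes "0 \<le> \<theta>" "0 < t"
  shows "prob {\<omega>\<in>space M. - x \<le> X t \<omega>} \<le> exp (\<theta> * x + t * \<psi> \<theta>)"
proof -
  have [measurable]: "X t \<in> borel_measurable M" using assms by (auto intro: measurable_X)
  have "prob {\<omega>\<in>space M. - x \<le> X t \<omega>} = expectation (indicator {\<omega>\<in>space M. - x \<le> X t \<omega>})"
    by simp
  also have "\<dots> \<le> expectation (\<lambda>\<omega>. exp (\<theta> * x) * exp (\<theta> * X t \<omega>))"
  proof (rule integral_mono)
    show "integrable M (\<lambda>\<omega>. exp (\<theta> * x) * exp (\<theta> * X t \<omega>))"
      using assms by (intro integrable_mult_right integrable_exp) auto
    fix \<omega>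
    have "0 \<le> \<theta> * (x + X t \<omega>)" if "- x \<le> X t \<omega>" using that assms by simp
    then show "indicator {\<omega>\<in>space M. - x \<le> X t \<omega>} \<omega> \<le> exp (\<theta> * x) * exp (\<theta> * X t \<omega>)"
      by (auto simp: indicator_def algebra_simps simp flip: exp_add)
  qed (simp add: emeasure_eq_measure)
  also have "\<dots> = exp (\<theta> * x + t * \<psi> \<theta>)"
    using assms by (simp add: expectation_exp exp_add)
  finally show ?thesis .
qed

text \<open>Before passage the path is at least \<open>- x\<close> at each positive integer time, so
  the exponential is dominated by the term of the last such time.\<close>

lemma exp_time_le_suminf:
  assumes "\<omega> \<in> space M" "0 < q"
  shows "exp_time q (passage_below X x \<omega>) \<le> ennreal (exp (2 * q)) +
    (\<Sum>n. ennreal (exp (q * (real n + 3))) * indicator {\<omega>\<in>space M. - x \<le> X (real (Suc n)) \<omega>} \<omega>)" (is "_ \<le> _ + (\<Sum>n. ?f n)")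
proof (cases "passage_below X x \<omega>")
  case (real T)
  show ?thesis
  proof (cases "T \<le> 2")
    case True
    then have "exp_time q (passage_below X x \<omega>) \<le> ennreal (exp (2 * q))"
      using real assms by (simp add: exp_time_def ennreal_leI)
    then show ?thesis by (rule order_trans) simp
  next
    case False
    \<comment> \<open>\<open>n + 1\<close> is the last integer strictly before \<open>T\<close>;
      strictness excludes passage by that time.\<close>
    define n where "n = nat (\<lceil>T\<rceil> - 2)"
    have "3 \<le> \<lceil>T\<rceil>" using False by linarith
    then have "real n = of_int (\<lceil>T\<rceil> - 2)" unfolding n_def by (intro of_nat_nat) linarith
    then have n': "real (Suc n) < T" "T \<le> real n + 3" by (simp_all, linarith+)
    have "- x \<le> X (real (Suc n)) \<omega>"
    proof (rule ccontr)
      assume "\<not> - x \<le> X (real (Suc n)) \<omega>"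
      then have "passage_below X x \<omega> \<le> ennreal (real (Suc n))" by (intro passage_below_le) auto
      then show False using n'(1) real by (simp add: ennreal_le_iff del: ennreal_plus of_nat_Suc)
    qed
    then have "exp_time q (passage_below X x \<omega>) \<le> ?f n"
      using real n'(2) assms by (simp add: exp_time_def ennreal_leI mult_left_mono)
    also have "?f n \<le> (\<Sum>n. ?f n)"
      by (rule ennreal_le_suminf)
    finally show ?thesis by (rule order_trans) simp
  qed
next
  case top
  \<comment> \<open>Without passage every summand is at least 1, so the series is infinite
    too.\<close>
  have *: "1 \<le> ?f n" for n
  proof -
    have "- x \<le> X (real (Suc n)) \<omega>"
    proof (rule ccontr)
      assume "\<not> - x \<le> X (real (Suc n)) \<omega>"
      then have "passage_below X x \<omega> \<le> ennreal (real (Suc n))" by (intro passage_below_le) auto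
      then show False using top by (simp add: top_unique)
    qed
    moreover have "ennreal 1 \<le> ennreal (exp (q * (real n + 3)))" using assms by (intro ennreal_leI) simp
    ultimately show ?thesis using assms by simp
  qed
  have "of_nat N \<le> (\<Sum>n. ?f n)" for N
  proof -
    have "of_nat N = (\<Sum>n<N. 1 :: ennreal)" by simp
    also have "\<dots> \<le> (\<Sum>n<N. ?f n)" using * by (intro sum_mono)
    also have "\<dots> \<le> (\<Sum>n. ?f n)" by (rule sum_le_suminf) auto
    finally show ?thesis .
  qed
  then have "\<not> (\<Sum>n. ?f n) < of_nat N" for N by (simp only: not_less)
  then have "\<not> (\<Sum>n. ?f n) < top" using ennreal_Ex_less_of_nat by blast
  then have "(\<Sum>n. ?f n) = top" by (simp only: less_top[symmetric] not_not)
  then show ?thesis by simp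
qed

lemma exp_moment_finite:
  assumes \<theta>: "0 < \<theta>" "\<psi> \<theta> < 0"
  shows "\<exists>q>0. (\<integral>\<^sup>+\<omega>. exp_time q (passage_below X x \<omega>) \<partial>M) < \<infinity>"
proof -
  \<comment> \<open>Half the decay rate of the level probabilities, so that the series becomes
    geometric with ratio \<open>exp (- q)\<close>.\<close>
  define q where "q = - \<psi> \<theta> / 2"
  have q: "0 < q" using \<theta> by (simp add: q_def)
  have [measurable]: "X (real (Suc n)) \<in> borel_measurable M" "X (1 + real n) \<in> borel_measurable M" for n
    by (auto intro: measurable_X)
  let ?f = "\<lambda>n \<omega>. ennreal (exp (q * (real n + 3))) * indicator {\<omega>\<in>space M. - x \<le> X (real (Suc n)) \<omega>} \<omega>"
  have "(\<integral>\<^sup>+\<omega>. exp_time q (passage_below X x \<omega>) \<partial>M) \<le> (\<integral>\<^sup>+\<omega>. ennreal (exp (2 * q)) + (\<Sum>n. ?f n \<omega>) \<partial>M)"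
    by (intro nn_integral_mono exp_time_le_suminf q)
  also have "\<dots> = ennreal (exp (2 * q)) + (\<Sum>n. \<integral>\<^sup>+\<omega>. ?f n \<omega> \<partial>M)"
    by (simp add: nn_integral_add nn_integral_suminf emeasure_space_1)
  also have "(\<Sum>n. \<integral>\<^sup>+\<omega>. ?f n \<omega> \<partial>M) \<le> (\<Sum>n. ennreal (exp (q + \<theta> * x) * exp (- q) ^ n))"
  proof (rule suminf_le)
    fix n
    have "(\<integral>\<^sup>+\<omega>. ?f n \<omega> \<partial>M) = ennreal (exp (q * (real n + 3)) * prob {\<omega>\<in>space M. - x \<le> X (real (Suc n)) \<omega>})"
      by (simp add: nn_integral_cmult_indicator emeasure_eq_measure ennreal_mult)
    also have "\<dots> \<le> ennreal (exp (q * (real n + 3)) * exp (\<theta> * x + real (Suc n) * \<psi> \<theta>))"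
      using \<theta> by (intro ennreal_leI mult_left_mono prob_level_bound) auto
    also have "exp (q * (real n + 3)) * exp (\<theta> * x + real (Suc n) * \<psi> \<theta>) = exp (q + \<theta> * x) * exp (- q) ^ n"
      by (simp add: q_def algebra_simps add_divide_distrib diff_divide_distrib flip: exp_add exp_of_nat_mult)
    finally show "(\<integral>\<^sup>+\<omega>. ?f n \<omega> \<partial>M) \<le> ennreal (exp (q + \<theta> * x) * exp (- q) ^ n)" .
  qed auto
  also have "(\<Sum>n. ennreal (exp (q + \<theta> * x) * exp (- q) ^ n)) < \<infinity>"
  proof -
    have "summable (\<lambda>n. exp (q + \<theta> * x) * exp (- q) ^ n)"
      using q by (intro summable_mult summable_geometric) simp
    then show ?thesis by (simp add: less_top[symmetric] ennreal_suminf_neq_top)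
  qed
  finally have "(\<integral>\<^sup>+\<omega>. exp_time q (passage_below X x \<omega>) \<partial>M) < \<infinity>"
    by (simp add: ennreal_add_less_top)
  then show ?thesis using q by blast
qed

lemma moments_finite:
  assumes \<theta>: "0 < \<theta>" "\<psi> \<theta> < 0" and k: "0 \<le> k"
  shows "passage_moment M X x k < \<infinity>"
proof -
  obtain q where q: "0 < q" "(\<integral>\<^sup>+\<omega>. exp_time q (passage_below X x \<omega>) \<partial>M) < \<infinity>"
    using exp_moment_finite[OF \<theta>] by blast
  obtain C where C: "\<And>T. time_power T k \<le> ennreal C * exp_time q T"
    using time_power_le_exp_time[OF q(1) k] by blast
  have "passage_moment M X x k \<le> (\<integral>\<^sup>+\<omega>. ennreal C * exp_time q (passage_below X x \<omega>) \<partial>M)"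
    unfolding passage_moment_def by (intro nn_integral_mono C)
  also have "\<dots> = ennreal C * (\<integral>\<^sup>+\<omega>. exp_time q (passage_below X x \<omega>) \<partial>M)"
    by (rule nn_integral_cmult) measurable
  also have "\<dots> < \<infinity>" using q(2) by (simp add: ennreal_mult_less_top)
  finally show ?thesis .
qed

lemma passage_moment_infinite_mono:
  assumes "0 < k" "k \<le> k'" "passage_moment M X x k = \<infinity>"
  shows "passage_moment M X x k' = \<infinity>"
proof -
  have le: "time_power T k \<le> 1 + time_power T k'" for T
  proof (cases T)
    case (real t)
    have "t powr k \<le> 1 + t powr k'"
    proof (cases "t \<le> 1")
      case True
      then have "t powr k \<le> 1" using real assms by (intro powr_le1) auto
      then show ?thesis by (rule order_trans) simp
    next
      case False
      then have "t powr k \<le> t powr k'" using assms by (intro powr_mono) auto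
      then show ?thesis by simp
    qed
    then have "ennreal (t powr k) \<le> ennreal (1 + t powr k')" by (rule ennreal_leI)
    then show ?thesis using real assms by (simp add: time_power_def)
  qed (use assms in \<open>simp add: time_power_def\<close>)
  have "passage_moment M X x k \<le> (\<integral>\<^sup>+\<omega>. 1 + time_power (passage_below X x \<omega>) k' \<partial>M)"
    unfolding passage_moment_def by (intro nn_integral_mono le)
  also have "\<dots> = 1 + passage_moment M X x k'"
    unfolding passage_moment_def by (simp add: nn_integral_add emeasure_space_1)
  finally have "top \<le> 1 + passage_moment M X x k'" using assms by simp
  then show ?thesis by (simp add: top_unique)
qed

lemma truncated_passage_mean_nn_integral:
  assumes "0 < t"
  shows "ennreal (truncated_passage_mean x t) = (\<integral>\<^sup>+\<omega>. min (passage_below X x \<omega>) (ennreal t) \<partial>M)"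
proof -
  have fin: "min T (ennreal t) < top" for T by (simp add: min_less_iff_disj)
  have "(\<integral>\<^sup>+\<omega>. min (passage_below X x \<omega>) (ennreal t) \<partial>M) =
    (\<integral>\<^sup>+\<omega>. ennreal (enn2real (min (passage_below X x \<omega>) (ennreal t))) \<partial>M)"
    using fin by (intro nn_integral_cong) (simp add: ennreal_enn2real)
  also have "\<dots> = ennreal (truncated_passage_mean x t)"
    unfolding truncated_passage_mean_def
  proof (rule nn_integral_eq_integral)
    show "integrable M (\<lambda>\<omega>. enn2real (min (passage_below X x \<omega>) (ennreal t)))"
      by (rule integrable_const_bound[where B=t]) (use assms in \<open>simp_all add: enn2real_leI less_imp_le\<close>)
  qed simp
  finally show ?thesis by simp
qed

text \<open>Interpolation: write the minimum as its power \<open>1 - k\<close> times its power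
  \<open>k\<close>, and bound the first factor by \<open>t\<close> and the second by
  \<open>T\<close>.\<close>

lemma truncated_passage_mean_le_moment:
  assumes t: "0 < t" and k: "0 < k" "k \<le> 1"
  shows "ennreal (truncated_passage_mean x t) \<le> ennreal (t powr (1 - k)) * passage_moment M X x k"
proof -
  have le: "min T (ennreal t) \<le> ennreal (t powr (1 - k)) * time_power T k" for T
  proof (cases T)
    case (real r)
    have "min r t \<le> t powr (1 - k) * r powr k"
    proof (cases "r = 0")
      case False
      have "min r t = min r t powr (1 - k) * min r t powr k"
        using real t False by (simp flip: powr_add)
      also have "\<dots> \<le> t powr (1 - k) * r powr k"
        using real t k by (intro mult_mono powr_mono2) auto
      finally show ?thesis .
    qed (use t in simp)
    moreover have "min T (ennreal t) = ennreal (min r t)"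
      using real t by (auto simp: min_def ennreal_le_iff)
    ultimately show ?thesis using real k
      by (simp add: time_power_def ennreal_leI flip: ennreal_mult)
  qed (use t k in \<open>simp add: time_power_def ennreal_mult_top\<close>)
  have "ennreal (truncated_passage_mean x t) \<le> (\<integral>\<^sup>+\<omega>. ennreal (t powr (1 - k)) * time_power (passage_below X x \<omega>) k \<partial>M)"
    unfolding truncated_passage_mean_nn_integral[OF t] by (intro nn_integral_mono le)
  also have "\<dots> = ennreal (t powr (1 - k)) * passage_moment M X x k"
    unfolding passage_moment_def by (rule nn_integral_cmult) measurable
  finally show ?thesis .
qed

end

section \<open>The oscillating case\<close>

lemma nn_integral_powr_from_0:
  assumes "0 < k" "0 \<le> T"
  shows "(\<integral>\<^sup>+t. ennreal (t powr (k - 1)) * indicator {0..T} t \<partial>lborel) = ennreal (T powr k / k)"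
  using nn_integral_has_integral_lebesgue'[OF _ has_integral_powr_from_0[of "k - 1" T]] assms by simp

lemma nn_integral_powr_to_inf:
  assumes "k < 1" "0 < T"
  shows "(\<integral>\<^sup>+t. ennreal (t powr (k - 2)) * indicator {T..} t \<partial>lborel) = ennreal (T powr (k - 1) / (1 - k))"
proof -
  have "- (T powr (k - 2 + 1)) / (k - 2 + 1) = T powr (k - 1) / (1 - k)"
    using assms by (simp add: field_simps)
  then show ?thesis
    using nn_integral_has_integral_lebesgue'[OF _ has_integral_powr_to_inf[of "k - 2" T]] assms by simp
qed

text \<open>Splitting at \<open>t = T\<close> gives at most \<open>T powr k / k\<close> from the
  left and \<open>T powr k / (1 - k)\<close> from the right. Thus truncated means, integrated over
  \<open>t\<close>, are controlled by the moment of order \<open>k\<close>.\<close>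

lemma nn_integral_min_powr_le:
  assumes "0 < k" "k < 1"
  shows "(\<integral>\<^sup>+t. min T (ennreal t) * (ennreal (t powr (k - 2)) * indicator {1..} t) \<partial>lborel)
    \<le> ennreal (1 / k + 1 / (1 - k)) * time_power T k"
proof (cases T)
  case (real r)
  show ?thesis
  proof (cases "r = 0")
    case True
    then show ?thesis using real by (simp add: min_def)
  next
    case False
    then have r: "0 < r" using real by simp
    have "(\<integral>\<^sup>+t. min T (ennreal t) * (ennreal (t powr (k - 2)) * indicator {1..} t) \<partial>lborel)
      \<le> (\<integral>\<^sup>+t. ennreal (t powr (k - 1)) * indicator {0..r} t + ennreal r * (ennreal (t powr (k - 2)) * indicator {r..} t) \<partial>lborel)"
    proof (intro nn_integral_mono)
      fix t :: real
      show "min T (ennreal t) * (ennreal (t powr (k - 2)) * indicator {1..} t)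
        \<le> ennreal (t powr (k - 1)) * indicator {0..r} t + ennreal r * (ennreal (t powr (k - 2)) * indicator {r..} t)"
      proof (cases "1 \<le> t")
        case True
        show ?thesis
        proof (cases "t \<le> r")
          case t: True
          have "min T (ennreal t) * ennreal (t powr (k - 2)) = ennreal (t * t powr (k - 2))"
            using real True t by (simp add: min_def ennreal_mult ennreal_le_iff)
          also have "t * t powr (k - 2) = t powr (k - 1)" using True powr_mult_base[of t "k - 2"] by simp
          finally show ?thesis using t True by simp
        next
          case t: False
          then have "min T (ennreal t) = ennreal r" using real True by (simp add: min_def ennreal_leI)
          then show ?thesis using t True by simp
        qed
      qed simp
    qed
    also have "\<dots> = (\<integral>\<^sup>+t. ennreal (t powr (k - 1)) * indicator {0..r} t \<partial>lborel) + ennreal r * (\<integral>\<^sup>+t. ennreal (t powr (k - 2)) * indicator {r..} t \<partial>lborel)"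
      by (subst nn_integral_add) (auto simp: nn_integral_cmult)
    also have "\<dots> = ennreal (r powr k / k) + ennreal r * ennreal (r powr (k - 1) / (1 - k))"
      using assms r by (simp add: nn_integral_powr_from_0 nn_integral_powr_to_inf)
    also have "\<dots> = ennreal ((1 / k + 1 / (1 - k)) * r powr k)"
      using assms r powr_mult_base[of r "k - 1"] by (simp add: algebra_simps flip: ennreal_plus ennreal_mult)
    also have "\<dots> = ennreal (1 / k + 1 / (1 - k)) * time_power T k"
      using real assms by (simp add: time_power_def ennreal_mult del: ennreal_plus)
    finally show ?thesis .
  qed
next
  case top
  have "0 < 1 / k + 1 / (1 - k)" using assms by (intro add_pos_pos) auto
  then show ?thesis using top assms by (simp add: time_power_def ennreal_mult_top del: ennreal_plus)
qed

context levy_exponent begin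

text \<open>\<nu> has finite mass away from 0, where \<open>min 1 (y\<^sup>2)\<close> is bounded
  below. Fubini's theorem needs this.\<close>

lemma sigma_finite_nu: "sigma_finite_measure \<nu>"
proof
  define A where "A n = {y\<in>space \<nu>. y \<in> {1 / real (Suc n) ..}}" for n :: nat
  have A: "A n \<in> sets \<nu>" for n unfolding A_def by (rule sets_nu_borel) simp
  have "emeasure \<nu> (A n) \<noteq> \<infinity>" for n
  proof -
    have "ennreal ((1 / real (Suc n))\<^sup>2) * emeasure \<nu> (A n) = (\<integral>\<^sup>+y. ennreal ((1 / real (Suc n))\<^sup>2) * indicator (A n) y \<partial>\<nu>)"
      using A by (simp add: nn_integral_cmult_indicator)
    also have "\<dots> \<le> (\<integral>\<^sup>+y. ennreal (min 1 (y\<^sup>2)) \<partial>\<nu>)"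
    proof (rule nn_integral_mono)
      fix y
      have "(1 / real (Suc n))\<^sup>2 \<le> min 1 (y\<^sup>2)" if "1 / real (Suc n) \<le> y"
        using that power_mono[OF that, of 2] power_le_one[of "1 / real (Suc n)" 2] by simp
      then show "ennreal ((1 / real (Suc n))\<^sup>2) * indicator (A n) y \<le> ennreal (min 1 (y\<^sup>2))"
        by (auto simp: A_def indicator_def intro!: ennreal_leI)
    qed
    also have "\<dots> < \<infinity>" by (rule levy_measure)
    finally show ?thesis by (auto simp: ennreal_mult_eq_top_iff less_top[symmetric])
  qed
  moreover have "(\<Union>n. A n) = space \<nu>"
  proof -
    have "\<exists>n. 1 / real (Suc n) \<le> y" if "0 < y" for y :: real
      using reals_Archimedean[OF that] by (auto simp: inverse_eq_divide intro: less_imp_le)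
    then show ?thesis by (auto simp: A_def space_nu)
  qed
  ultimately show "\<exists>A. countable A \<and> A \<subseteq> sets \<nu> \<and> \<Union>A = space \<nu> \<and> (\<forall>a\<in>A. emeasure \<nu> a \<noteq> \<infinity>)"
    using A by (intro exI[of _ "range A"]) auto
qed

lemma measurable_nu_pair:
  "(\<lambda>p. (fst p, snd p)) \<in> measurable (\<nu> \<Otimes>\<^sub>M lborel) (borel \<Otimes>\<^sub>M (borel :: real measure))"
proof (rule measurable_Pair)
  show "fst \<in> measurable (\<nu> \<Otimes>\<^sub>M (lborel :: real measure)) borel"
    using measurable_compose[OF measurable_fst measurable_nu[OF measurable_ident]] by simp
qed simp

end

context levy_laplace_mean begin

text \<open>If \<open>\<psi> 1 = 0\<close>, then also \<open>\<psi> (1 / 2) = 0\<close>, and the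
  second moment of \<open>exp (X t / 2) - 1\<close> is 0. Hence \<open>X t = 0\<close> almost
  surely, simultaneously at positive rational times and by right-continuity at all times: the pure
  drift of slope 0.\<close>

lemma psi_1_pos:
  assumes "m = 0" "\<not> pure_drift M X"
  shows "0 < \<psi> 1"
proof (rule ccontr)
  assume "\<not> 0 < \<psi> 1"
  then have psi1: "\<psi> 1 = 0" using psi_nonneg[of 1] by simp
  have psi2: "\<psi> (1 / 2) = 0" using psi_scale_le[of "1 / 2" 1] psi_nonneg[of "1 / 2"] psi1 by simp
  have zero: "AE \<omega> in M. X t \<omega> = 0" if t: "0 < t" for t
  proof -
    have [measurable]: "X t \<in> borel_measurable M" using t by (auto intro: measurable_X)
    have int: "integrable M (\<lambda>\<omega>. exp (1 * X t \<omega>))" "integrable M (\<lambda>\<omega>. exp (1 / 2 * X t \<omega>))"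
      using t by (intro integrable_exp; simp)+
    have sq: "(exp (1 / 2 * X t \<omega>) - 1)\<^sup>2 = exp (1 * X t \<omega>) - 2 * exp (1 / 2 * X t \<omega>) + 1" for \<omega>
      by (simp add: power2_eq_square algebra_simps flip: exp_add)
    have "expectation (\<lambda>\<omega>. (exp (1 / 2 * X t \<omega>) - 1)\<^sup>2) = 0"
      unfolding sq using int t expectation_exp[of 1 t] expectation_exp[of "1 / 2" t] psi1 psi2
      by (simp add: prob_space)
    moreover have "integrable M (\<lambda>\<omega>. (exp (1 / 2 * X t \<omega>) - 1)\<^sup>2)"
      unfolding sq using int by simp
    ultimately have "AE \<omega> in M. (exp (1 / 2 * X t \<omega>) - 1)\<^sup>2 = 0"
      by (subst integral_nonneg_eq_0_iff_AE[symmetric]) auto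
    then show ?thesis by eventually_elim simp
  qed
  have "AE \<omega> in M. \<forall>q::rat. 0 < q \<longrightarrow> X (of_rat q) \<omega> = 0"
    unfolding AE_all_countable using zero by (auto simp: zero_less_of_rat_iff)
  then have "AE \<omega> in M. \<forall>t\<ge>0. X t \<omega> = 0 * t" using AE_space
  proof eventually_elim
    case (elim \<omega>)
    show ?case
    proof (intro allI impI, rule ccontr)
      fix t :: real assume t: "0 \<le> t" "X t \<omega> \<noteq> 0 * t"
      then have "\<forall>\<^sub>F u in at_right t. X u \<omega> \<noteq> 0"
        using right_continuous[OF elim(2) t(1)] by (intro tendsto_imp_eventually_ne) auto
      then obtain b where b: "t < b" "\<And>u. t < u \<Longrightarrow> u < b \<Longrightarrow> X u \<omega> \<noteq> 0"
        by (auto simp: eventually_at_right_field)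
      obtain q where q: "t < of_rat q" "of_rat q < b" using of_rat_dense[OF b(1)] by blast
      then have "(0::real) < of_rat q" using t(1) by linarith
      then have "0 < q" by (simp add: zero_less_of_rat_iff)
      then show False using elim(1) b(2)[OF q] by auto
    qed
  qed
  then have "pure_drift M X" unfolding pure_drift_def by (rule exI)
  with assms show False by simp
qed

lemma passage_moment_infinite_gt_half:
  assumes m: "m = 0" and psi1: "0 < \<psi> 1" and x: "admissible_level M X x" and k: "1 / 2 < k"
  shows "passage_moment M X x k = \<infinity>"
proof -
  \<comment> \<open>Interpolation needs an order of at most 1.\<close>
  define l where "l = min k 1"
  have l: "1 / 2 < l" "l \<le> 1" "l \<le> k" using k by (auto simp: l_def)
  have "passage_moment M X x l = \<infinity>"
  proof (cases "passage_moment M X x l")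
    case (real B)
    obtain \<delta> where \<delta>: "0 < \<delta>" "\<And>t \<theta>'. 0 < t \<Longrightarrow> 0 < \<theta>' \<Longrightarrow> \<theta>' \<le> 1 \<Longrightarrow>
      \<delta> * ((t * \<psi> \<theta>') / (1 + t * \<psi> \<theta>') / \<theta>') - 1 / \<psi> 1 \<le> truncated_passage_mean x t"
      using truncated_passage_mean_lower_admissible[OF x psi1] by blast
    \<comment> \<open>With \<open>t * \<psi> \<theta> = 1\<close> the fraction in the lower bound is
      1/2. After multiplication by \<theta> the moment term is of order
      \<open>\<theta> powr (2 * l - 1)\<close>, which vanishes at 0 because
      \<open>l > 1 / 2\<close>.\<close>
    have le: "\<delta> / 2 \<le> \<theta> / \<psi> 1 + \<theta> * ((1 / (\<psi> 1 * \<theta>\<^sup>2)) powr (1 - l) * B)" if \<theta>: "0 < \<theta>" "\<theta> < 1" for \<theta>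
    proof -
      have low: "\<psi> 1 * \<theta>\<^sup>2 \<le> \<psi> \<theta>" using psi_scale_ge[OF m, of \<theta> 1] \<theta> by (simp add: mult.commute)
      have pos: "0 < \<psi> 1 * \<theta>\<^sup>2" using psi1 \<theta> by simp
      define t where "t = 1 / \<psi> \<theta>"
      have t: "0 < t" "t \<le> 1 / (\<psi> 1 * \<theta>\<^sup>2)" "t * \<psi> \<theta> = 1"
        using low pos unfolding t_def by (auto intro!: divide_left_mono mult_pos_pos)
      have "\<delta> * (1 / 2 / \<theta>) - 1 / \<psi> 1 \<le> truncated_passage_mean x t"
        using \<delta>(2)[of t \<theta>] t \<theta> by simp
      also have "truncated_passage_mean x t \<le> t powr (1 - l) * B"
        using truncated_passage_mean_le_moment[OF t(1), of l x] l real
        by (simp add: ennreal_le_iff flip: ennreal_mult)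
      also have "\<dots> \<le> (1 / (\<psi> 1 * \<theta>\<^sup>2)) powr (1 - l) * B"
        using t l real by (intro mult_right_mono powr_mono2) auto
      finally have "\<theta> * (\<delta> * (1 / 2 / \<theta>) - 1 / \<psi> 1) \<le> \<theta> * ((1 / (\<psi> 1 * \<theta>\<^sup>2)) powr (1 - l) * B)"
        using \<theta> by (intro mult_left_mono) auto
      then show ?thesis using \<theta> by (simp add: algebra_simps)
    qed
    have "((\<lambda>\<theta>. \<theta> / \<psi> 1 + \<theta> * ((1 / (\<psi> 1 * \<theta>\<^sup>2)) powr (1 - l) * B)) \<longlongrightarrow> 0) (at_right 0)"
    proof (rule Lim_transform_eventually)
      have "0 < 2 * l - 1" using l by simp
      then have "((\<lambda>\<theta>. \<theta> powr (2 * l - 1)) \<longlongrightarrow> 0) (at_right 0)" by real_asymp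
      moreover have "((\<lambda>\<theta>::real. \<theta>) \<longlongrightarrow> 0) (at_right 0)" by (rule tendsto_ident_at)
      ultimately have "((\<lambda>\<theta>. \<theta> / \<psi> 1 + (B * \<psi> 1 powr (l - 1)) * \<theta> powr (2 * l - 1)) \<longlongrightarrow> 0 / \<psi> 1 + (B * \<psi> 1 powr (l - 1)) * 0) (at_right 0)"
        using psi1 by (intro tendsto_intros) auto
      then show "((\<lambda>\<theta>. \<theta> / \<psi> 1 + (B * \<psi> 1 powr (l - 1)) * \<theta> powr (2 * l - 1)) \<longlongrightarrow> 0) (at_right 0)" by simp
      show "\<forall>\<^sub>F \<theta> in at_right 0. \<theta> / \<psi> 1 + (B * \<psi> 1 powr (l - 1)) * \<theta> powr (2 * l - 1)
        = \<theta> / \<psi> 1 + \<theta> * ((1 / (\<psi> 1 * \<theta>\<^sup>2)) powr (1 - l) * B)"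
        using eventually_at_right_less[of "0::real"]
      proof eventually_elim
        case (elim \<theta>)
        have "\<psi> 1 * \<theta>\<^sup>2 = \<psi> 1 * \<theta> powr 2" using elim by simp
        then have "(1 / (\<psi> 1 * \<theta>\<^sup>2)) powr (1 - l) = (\<psi> 1 * \<theta> powr 2) powr (l - 1)"
          using psi1 elim by (simp add: powr_divide powr_minus_divide[symmetric])
        also have "\<dots> = \<psi> 1 powr (l - 1) * \<theta> powr (2 * (l - 1))"
          unfolding powr_powr[symmetric] by (rule powr_mult)
        finally have "\<theta> * ((1 / (\<psi> 1 * \<theta>\<^sup>2)) powr (1 - l) * B) = B * \<psi> 1 powr (l - 1) * (\<theta> * \<theta> powr (2 * (l - 1)))"
          by simp
        also have "\<theta> * \<theta> powr (2 * (l - 1)) = \<theta> powr (2 * l - 1)"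
          using elim powr_mult_base[of \<theta> "2 * (l - 1)"] by (simp add: algebra_simps)
        finally show ?case by (simp only:)
      qed
    qed
    moreover have "\<forall>\<^sub>F \<theta> in at_right 0. \<delta> / 2 \<le> \<theta> / \<psi> 1 + \<theta> * ((1 / (\<psi> 1 * \<theta>\<^sup>2)) powr (1 - l) * B)"
      unfolding eventually_at_right_field using le by (intro exI[of _ 1]) auto
    ultimately have "\<delta> / 2 \<le> 0" by (rule tendsto_lowerbound) simp
    then show ?thesis using \<delta>(1) by simp
  qed simp
  then show ?thesis using l by (intro passage_moment_infinite_mono[of l k]) auto
qed

text \<open>It suffices to integrate over \<open>{y..2 * y}\<close>: there
  \<open>y / t \<ge> 1 / 2\<close>, so the compensated exponential is at least its value at 1/2, and
  the length of the interval adds one power of \<open>y\<close>.\<close>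

lemma nn_integral_compensated_lower:
  assumes y: "1 \<le> y" and k: "0 < k"
  shows "ennreal ((exp (- (1 / 2)) - 1 + 1 / 2) * y powr (k + 1)) \<le>
    (\<integral>\<^sup>+t. ennreal (t powr k * (exp (- (1 / t * y)) - 1 + 1 / t * y)) * indicator {1..} t \<partial>lborel)"
proof -
  let ?e = "exp (- (1 / 2)) - 1 + (1 / 2 :: real)"
  have e: "0 \<le> ?e" by (rule exp_neg_compensated_nonneg)
  have "ennreal (?e * y powr (k + 1)) = ennreal (y powr k * ?e) * ennreal (2 * y - y)"
    using y e by (simp add: powr_add ennreal_mult[symmetric] algebra_simps)
  also have "\<dots> = (\<integral>\<^sup>+t. ennreal (y powr k * ?e) * indicator {y..2 * y} t \<partial>lborel)"
    using y by (subst nn_integral_cmult_indicator) auto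
  also have "\<dots> \<le> (\<integral>\<^sup>+t. ennreal (t powr k * (exp (- (1 / t * y)) - 1 + 1 / t * y)) * indicator {1..} t \<partial>lborel)"
  proof (rule nn_integral_mono)
    fix t :: real
    have "y powr k * ?e \<le> t powr k * (exp (- (1 / t * y)) - 1 + 1 / t * y)" if t: "y \<le> t" "t \<le> 2 * y"
    proof (intro mult_mono powr_mono2)
      define u where "u = 1 / t * y"
      have u: "1 / 2 \<le> u" using t y by (simp add: u_def field_simps)
      then have "?e \<le> (1 / 2 / u) * (exp (- u) - 1 + u)"
        using exp_neg_compensated_scale_le[of "1 / 2 / u" u] by simp
      also have "\<dots> \<le> 1 * (exp (- u) - 1 + u)"
        using u by (intro mult_right_mono exp_neg_compensated_nonneg) auto
      finally show "?e \<le> exp (- (1 / t * y)) - 1 + 1 / t * y" by (simp add: u_def)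
    qed (use y k t e in auto)
    then show "ennreal (y powr k * ?e) * indicator {y..2 * y} t
      \<le> ennreal (t powr k * (exp (- (1 / t * y)) - 1 + 1 / t * y)) * indicator {1..} t"
      using y by (auto simp: indicator_def intro!: ennreal_leI)
  qed
  finally show ?thesis .
qed

lemma jump_moment_finite_of_passage_moment:
  assumes m: "m = 0" and psi1: "0 < \<psi> 1" and x: "admissible_level M X x" and k: "0 < k" "k < 1"
    and fin: "passage_moment M X x k < \<infinity>"
  shows "jump_moment (k + 1) < \<infinity>"
proof -
  interpret \<nu>: sigma_finite_measure \<nu> by (rule sigma_finite_nu)
  interpret P: pair_sigma_finite \<nu> lborel ..
  interpret Q: pair_sigma_finite M lborel ..
  obtain \<delta> where \<delta>: "0 < \<delta>" "\<And>t \<theta>'. 0 < t \<Longrightarrow> 0 < \<theta>' \<Longrightarrow> \<theta>' \<le> 1 \<Longrightarrow>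
    \<delta> * ((t * \<psi> \<theta>') / (1 + t * \<psi> \<theta>') / \<theta>') - 1 / \<psi> 1 \<le> truncated_passage_mean x t"
    using truncated_passage_mean_lower_admissible[OF x psi1] by blast
  define e where "e u = exp (- u) - 1 + (u::real)" for u
  have e_nonneg: "0 \<le> e u" for u unfolding e_def by (rule exp_neg_compensated_nonneg)
  have [measurable]: "e \<in> borel_measurable borel" unfolding e_def[abs_def] by measurable
  define w where "w t = ennreal (t powr (k - 2)) * indicator {1..} t" for t :: real
  have [measurable]: "w \<in> borel_measurable borel" unfolding w_def[abs_def] by measurable
  \<comment> \<open>For \<open>t \<ge> 1\<close> monotonicity of
    \<open>\<psi> \<theta> / \<theta>\<close> gives
    \<open>t * \<psi> (1 / t) \<le> \<psi> 1\<close>, so \<open>1 + \<psi> 1\<close> bounds the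
    denominator.\<close>
  define \<delta>' where "\<delta>' = \<delta> / (1 + \<psi> 1)"
  have \<delta>': "0 < \<delta>'" using \<delta>(1) psi1 by (simp add: \<delta>'_def)
  have point: "ennreal (\<delta>' * t\<^sup>2 * compensated_part (1 / t)) \<le> (\<integral>\<^sup>+\<omega>. min (passage_below X x \<omega>) (ennreal t) \<partial>M) + ennreal (1 / \<psi> 1)"
    if t: "1 \<le> t" for t
  proof -
    have "t * \<psi> (1 / t) \<le> \<psi> 1" using psi_ratio_mono[of "1 / t" 1] t by (simp add: mult.commute)
    have s: "0 \<le> t * \<psi> (1 / t)" using t psi_nonneg by simp
    have "\<delta>' * t\<^sup>2 * compensated_part (1 / t) \<le> \<delta>' * t\<^sup>2 * \<psi> (1 / t)"
      using \<delta>' t m by (intro mult_left_mono) (auto simp: psi_mean)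
    also have "\<dots> = \<delta> * ((t * \<psi> (1 / t)) / (1 + \<psi> 1) / (1 / t))"
      using t by (simp add: \<delta>'_def power2_eq_square)
    also have "\<dots> \<le> \<delta> * ((t * \<psi> (1 / t)) / (1 + t * \<psi> (1 / t)) / (1 / t))"
      using \<delta>(1) t s \<open>t * \<psi> (1 / t) \<le> \<psi> 1\<close> by (intro mult_left_mono divide_right_mono divide_left_mono) auto
    also have "\<dots> \<le> truncated_passage_mean x t + 1 / \<psi> 1"
      using \<delta>(2)[of t "1 / t"] t by simp
    finally have "ennreal (\<delta>' * t\<^sup>2 * compensated_part (1 / t)) \<le> ennreal (truncated_passage_mean x t + 1 / \<psi> 1)"
      by (rule ennreal_leI)
    also have "\<dots> = ennreal (truncated_passage_mean x t) + ennreal (1 / \<psi> 1)"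
      using psi1 by (intro ennreal_plus) (auto simp: truncated_passage_mean_def intro!: Bochner_Integration.integral_nonneg)
    finally show ?thesis using truncated_passage_mean_nn_integral[of t x] t by simp
  qed
  have comp: "ennreal (compensated_part (1 / t)) = (\<integral>\<^sup>+y. ennreal (e (1 / t * y)) \<partial>\<nu>)" if "1 \<le> t" for t
    unfolding compensated_part_def e_def using that integrable_compensated[of "1 / t"]
    by (subst nn_integral_eq_integral) (auto simp: exp_neg_compensated_nonneg)
  have "(\<integral>\<^sup>+t. (\<integral>\<^sup>+\<omega>. min (passage_below X x \<omega>) (ennreal t) \<partial>M) * w t \<partial>lborel) =
    (\<integral>\<^sup>+\<omega>. (\<integral>\<^sup>+t. min (passage_below X x \<omega>) (ennreal t) * w t \<partial>lborel) \<partial>M)"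
    by (subst Q.Fubini'[symmetric]) (auto simp: nn_integral_multc)
  also have "\<dots> \<le> (\<integral>\<^sup>+\<omega>. ennreal (1 / k + 1 / (1 - k)) * time_power (passage_below X x \<omega>) k \<partial>M)"
    unfolding w_def by (intro nn_integral_mono nn_integral_min_powr_le k)
  also have "\<dots> = ennreal (1 / k + 1 / (1 - k)) * passage_moment M X x k"
    unfolding passage_moment_def by (rule nn_integral_cmult) measurable
  also have "\<dots> < \<infinity>" using fin by (simp add: ennreal_mult_less_top del: ennreal_plus)
  finally have fin1: "(\<integral>\<^sup>+t. (\<integral>\<^sup>+\<omega>. min (passage_below X x \<omega>) (ennreal t) \<partial>M) * w t \<partial>lborel) < \<infinity>" .
  \<comment> \<open>Here \<open>k < 1\<close> makes the weight integrable at infinity.\<close>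
  have fin2: "(\<integral>\<^sup>+t. w t \<partial>lborel) < \<infinity>" unfolding w_def using nn_integral_powr_to_inf[of k 1] k by simp
  define c0 where "c0 = e (1 / 2)"
  \<comment> \<open>Strict positivity at 2 is evident and is transported to 1/2 by the quadratic
    scaling inequality with factor 1/4.\<close>
  have c0: "0 < c0"
  proof -
    have "0 < exp (- 2) - 1 + (2::real)" using exp_gt_zero[of "- 2 :: real"] by (smt (verit))
    then have "0 < (1 / 4)\<^sup>2 * (exp (- 2) - 1 + (2::real))" by simp
    also have "\<dots> \<le> exp (- (1 / 4 * 2)) - 1 + 1 / 4 * (2::real)" by (rule exp_neg_compensated_scale_ge) auto
    finally show ?thesis by (simp add: c0_def e_def)
  qed
  have "ennreal c0 * jump_moment (k + 1) = (\<integral>\<^sup>+y. ennreal c0 * (ennreal (y powr (k + 1)) * indicator {1..} y) \<partial>\<nu>)"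
    by (rule nn_integral_cmult[symmetric]) (rule measurable_nu, measurable)
  also have "\<dots> \<le> (\<integral>\<^sup>+y. (\<integral>\<^sup>+t. ennreal (t powr k * e (1 / t * y)) * indicator {1..} t \<partial>lborel) \<partial>\<nu>)"
    using nn_integral_compensated_lower[OF _ k(1)] c0
    by (intro nn_integral_mono) (auto simp: indicator_def c0_def e_def ennreal_mult[symmetric])
  also have "\<dots> = (\<integral>\<^sup>+t. (\<integral>\<^sup>+y. ennreal (t powr k * e (1 / t * y)) * indicator {1..} t \<partial>\<nu>) \<partial>lborel)"
  proof (rule P.Fubini'[symmetric])
    have "(\<lambda>(y, t). ennreal (t powr k * e (1 / t * y)) * indicator {1..} t) \<in> borel_measurable (borel \<Otimes>\<^sub>M borel)"
      by measurable
    from measurable_compose[OF measurable_nu_pair this]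
    show "(\<lambda>(y, t). ennreal (t powr k * e (1 / t * y)) * indicator {1..} t) \<in> borel_measurable (\<nu> \<Otimes>\<^sub>M lborel)"
      by (simp add: case_prod_beta')
  qed
  also have "\<dots> \<le> (\<integral>\<^sup>+t. ennreal (1 / \<delta>') * ((\<integral>\<^sup>+\<omega>. min (passage_below X x \<omega>) (ennreal t) \<partial>M) * w t + ennreal (1 / \<psi> 1) * w t) \<partial>lborel)"
  proof (rule nn_integral_mono)
    fix t :: real
    show "(\<integral>\<^sup>+y. ennreal (t powr k * e (1 / t * y)) * indicator {1..} t \<partial>\<nu>) \<le>
      ennreal (1 / \<delta>') * ((\<integral>\<^sup>+\<omega>. min (passage_below X x \<omega>) (ennreal t) \<partial>M) * w t + ennreal (1 / \<psi> 1) * w t)"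
    proof (cases "1 \<le> t")
      case True
      have "(\<integral>\<^sup>+y. ennreal (t powr k * e (1 / t * y)) * indicator {1..} t \<partial>\<nu>) = (\<integral>\<^sup>+y. ennreal (t powr k) * ennreal (e (1 / t * y)) \<partial>\<nu>)"
        using True e_nonneg by (simp add: ennreal_mult)
      also have "\<dots> = ennreal (t powr k) * ennreal (compensated_part (1 / t))"
        unfolding comp[OF True] by (rule nn_integral_cmult) (rule measurable_nu, measurable)
      also have "\<dots> = ennreal (1 / \<delta>') * (ennreal (\<delta>' * t\<^sup>2 * compensated_part (1 / t)) * ennreal (t powr (k - 2)))"
      proof -
        have "t powr k = t powr 2 * t powr (k - 2)" by (simp flip: powr_add)
        also have "t powr 2 = t\<^sup>2" using True by simp
        finally have "t powr k * compensated_part (1 / t) = 1 / \<delta>' * (\<delta>' * t\<^sup>2 * compensated_part (1 / t) * t powr (k - 2))"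
          using \<delta>' by simp
        then show ?thesis using \<delta>' compensated_part_nonneg[of "1 / t"] by (simp flip: ennreal_mult)
      qed
      also have "\<dots> \<le> ennreal (1 / \<delta>') * (((\<integral>\<^sup>+\<omega>. min (passage_below X x \<omega>) (ennreal t) \<partial>M) + ennreal (1 / \<psi> 1)) * ennreal (t powr (k - 2)))"
        by (intro mult_left_mono mult_right_mono point True) auto
      also have "\<dots> = ennreal (1 / \<delta>') * ((\<integral>\<^sup>+\<omega>. min (passage_below X x \<omega>) (ennreal t) \<partial>M) * w t + ennreal (1 / \<psi> 1) * w t)"
        using True by (simp add: w_def distrib_right)
      finally show ?thesis .
    qed simp
  qed
  also have "\<dots> = ennreal (1 / \<delta>') * ((\<integral>\<^sup>+t. (\<integral>\<^sup>+\<omega>. min (passage_below X x \<omega>) (ennreal t) \<partial>M) * w t \<partial>lborel) + ennreal (1 / \<psi> 1) * (\<integral>\<^sup>+t. w t \<partial>lborel))"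
    by (simp add: nn_integral_cmult nn_integral_add)
  also have "\<dots> < \<infinity>" using fin1 fin2 by (simp add: ennreal_mult_less_top ennreal_add_less_top)
  finally show ?thesis using c0 by (auto simp: ennreal_mult_less_top)
qed

end

section \<open>Uniqueness of Laplace transforms\<close>

text \<open>For a law on [-1, 1] the Taylor polynomial of the characteristic function is determined
  by the moments, and its error at \<open>t\<close> is at most
  \<open>2 * \<bar>t\<bar> ^ n / fact n\<close>. So the characteristic functions agree.\<close>

lemma real_distribution_eq_of_moments:
  assumes "real_distribution M1" "real_distribution M2"
    and bound: "AE x in M1. \<bar>x\<bar> \<le> 1" "AE x in M2. \<bar>x\<bar> \<le> 1"
    and moments: "\<And>k. (\<integral>x. x ^ k \<partial>M1) = (\<integral>x. x ^ k \<partial>M2)"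
  shows "M1 = M2"
proof (rule Levy_uniqueness[OF assms(1,2)], rule ext)
  interpret M1: real_distribution M1 by fact
  interpret M2: real_distribution M2 by fact
  have approx: "cmod (char N t - (\<Sum>k\<le>n. ((\<i> * t) ^ k / fact k) * (\<integral>x. x ^ k \<partial>N))) \<le> 2 * \<bar>t\<bar> ^ n / fact n"
    if N: "real_distribution N" and b: "AE x in N. \<bar>x\<bar> \<le> 1" for N t n
  proof -
    interpret N: real_distribution N by fact
    have pw: "AE x in N. \<bar>x ^ k\<bar> \<le> 1" for k
      using b by eventually_elim (simp add: power_abs power_le_one)
    have int: "integrable N (\<lambda>x. x ^ k)" for k
      using pw[of k] by (intro N.integrable_const_bound[where B=1]) auto
    have "cmod (char N t - (\<Sum>k\<le>n. ((\<i> * t) ^ k / fact k) * (\<integral>x. x ^ k \<partial>N))) \<le> (2 * \<bar>t\<bar> ^ n / fact n) * (\<integral>x. \<bar>x\<bar> ^ n \<partial>N)"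
      using N.char_approx1[of n t] int by simp
    also have "(\<integral>x. \<bar>x\<bar> ^ n \<partial>N) \<le> (\<integral>x. 1 \<partial>N)"
      using pw[of n] integrable_abs[OF int[of n]] by (intro integral_mono_AE) (auto simp: power_abs)
    then have "(2 * \<bar>t\<bar> ^ n / fact n) * (\<integral>x. \<bar>x\<bar> ^ n \<partial>N) \<le> (2 * \<bar>t\<bar> ^ n / fact n) * 1"
      using N.prob_space by (intro mult_left_mono) auto
    finally show ?thesis by simp
  qed
  fix t :: real
  have "cmod (char M1 t - char M2 t) \<le> 4 * (\<bar>t\<bar> ^ n / fact n)" for n
  proof -
    define S where "S = (\<Sum>k\<le>n. ((\<i> * t) ^ k / fact k) * (\<integral>x. x ^ k \<partial>M1))"
    have "cmod (char M1 t - S) \<le> 2 * \<bar>t\<bar> ^ n / fact n"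
      unfolding S_def by (rule approx[OF assms(1) bound(1)])
    moreover have "cmod (char M2 t - S) \<le> 2 * \<bar>t\<bar> ^ n / fact n"
      unfolding S_def moments by (rule approx[OF assms(2) bound(2)])
    moreover have "cmod (char M1 t - char M2 t) \<le> cmod (char M1 t - S) + cmod (char M2 t - S)"
      using norm_triangle_ineq4[of "char M1 t - S" "char M2 t - S"] by simp
    ultimately show ?thesis by simp
  qed
  moreover have "(\<lambda>n. 4 * (\<bar>t\<bar> ^ n / fact n)) \<longlonglongrightarrow> 4 * 0"
    using summable_LIMSEQ_zero[OF summable_exp[of "\<bar>t\<bar>"]]
    by (intro tendsto_mult tendsto_const) (simp add: divide_inverse mult.commute)
  ultimately have "cmod (char M1 t - char M2 t) \<le> 4 * 0"
    by (intro LIMSEQ_le_const) auto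
  then show "char M1 t = char M2 t" by simp
qed

text \<open>The measures may be infinite, so each is first tilted by \<open>exp (- x) / r\<close> to
  a probability measure and then mapped by \<open>u = exp (- x)\<close> into the unit interval. The
  \<open>k\<close>-th moment of the image is the transform at \<open>k + 1\<close> divided by
  \<open>r\<close>, and both operations are invertible.\<close>

lemma laplace_unique:
  fixes A B :: "real measure"
  assumes sets: "sets A = sets borel" "sets B = sets borel"
    and nonneg: "AE x in A. 0 \<le> x" "AE x in B. 0 \<le> x"
    and eq: "\<And>\<theta>. 0 < \<theta> \<Longrightarrow> (\<integral>\<^sup>+x. ennreal (exp (- \<theta> * x)) \<partial>A) = (\<integral>\<^sup>+x. ennreal (exp (- \<theta> * x)) \<partial>B)"
    and fin: "(\<integral>\<^sup>+x. ennreal (exp (- x)) \<partial>A) < \<infinity>"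
  shows "A = B"
proof -
  note [measurable_cong] = sets
  obtain r where r: "(\<integral>\<^sup>+x. ennreal (exp (- x)) \<partial>A) = ennreal r" "0 \<le> r"
    using fin by (cases "\<integral>\<^sup>+x. ennreal (exp (- x)) \<partial>A") auto
  then have rB: "(\<integral>\<^sup>+x. ennreal (exp (- x)) \<partial>B) = ennreal r" using eq[of 1] by simp
  show ?thesis
  proof (cases "r = 0")
    case True
    have "emeasure N (space N) = 0" if "(\<integral>\<^sup>+x. ennreal (exp (- x)) \<partial>N) = 0" and [measurable_cong]: "sets N = sets borel" for N :: "real measure"
    proof -
      have "AE x in N. ennreal (exp (- x)) = 0" using that(1) by (subst (asm) nn_integral_0_iff_AE) auto
      then have "AE x in N. False" by eventually_elim simp
      then show ?thesis by (simp add: AE_iff_null_sets null_setsD1)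
    qed
    then have "emeasure A (space A) = 0" "emeasure B (space B) = 0" using True r rB sets by auto
    then show ?thesis using sets
      by (intro measure_eqI) (auto, metis emeasure_space le_zero_eq)
  next
    case False
    with r have pos: "0 < r" by simp
    define T where "T N = distr (density N (\<lambda>x. ennreal (exp (- x) / r))) borel (\<lambda>x. exp (- x))" for N :: "real measure"
    have dist: "real_distribution (T N)" and bnd: "AE x in T N. \<bar>x\<bar> \<le> 1"
      and recover: "N = density (distr (T N) borel (\<lambda>u. - ln u)) (\<lambda>x. ennreal (exp x * r))"
      and moment: "(\<integral>u. u ^ k \<partial>T N) = enn2real (\<integral>\<^sup>+x. ennreal (exp (- real (Suc k) * x)) \<partial>N) / r"
      if [measurable_cong]: "sets N = sets borel" and nn: "AE x in N. 0 \<le> x"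
        and mass: "(\<integral>\<^sup>+x. ennreal (exp (- x)) \<partial>N) = ennreal r" for N k
    proof -
      have inv: "ennreal (exp (- x) / r) = ennreal (1 / r) * ennreal (exp (- x))" for x
        using pos by (simp flip: ennreal_mult)
      have "prob_space (T N)"
        unfolding T_def
      proof (rule prob_space.prob_space_distr)
        show "prob_space (density N (\<lambda>x. ennreal (exp (- x) / r)))"
        proof
          have "emeasure (density N (\<lambda>x. ennreal (exp (- x) / r))) (space (density N (\<lambda>x. ennreal (exp (- x) / r))))
             = (\<integral>\<^sup>+x. ennreal (exp (- x) / r) \<partial>N)" by (simp add: emeasure_density cong: nn_integral_cong)
          also have "\<dots> = ennreal (1 / r) * ennreal r"
            unfolding inv mass[symmetric] by (rule nn_integral_cmult) measurable
          also have "\<dots> = 1" using pos by (simp flip: ennreal_mult)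
          finally show "emeasure (density N (\<lambda>x. ennreal (exp (- x) / r))) (space (density N (\<lambda>x. ennreal (exp (- x) / r)))) = 1" .
        qed
      qed measurable
      then show "real_distribution (T N)" by (simp add: real_distribution_def real_distribution_axioms_def T_def)
      show "AE x in T N. \<bar>x\<bar> \<le> 1"
        unfolding T_def using nn by (subst AE_distr_iff) (auto simp: AE_density elim!: eventually_mono)
      show "N = density (distr (T N) borel (\<lambda>u. - ln u)) (\<lambda>x. ennreal (exp x * r))"
      proof -
        have "distr (T N) borel (\<lambda>u. - ln u) = distr (density N (\<lambda>x. ennreal (exp (- x) / r))) borel (\<lambda>x. x)"
          unfolding T_def by (subst distr_distr) (auto simp: comp_def)
        also have "\<dots> = density N (\<lambda>x. ennreal (exp (- x) / r))"
          using that(1) by (intro distr_id2) simp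
        finally have "density (distr (T N) borel (\<lambda>u. - ln u)) (\<lambda>x. ennreal (exp x * r)) = density N (\<lambda>x. ennreal (exp (- x) / r) * ennreal (exp x * r))"
          by (simp add: density_density_eq)
        also have "\<dots> = density N (\<lambda>x. 1)" using pos by (simp add: exp_minus flip: ennreal_mult)
        finally show ?thesis by (simp add: density_1)
      qed
      show "(\<integral>u. u ^ k \<partial>T N) = enn2real (\<integral>\<^sup>+x. ennreal (exp (- real (Suc k) * x)) \<partial>N) / r"
      proof -
        have "(\<integral>u. u ^ k \<partial>T N) = (\<integral>x. exp (- x) / r * exp (- x) ^ k \<partial>N)"
          unfolding T_def using pos by (simp add: integral_distr integral_density)
        also have "\<dots> = (\<integral>x. exp (- real (Suc k) * x) / r \<partial>N)"
          by (intro Bochner_Integration.integral_cong refl) (simp add: algebra_simps flip: exp_of_nat_mult exp_add)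
        also have "\<dots> = (\<integral>x. exp (- real (Suc k) * x) \<partial>N) / r" by simp
        also have "(\<integral>x. exp (- real (Suc k) * x) \<partial>N) = enn2real (\<integral>\<^sup>+x. ennreal (exp (- real (Suc k) * x)) \<partial>N)"
          by (intro integral_eq_nn_integral) auto
        finally show ?thesis .
      qed
    qed
    have "T A = T B"
    proof (rule real_distribution_eq_of_moments)
      show "(\<integral>x. x ^ k \<partial>T A) = (\<integral>x. x ^ k \<partial>T B)" for k
        unfolding moment[OF sets(1) nonneg(1) r(1)] moment[OF sets(2) nonneg(2) rB] by (simp only: eq of_nat_0_less_iff zero_less_Suc)
    qed (rule dist[OF sets(1) nonneg(1) r(1)] dist[OF sets(2) nonneg(2) rB] bnd[OF sets(1) nonneg(1) r(1)] bnd[OF sets(2) nonneg(2) rB])+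
    then show ?thesis
      using recover[OF sets(1) nonneg(1) r(1)] recover[OF sets(2) nonneg(2) rB] by metis
  qed
qed

lemma (in prob_space) nn_integral_layer_cake:
  fixes Z :: "'a \<Rightarrow> real" and w :: "real \<Rightarrow> ennreal"
  assumes [measurable]: "Z \<in> borel_measurable M" "w \<in> borel_measurable borel"
  shows "(\<integral>\<^sup>+\<omega>. (\<integral>\<^sup>+t. w t * indicator {0..<Z \<omega>} t \<partial>lborel) \<partial>M)
    = (\<integral>\<^sup>+t. w t * (emeasure M {\<omega>\<in>space M. t < Z \<omega>} * indicator {0..} t) \<partial>lborel)"
proof -
  interpret P: pair_sigma_finite M lborel ..
  have "(\<integral>\<^sup>+\<omega>. (\<integral>\<^sup>+t. w t * indicator {0..<Z \<omega>} t \<partial>lborel) \<partial>M)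
    = (\<integral>\<^sup>+\<omega>. (\<integral>\<^sup>+t. w t * indicator {0..} t * (if t < Z \<omega> then 1 else 0) \<partial>lborel) \<partial>M)"
    by (intro nn_integral_cong) (auto simp: indicator_def)
  also have "\<dots> = (\<integral>\<^sup>+t. (\<integral>\<^sup>+\<omega>. w t * indicator {0..} t * (if t < Z \<omega> then 1 else 0) \<partial>M) \<partial>lborel)"
    by (rule P.Fubini'[symmetric]) measurable
  also have "\<dots> = (\<integral>\<^sup>+t. w t * (emeasure M {\<omega>\<in>space M. t < Z \<omega>} * indicator {0..} t) \<partial>lborel)"
  proof (rule nn_integral_cong)
    fix t :: real
    have "(\<integral>\<^sup>+\<omega>. w t * indicator {0..} t * (if t < Z \<omega> then 1 else 0) \<partial>M) = (\<integral>\<^sup>+\<omega>. w t * indicator {0..} t * indicator {\<omega>\<in>space M. t < Z \<omega>} \<omega> \<partial>M)"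
      by (intro nn_integral_cong) (auto simp: indicator_def)
    also have "\<dots> = w t * indicator {0..} t * emeasure M {\<omega>\<in>space M. t < Z \<omega>}"
      by (rule nn_integral_cmult_indicator) measurable
    finally show "(\<integral>\<^sup>+\<omega>. w t * indicator {0..} t * (if t < Z \<omega> then 1 else 0) \<partial>M) = w t * (emeasure M {\<omega>\<in>space M. t < Z \<omega>} * indicator {0..} t)"
      by (simp add: mult_ac)
  qed
  finally show ?thesis .
qed

section \<open>The all-time depth under positive drift\<close>

context levy_process begin

text \<open>\<open>ennreal\<close> sends negative reals to 0, so positive values of the path
  contribute depth 0. An infinite depth is not excluded at this point.\<close>

definition low_sup :: "'a \<Rightarrow> ennreal" where
  "low_sup \<omega> = (SUP t\<in>{0..}. ennreal (- X t \<omega>))"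

lemma low_sup_grid:
  assumes "\<omega> \<in> space M" "0 < t"
  shows "low_sup \<omega> = (SUP n. SUP k. ennreal (- X (real k * (t / 2 ^ n)) \<omega>))"
proof (rule antisym)
  show "(SUP n. SUP k. ennreal (- X (real k * (t / 2 ^ n)) \<omega>)) \<le> low_sup \<omega>"
    unfolding low_sup_def using assms(2) by (intro SUP_least SUP_upper) simp
  show "low_sup \<omega> \<le> (SUP n. SUP k. ennreal (- X (real k * (t / 2 ^ n)) \<omega>))"
    unfolding low_sup_def
  proof (rule SUP_least, rule dense_le)
    fix s z assume s: "s \<in> {0..}" and z: "z < ennreal (- X s \<omega>)"
    then obtain y where y: "z = ennreal y" "0 \<le> y" by (cases z) auto
    with z have "X s \<omega> < - y" by (simp add: ennreal_less_iff)
    obtain n k where "0 < k" "s < real k * (t / 2 ^ n)" "real k * (t / 2 ^ n) < s + 1" and "X (real k * (t / 2 ^ n)) \<omega> < - y"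
      by (rule grid_dense[OF assms _ \<open>X s \<omega> < - y\<close> zero_less_one]) (use s in auto)
    then have "z \<le> ennreal (- X (real k * (t / 2 ^ n)) \<omega>)"
      unfolding y by (intro ennreal_leI) simp
    also have "\<dots> \<le> (SUP n. SUP k. ennreal (- X (real k * (t / 2 ^ n)) \<omega>))"
      by (rule SUP_upper2[of n]) (auto intro: SUP_upper)
    finally show "z \<le> (SUP n. SUP k. ennreal (- X (real k * (t / 2 ^ n)) \<omega>))" .
  qed
qed

lemma measurable_low_sup [measurable]: "low_sup \<in> borel_measurable M"
proof -
  have [measurable]: "X (real k * (1 / 2 ^ n)) \<in> borel_measurable M" for k n by (rule measurable_X) simp
  have "(\<lambda>\<omega>. SUP n. SUP k. ennreal (- X (real k * (1 / 2 ^ n)) \<omega>)) \<in> borel_measurable M"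
    by (intro borel_measurable_SUP countableI_type) measurable
  then show ?thesis
    using low_sup_grid[of _ 1] by (subst measurable_cong) auto
qed

end

text \<open>The value 0 at infinity is needed because finiteness of \<open>low_sup\<close> is itself
  deduced from this transform.\<close>

definition ennreal_exp_neg :: "real \<Rightarrow> ennreal \<Rightarrow> real" where
  "ennreal_exp_neg \<theta> z = (if z = \<infinity> then 0 else exp (- \<theta> * enn2real z))"

lemma measurable_ennreal_exp_neg [measurable]: "ennreal_exp_neg \<theta> \<in> borel_measurable borel"
  unfolding ennreal_exp_neg_def[abs_def] by measurable

lemma ennreal_exp_neg_tendsto:
  assumes \<theta>: "0 < \<theta>" and u: "\<And>n. 0 \<le> u n" and lim: "(\<lambda>n. ennreal (u n)) \<longlonglongrightarrow> z"
  shows "(\<lambda>n. exp (- \<theta> * u n)) \<longlonglongrightarrow> ennreal_exp_neg \<theta> z"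
proof (cases z)
  case (real r)
  then have "u \<longlonglongrightarrow> r" using lim u by (intro tendsto_ennrealD) auto
  then have "(\<lambda>n. exp (- \<theta> * u n)) \<longlonglongrightarrow> exp (- \<theta> * r)" by (intro tendsto_intros)
  then show ?thesis using real by (simp add: ennreal_exp_neg_def)
next
  case top
  have "filterlim u at_top sequentially"
    unfolding filterlim_at_top_dense
  proof
    fix B :: real
    have "\<forall>\<^sub>F n in sequentially. ennreal B < ennreal (u n)"
      using lim top by (intro order_tendstoD(1)[of _ top]) auto
    then show "\<forall>\<^sub>F n in sequentially. B < u n" by eventually_elim (metis ennreal_leI leD not_less)
  qed
  then have "filterlim (\<lambda>n. \<theta> * u n) at_top sequentially"
    using \<theta> by (intro filterlim_tendsto_pos_mult_at_top[OF tendsto_const])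
  then have "filterlim (\<lambda>n. - (\<theta> * u n)) at_bot sequentially"
    by (simp add: filterlim_uminus_at_bot)
  then have "(\<lambda>n. exp (- (\<theta> * u n))) \<longlonglongrightarrow> 0" by (rule filterlim_compose[OF exp_at_bot])
  then show ?thesis using top by (simp add: ennreal_exp_neg_def)
qed

context levy_laplace begin

text \<open>\<open>4 ^ n\<close> steps of length \<open>t / 2 ^ n\<close> reach time
  \<open>2 ^ n * t\<close>: mesh and horizon are refined together. Each grid contains the previous
  one, so the depths increase.\<close>

lemma grid_low_tendsto:
  assumes \<omega>: "\<omega> \<in> space M" "X 0 \<omega> = 0" and t: "0 < t"
  shows "(\<lambda>n. ennreal (grid_low (t / 2 ^ n) 0 (4 ^ n) \<omega>)) \<longlonglongrightarrow> low_sup \<omega>"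
proof -
  define h where "h n = t / 2 ^ n" for n :: nat
  define J where "J n = grid_low (h n) 0 (4 ^ n) \<omega>" for n
  have h: "0 < h n" for n using t by (simp add: h_def)
  have J0: "0 \<le> J n" for n unfolding J_def by (rule walk.low_nonneg[OF walk_steps[OF h]])
  have J_iff: "J n \<le> a \<longleftrightarrow> (\<forall>k\<le>4 ^ n. - a \<le> X (real k * h n) \<omega>)" if "0 \<le> a" for n a
    unfolding J_def grid_low_le_iff[OF h that] using \<omega>(2) by simp
  have "incseq J"
  proof (rule incseq_SucI)
    fix n
    have "- J (Suc n) \<le> X (real k * h n) \<omega>" if k: "k \<le> 4 ^ n" for k
    proof -
      have "- J (Suc n) \<le> X (real (2 * k) * h (Suc n)) \<omega>"
        using k J_iff[OF J0, of "Suc n" "Suc n"] by (auto simp del: of_nat_mult)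
      moreover have "real (2 * k) * h (Suc n) = real k * h n" by (simp add: h_def)
      ultimately show ?thesis by (simp only:)
    qed
    then show "J n \<le> J (Suc n)" using J_iff[OF J0] by blast
  qed
  then have "incseq (\<lambda>n. ennreal (J n))" by (auto simp: incseq_def intro: ennreal_leI)
  then have "(\<lambda>n. ennreal (J n)) \<longlonglongrightarrow> (SUP n. ennreal (J n))" by (rule LIMSEQ_SUP)
  moreover have "(SUP n. ennreal (J n)) = low_sup \<omega>"
  proof (rule antisym)
    show "(SUP n. ennreal (J n)) \<le> low_sup \<omega>"
    proof (rule SUP_least)
      fix n
      show "ennreal (J n) \<le> low_sup \<omega>"
      proof (cases "low_sup \<omega>")
        case (real s)
        have "- s \<le> X (real k * h n) \<omega>" for k
        proof -
          have "ennreal (- X (real k * h n) \<omega>) \<le> low_sup \<omega>"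
            unfolding low_sup_def using h[of n] by (intro SUP_upper) auto
          then show ?thesis using real by (simp add: ennreal_le_iff)
        qed
        then show ?thesis using real J_iff[of s n] by (simp add: ennreal_leI)
      qed simp
    qed
    show "low_sup \<omega> \<le> (SUP n. ennreal (J n))"
      unfolding low_sup_grid[OF \<omega>(1) t]
    proof (intro SUP_least)
      fix n k :: nat
      \<comment> \<open>Large enough for the \<open>k\<close>-th point of the \<open>n\<close>-th
        mesh to lie within the first \<open>4 ^ N\<close> points of the \<open>N\<close>-th.\<close>
      define N where "N = n + k"
      define K where "K = k * 2 ^ (N - n)"
      have "K \<le> 2 ^ N * 2 ^ N"
        unfolding K_def by (intro mult_mono power_increasing) (auto simp: N_def intro: order_trans[OF less_imp_le[OF less_exp]] power_increasing)
      then have K: "K \<le> 4 ^ N" by (simp flip: power_mult_distrib)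
      have Kh: "real K * h N = real k * (t / 2 ^ n)"
        by (simp add: K_def N_def h_def power_add)
      have "- J N \<le> X (real K * h N) \<omega>" using J_iff[OF J0, of N N] K by blast
      then have "ennreal (- X (real k * (t / 2 ^ n)) \<omega>) \<le> ennreal (J N)"
        unfolding Kh by (intro ennreal_leI) simp
      also have "\<dots> \<le> (SUP n. ennreal (J n))" by (rule SUP_upper) simp
      finally show "ennreal (- X (real k * (t / 2 ^ n)) \<omega>) \<le> (SUP n. ennreal (J n))" .
    qed
  qed
  ultimately show ?thesis by (simp add: J_def h_def)
qed

end

context levy_laplace_mean begin

text \<open>\<open>over_lap_sum_lower\<close> with \<open>s = n * h * m * \<theta>'\<close>, after
  which \<theta>' tends to 0.\<close>

lemma over_lap_sum_lower_mean:
  assumes "0 < h" "0 < \<theta>"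
  shows "n * h * m \<le> walk.over_lap_sum M (steps h) \<theta> n / \<theta>"
proof -
  have "((\<lambda>\<theta>'. n * h * m / (1 + n * h * m * \<theta>')) \<longlongrightarrow> n * h * m / (1 + n * h * m * 0)) (at_right 0)"
    by (intro tendsto_intros) auto
  then have lim: "((\<lambda>\<theta>'. n * h * m / (1 + n * h * m * \<theta>')) \<longlongrightarrow> n * h * m) (at_right 0)" by simp
  have "n * h * m / (1 + n * h * m * \<theta>') \<le> walk.over_lap_sum M (steps h) \<theta> n / \<theta>" if "0 < \<theta>'" "\<theta>' < \<theta>" for \<theta>'
  proof -
    have "(n * h * m * \<theta>') / (1 + n * h * m * \<theta>') / \<theta>' \<le> walk.over_lap_sum M (steps h) \<theta> n / \<theta>"
    proof (rule walk.over_lap_sum_lower[OF walk_steps])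
      have "h * (m * \<theta>') \<le> h * \<psi> \<theta>'" using assms that psi_ge[of \<theta>'] by (intro mult_left_mono) auto
      also have "\<dots> \<le> exp (h * \<psi> \<theta>') - 1" using exp_ge_add_one_self[of "h * \<psi> \<theta>'"] by linarith
      finally have "real n * (h * (m * \<theta>')) \<le> real n * (exp (h * \<psi> \<theta>') - 1)" by (intro mult_left_mono) auto
      then show "real n * h * m * \<theta>' \<le> real n * (walk.mgf M (steps h) \<theta>' - 1)"
        using assms that by (simp add: mgf_steps mult.assoc)
    qed (use assms that m_nonneg in \<open>auto intro!: mult_nonneg_nonneg\<close>)
    then show ?thesis using that by simp
  qed
  then have "\<forall>\<^sub>F \<theta>' in at_right 0. n * h * m / (1 + n * h * m * \<theta>') \<le> walk.over_lap_sum M (steps h) \<theta> n / \<theta>"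
    unfolding eventually_at_right_field using assms by (intro exI[of _ \<theta>]) auto
  with lim show ?thesis by (rule tendsto_upperbound) simp
qed

text \<open>For fixed \<open>K\<close> the average of \<open>low_lap \<theta>\<close> over
  \<open>k < n\<close> is at most its value at \<open>K\<close> plus \<open>K / n\<close>, by
  monotonicity. The summed identity divided by \<open>n\<close> then gives the bound as
  \<open>n\<close> tends to infinity.\<close>

lemma low_lap_lower:
  assumes h: "0 < h" and \<theta>: "0 < \<theta>" and m: "0 < m"
  shows "\<theta> * h * m \<le> (exp (h * \<psi> \<theta>) - 1) * walk.low_lap M (steps h) \<theta> K"
proof -
  interpret w: walk M "steps h" "distr M borel (X h)" by (rule walk_steps[OF h])
  have mgf: "w.mgf \<theta> = exp (h * \<psi> \<theta>)" using h \<theta> by (simp add: mgf_steps)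
  have "0 < \<psi> \<theta>" using psi_ge[of \<theta>] mult_pos_pos[OF m \<theta>] \<theta> by linarith
  then have pos: "0 < exp (h * \<psi> \<theta>) - 1" using h by simp
  define E where "E = exp (h * \<psi> \<theta>) - 1"
  have key: "(\<theta> * h * m) \<le> E * w.low_lap \<theta> K + (1 + E * K) / real n" if n: "0 < n" for n :: nat
  proof -
    have "\<theta> * (real n * h * m) \<le> w.over_lap_sum \<theta> n" using over_lap_sum_lower_mean[OF h \<theta>, of n] \<theta> by (simp add: field_simps)
    then have 1: "\<theta> * (real n * h * m) - 1 \<le> E * w.low_lap_sum \<theta> n"
      using w.low_lap_sum_eq[of \<theta> n] w.low_lap_nonneg[of \<theta> n] \<theta> by (simp add: mgf E_def)
    have "w.low_lap_sum \<theta> n \<le> (\<Sum>k<n. (if k < K then 1 else 0) + w.low_lap \<theta> K)"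
      unfolding w.low_lap_sum_def
    proof (rule sum_mono)
      fix k
      show "w.low_lap \<theta> k \<le> (if k < K then 1 else 0) + w.low_lap \<theta> K"
        using w.low_lap_le_1[of \<theta> k] w.low_lap_antimono[of \<theta> K k] w.low_lap_nonneg[of \<theta> K] \<theta> by (auto simp: not_less)
    qed
    also have "\<dots> = (\<Sum>k<n. if k < K then 1 else 0) + n * w.low_lap \<theta> K" by (simp add: sum.distrib)
    also have "(\<Sum>k<n. if k < K then 1 else (0::real)) = (\<Sum>k\<in>{..<n} \<inter> {..<K}. 1)"
      by (subst sum.inter_restrict) (auto intro!: sum.cong)
    also have "\<dots> \<le> real K" using card_mono[of "{..<K}" "{..<n} \<inter> {..<K}"] by simp
    finally have "E * w.low_lap_sum \<theta> n \<le> E * (real K + n * w.low_lap \<theta> K)" using pos by (intro mult_left_mono) (auto simp: E_def)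
    with 1 have "\<theta> * (real n * h * m) \<le> 1 + E * (real K + n * w.low_lap \<theta> K)" by linarith
    moreover have "real n * (E * w.low_lap \<theta> K + (1 + E * K) / n) = 1 + E * (real K + n * w.low_lap \<theta> K)"
      using n by (simp add: field_simps)
    ultimately have "real n * (\<theta> * h * m) \<le> real n * (E * w.low_lap \<theta> K + (1 + E * K) / n)"
      by (simp add: mult_ac)
    then show ?thesis using n by simp
  qed
  have "(\<lambda>n. E * w.low_lap \<theta> K + (1 + E * K) / real n) \<longlonglongrightarrow> E * w.low_lap \<theta> K + 0"
    by (intro tendsto_add tendsto_const lim_const_over_n)
  moreover have "\<forall>\<^sub>F n in sequentially. \<theta> * h * m \<le> E * w.low_lap \<theta> K + (1 + E * K) / real n"
    using key by (auto simp: eventually_sequentially intro!: exI[of _ 1])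
  ultimately have "\<theta> * h * m \<le> E * w.low_lap \<theta> K + 0" by (rule tendsto_lowerbound) simp
  then show ?thesis by (simp add: E_def)
qed

text \<open>The opposite direction at a finite horizon \<open>K\<close>: overshoots at \<theta> are
  compared with those at a small \<theta>', whose sum the identity bounds because
  \<open>low_lap \<theta>'\<close> is at most 1. The term \<open>1 / (K * h)\<close> is the boundary
  term of the identity.\<close>

lemma low_lap_upper:
  assumes h: "0 < h" and \<theta>: "0 < \<theta>'" "\<theta>' \<le> \<theta>" and \<epsilon>: "0 < \<epsilon>" and K: "0 < K"
  shows "walk.low_lap M (steps h) \<theta> K * ((exp (h * \<psi> \<theta>) - 1) / h) \<le>
    \<theta> * exp (\<theta> * \<epsilon>) * (((exp (h * \<psi> \<theta>') - 1) / h + 1 / (K * h)) / \<theta>')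
    + exp_right_part \<theta> \<epsilon> h / h"
proof -
  interpret w: walk M "steps h" "distr M borel (X h)" by (rule walk_steps[OF h])
  have mgf: "w.mgf \<theta> = exp (h * \<psi> \<theta>)" "w.mgf \<theta>' = exp (h * \<psi> \<theta>')" using h \<theta> by (simp_all add: mgf_steps)
  define R where "R = exp_right_part \<theta> \<epsilon> h"
  have R: "expectation (\<lambda>\<omega>. exp (\<theta> * steps h 0 \<omega>) * indicator {x. \<epsilon> < x} (steps h 0 \<omega>)) = R"
    unfolding R_def using expectation_steps[OF h, of "\<lambda>x. exp (\<theta> * x) * indicator {x. \<epsilon> < x} x" 0] by simp
  define E where "E = exp (h * \<psi> \<theta>) - 1"
  define E' where "E' = exp (h * \<psi> \<theta>') - 1"
  have pos: "0 \<le> E" "0 \<le> E'" unfolding E_def E'_def using h \<theta> psi_nonneg[of \<theta>] psi_nonneg[of \<theta>'] by auto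
  have "real K * w.low_lap \<theta> K \<le> w.low_lap_sum \<theta> K"
    unfolding w.low_lap_sum_def using sum_mono[of "{..<K}" "\<lambda>_. w.low_lap \<theta> K" "w.low_lap \<theta>"] w.low_lap_antimono[of \<theta> _ K] \<theta> by simp
  then have "E * (real K * w.low_lap \<theta> K) \<le> E * w.low_lap_sum \<theta> K" using pos by (intro mult_left_mono)
  also have "\<dots> \<le> w.over_lap_sum \<theta> K" using w.low_lap_sum_eq[of \<theta> K] w.low_lap_le_1[of \<theta> K] \<theta> by (simp add: mgf E_def)
  also have "\<dots> \<le> (\<Sum>k<K. \<theta> * exp (\<theta> * \<epsilon>) * (w.over_lap \<theta>' k / \<theta>') + R)"
    unfolding w.over_lap_sum_def using w.over_lap_ratio_upper[OF \<theta> \<epsilon>] R by (intro sum_mono) simp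
  also have "\<dots> = \<theta> * exp (\<theta> * \<epsilon>) * (w.over_lap_sum \<theta>' K / \<theta>') + K * R"
    by (simp add: w.over_lap_sum_def sum.distrib sum_distrib_left sum_divide_distrib)
  also have "w.over_lap_sum \<theta>' K \<le> E' * K + 1"
  proof -
    have "w.low_lap_sum \<theta>' K \<le> K"
      unfolding w.low_lap_sum_def using sum_mono[of "{..<K}" "w.low_lap \<theta>'" "\<lambda>_. 1"] w.low_lap_le_1[of \<theta>'] \<theta> by simp
    then have "E' * w.low_lap_sum \<theta>' K \<le> E' * K" using pos by (intro mult_left_mono)
    then show ?thesis using w.low_lap_sum_eq[of \<theta>' K] w.low_lap_nonneg[of \<theta>' K] \<theta> by (simp add: mgf E'_def)
  qed
  then have "\<theta> * exp (\<theta> * \<epsilon>) * (w.over_lap_sum \<theta>' K / \<theta>') + K * R \<le> \<theta> * exp (\<theta> * \<epsilon>) * ((E' * K + 1) / \<theta>') + K * R"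
    using \<theta> by (intro add_right_mono mult_left_mono divide_right_mono) auto
  finally have "E * (real K * w.low_lap \<theta> K) / (real K * h) \<le> (\<theta> * exp (\<theta> * \<epsilon>) * ((E' * K + 1) / \<theta>') + K * R) / (real K * h)"
    using K h by (intro divide_right_mono) auto
  also have "(\<theta> * exp (\<theta> * \<epsilon>) * ((E' * K + 1) / \<theta>') + K * R) / (real K * h) = \<theta> * exp (\<theta> * \<epsilon>) * ((E' / h + 1 / (K * h)) / \<theta>') + R / h"
    using K h \<theta> by (simp add: field_simps)
  also have "E * (real K * w.low_lap \<theta> K) / (real K * h) = w.low_lap \<theta> K * (E / h)" using K by simp
  finally show ?thesis by (simp add: E_def E'_def R_def)
qed

text \<open>For the upper bound the order of limits matters: first mesh and horizon with \<theta>'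
  and \<epsilon> fixed, which kills the right tail and the boundary term; then \<theta>' to 0, where
  \<open>\<psi> \<theta>' / \<theta>'\<close> tends to \<open>m\<close>; finally \<epsilon> to
  0.\<close>

lemma laplace_low_sup:
  assumes \<theta>: "0 < \<theta>" and m: "0 < m"
  shows "expectation (\<lambda>\<omega>. ennreal_exp_neg \<theta> (low_sup \<omega>)) * \<psi> \<theta> = \<theta> * m"
proof -
  define h where "h n = (1 / 2 ^ n :: real)" for n :: nat
  have h: "0 < h n" for n by (simp add: h_def)
  have h0: "filterlim h (at_right 0) sequentially"
    unfolding h_def[abs_def] by (rule filterlim_dyadic_mesh) simp
  define \<phi> where "\<phi> = expectation (\<lambda>\<omega>. ennreal_exp_neg \<theta> (low_sup \<omega>))"
  note [measurable] = walk.measurable_low[OF walk_steps[OF h]]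
  define b where "b n = walk.low_lap M (steps (h n)) \<theta> (4 ^ n)" for n
  have b_lim: "b \<longlonglongrightarrow> \<phi>"
    unfolding b_def[abs_def] walk.low_lap_def[OF walk_steps[OF h]] \<phi>_def
  proof (rule integral_dominated_convergence[where w="\<lambda>_. 1"])
    show "AE \<omega> in M. (\<lambda>n. exp (- \<theta> * grid_low (h n) 0 (4 ^ n) \<omega>)) \<longlonglongrightarrow> ennreal_exp_neg \<theta> (low_sup \<omega>)"
      using start AE_space
    proof eventually_elim
      case (elim \<omega>)
      show ?case
        using grid_low_tendsto[OF elim(2,1), of 1] walk.low_nonneg[OF walk_steps[OF h]]
        by (intro ennreal_exp_neg_tendsto[OF \<theta>]) (auto simp: h_def)
    qed
    show "AE \<omega> in M. norm (exp (- \<theta> * grid_low (h n) 0 (4 ^ n) \<omega>)) \<le> 1" for n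
      using \<theta> walk.low_nonneg[OF walk_steps[OF h]] by (intro AE_I2) simp
  qed auto
  have E_lim: "(\<lambda>n. (exp (h n * u) - 1) / h n) \<longlonglongrightarrow> u" for u :: real
  proof -
    have "((\<lambda>s. (exp (s * u) - 1) / s) \<longlongrightarrow> u) (at_right 0)" by real_asymp
    then show ?thesis using h0 by (rule filterlim_compose)
  qed
  have prod_lim: "(\<lambda>n. b n * ((exp (h n * \<psi> \<theta>) - 1) / h n)) \<longlonglongrightarrow> \<phi> * \<psi> \<theta>"
    by (intro tendsto_mult b_lim E_lim)
  have "\<theta> * m \<le> \<phi> * \<psi> \<theta>"
  proof (rule LIMSEQ_le_const[OF prod_lim], intro exI allI impI)
    fix n :: nat
    have "\<theta> * h n * m / h n \<le> (exp (h n * \<psi> \<theta>) - 1) * b n / h n"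
      unfolding b_def using h[of n] by (intro divide_right_mono low_lap_lower \<theta> m) auto
    then show "\<theta> * m \<le> b n * ((exp (h n * \<psi> \<theta>) - 1) / h n)" using h[of n] by (simp add: mult.commute)
  qed
  moreover have "\<phi> * \<psi> \<theta> \<le> \<theta> * m"
  proof -
    have 1: "\<phi> * \<psi> \<theta> \<le> \<theta> * exp (\<theta> * \<epsilon>) * (\<psi> \<theta>' / \<theta>')" if \<theta>': "0 < \<theta>'" "\<theta>' \<le> \<theta>" and \<epsilon>: "0 < \<epsilon>" for \<theta>' \<epsilon>
    proof (rule LIMSEQ_le[OF prod_lim])
      have "(\<lambda>n. 1 / (2 ^ n :: real)) \<longlonglongrightarrow> 0" by real_asymp
      moreover have "1 / (real (4 ^ n) * h n) = 1 / 2 ^ n" for n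
      proof -
        have "(4::real) ^ n = 2 ^ n * 2 ^ n" by (simp flip: power_mult_distrib)
        then show ?thesis by (simp add: h_def)
      qed
      ultimately have "(\<lambda>n. 1 / (real (4 ^ n) * h n)) \<longlonglongrightarrow> 0" by simp
      moreover have "(\<lambda>n. exp_right_part \<theta> \<epsilon> (h n) / h n) \<longlonglongrightarrow> 0"
        by (rule filterlim_compose[OF exp_right_tail_small[OF \<theta> \<epsilon>] h0])
      ultimately have "(\<lambda>n. \<theta> * exp (\<theta> * \<epsilon>) * (((exp (h n * \<psi> \<theta>') - 1) / h n + 1 / (real (4 ^ n) * h n)) / \<theta>')
        + exp_right_part \<theta> \<epsilon> (h n) / h n)
        \<longlonglongrightarrow> \<theta> * exp (\<theta> * \<epsilon>) * ((\<psi> \<theta>' + 0) / \<theta>') + 0"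
        using \<theta>' by (intro tendsto_intros E_lim) auto
      then show "(\<lambda>n. \<theta> * exp (\<theta> * \<epsilon>) * (((exp (h n * \<psi> \<theta>') - 1) / h n + 1 / (real (4 ^ n) * h n)) / \<theta>')
        + exp_right_part \<theta> \<epsilon> (h n) / h n)
        \<longlonglongrightarrow> \<theta> * exp (\<theta> * \<epsilon>) * (\<psi> \<theta>' / \<theta>')" by simp
      show "\<exists>N. \<forall>n\<ge>N. b n * ((exp (h n * \<psi> \<theta>) - 1) / h n) \<le>
        \<theta> * exp (\<theta> * \<epsilon>) * (((exp (h n * \<psi> \<theta>') - 1) / h n + 1 / (real (4 ^ n) * h n)) / \<theta>')
        + exp_right_part \<theta> \<epsilon> (h n) / h n"
        unfolding b_def by (intro exI allI impI low_lap_upper h \<theta>' \<epsilon>) simp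
    qed
    have 2: "\<phi> * \<psi> \<theta> \<le> \<theta> * exp (\<theta> * \<epsilon>) * m" if \<epsilon>: "0 < \<epsilon>" for \<epsilon>
    proof (rule tendsto_lowerbound)
      show "((\<lambda>\<theta>'. \<theta> * exp (\<theta> * \<epsilon>) * (\<psi> \<theta>' / \<theta>')) \<longlongrightarrow> \<theta> * exp (\<theta> * \<epsilon>) * m) (at_right 0)"
        by (intro tendsto_mult tendsto_const psi_ratio_tendsto)
      show "\<forall>\<^sub>F \<theta>' in at_right 0. \<phi> * \<psi> \<theta> \<le> \<theta> * exp (\<theta> * \<epsilon>) * (\<psi> \<theta>' / \<theta>')"
        unfolding eventually_at_right_field using 1 \<epsilon> \<theta> by (intro exI[of _ \<theta>]) auto
    qed simp
    have "((\<lambda>\<epsilon>. \<theta> * exp (\<theta> * \<epsilon>) * m) \<longlongrightarrow> \<theta> * exp (\<theta> * 0) * m) (at_right 0)"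
      by (intro tendsto_intros)
    moreover have "\<forall>\<^sub>F \<epsilon> in at_right 0. \<phi> * \<psi> \<theta> \<le> \<theta> * exp (\<theta> * \<epsilon>) * m"
      unfolding eventually_at_right_field using 2 by (intro exI[of _ 1]) auto
    ultimately have "\<phi> * \<psi> \<theta> \<le> \<theta> * exp (\<theta> * 0) * m" by (rule tendsto_lowerbound) simp
    then show ?thesis by simp
  qed
  ultimately show ?thesis by (simp add: \<phi>_def)
qed

text \<open>The transform vanishes at infinite depth, so it bounds the probability of finite depth
  from below. It equals \<open>m / (\<psi> \<theta> / \<theta>)\<close> and tends to 1 as \<theta>
  tends to 0.\<close>

lemma AE_low_sup_finite:
  assumes m: "0 < m"
  shows "AE \<omega> in M. low_sup \<omega> < \<infinity>"
proof -
  have le: "m / (\<psi> \<theta> / \<theta>) \<le> prob {\<omega>\<in>space M. low_sup \<omega> < \<infinity>}" if \<theta>: "0 < \<theta>" for \<theta>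
  proof -
    have pos: "0 < \<psi> \<theta>" using psi_ge[of \<theta>] mult_pos_pos[OF m \<theta>] \<theta> by linarith
    have "expectation (\<lambda>\<omega>. ennreal_exp_neg \<theta> (low_sup \<omega>)) \<le> expectation (indicator {\<omega>\<in>space M. low_sup \<omega> < \<infinity>})"
    proof (rule integral_mono)
      show "integrable M (\<lambda>\<omega>. ennreal_exp_neg \<theta> (low_sup \<omega>))"
        using \<theta> by (intro integrable_const_bound[where B=1]) (auto simp: ennreal_exp_neg_def)
      show "ennreal_exp_neg \<theta> (low_sup \<omega>) \<le> indicator {\<omega>\<in>space M. low_sup \<omega> < \<infinity>} \<omega>" if "\<omega> \<in> space M" for \<omega>
        using \<theta> that by (auto simp: ennreal_exp_neg_def indicator_def less_top)
    qed (simp add: emeasure_eq_measure)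
    moreover have "expectation (\<lambda>\<omega>. ennreal_exp_neg \<theta> (low_sup \<omega>)) = m / (\<psi> \<theta> / \<theta>)"
      using laplace_low_sup[OF \<theta> m] pos \<theta> by (simp add: field_simps)
    ultimately show ?thesis by simp
  qed
  have "((\<lambda>\<theta>. m / (\<psi> \<theta> / \<theta>)) \<longlongrightarrow> m / m) (at_right 0)"
    using m by (intro tendsto_divide tendsto_const psi_ratio_tendsto) simp
  moreover have "\<forall>\<^sub>F \<theta> in at_right 0. m / (\<psi> \<theta> / \<theta>) \<le> prob {\<omega>\<in>space M. low_sup \<omega> < \<infinity>}"
    unfolding eventually_at_right_field using le by (intro exI[of _ 1]) auto
  ultimately have "m / m \<le> prob {\<omega>\<in>space M. low_sup \<omega> < \<infinity>}" by (rule tendsto_upperbound) simp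
  then have "prob {\<omega>\<in>space M. low_sup \<omega> < \<infinity>} = 1" using m prob_le_1 by (intro antisym) auto
  then show ?thesis by (subst (asm) prob_Collect_eq_1) auto
qed

end

section \<open>Layer-cake integrals of exponentials and powers\<close>

lemma nn_integral_lborel_Ico_eq_Icc:
  fixes f :: "real \<Rightarrow> ennreal"
  shows "(\<integral>\<^sup>+t. f t * indicator {a..<b} t \<partial>lborel) = (\<integral>\<^sup>+t. f t * indicator {a..b} t \<partial>lborel)"
  using AE_lborel_singleton[of b] by (intro nn_integral_cong_AE) (auto elim!: eventually_mono simp: indicator_def)

lemma nn_integral_exp_segment:
  fixes \<theta> z :: real
  assumes "0 < \<theta>" "0 \<le> z"
  shows "(\<integral>\<^sup>+t. ennreal (exp (- \<theta> * t)) * indicator {0..<z} t \<partial>lborel) = ennreal ((1 - exp (- \<theta> * z)) / \<theta>)"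
proof -
  have "(\<integral>\<^sup>+t. ennreal (exp (- \<theta> * t)) * indicator {0..z} t \<partial>lborel) = ennreal (- exp (- \<theta> * z) / \<theta> - (- exp (- \<theta> * 0) / \<theta>))"
    using assms by (intro nn_integral_FTC_Icc) (auto intro!: derivative_eq_intros)
  then show ?thesis unfolding nn_integral_lborel_Ico_eq_Icc by (simp add: diff_divide_distrib)
qed

text \<open>The Laplace transform of the positive part of \<open>y - u\<close> on the half-line.
  Integrated over \<nu>, it identifies \<open>compensated_part \<theta> / \<theta>\<^sup>2\<close>
  as the transform of the density in the ladder height measure.\<close>

lemma nn_integral_compensated_segment:
  fixes \<theta> y :: real
  assumes "0 < \<theta>" "0 \<le> y"
  shows "(\<integral>\<^sup>+u. ennreal (y - u) * indicator {0..y} u * ennreal (exp (- \<theta> * u)) \<partial>lborel)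
    = ennreal ((exp (- (\<theta> * y)) - 1 + \<theta> * y) / \<theta>\<^sup>2)"
proof -
  define F where "F u = exp (- \<theta> * u) / \<theta>\<^sup>2 - (y - u) * exp (- \<theta> * u) / \<theta>" for u
  have "(\<integral>\<^sup>+u. ennreal ((y - u) * exp (- \<theta> * u)) * indicator {0..y} u \<partial>lborel) = ennreal (F y - F 0)"
  proof (rule nn_integral_FTC_Icc)
    fix u assume "u \<in> {0..y}"
    show "DERIV F u :> (y - u) * exp (- \<theta> * u)"
      unfolding F_def using assms(1)
      by (auto intro!: derivative_eq_intros simp: field_simps power2_eq_square)
  qed (use assms in auto)
  also have "F y - F 0 = (exp (- (\<theta> * y)) - 1 + \<theta> * y) / \<theta>\<^sup>2"
    using assms(1) by (simp add: F_def field_simps power2_eq_square)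
  also have "(\<integral>\<^sup>+u. ennreal ((y - u) * exp (- \<theta> * u)) * indicator {0..y} u \<partial>lborel)
     = (\<integral>\<^sup>+u. ennreal (y - u) * indicator {0..y} u * ennreal (exp (- \<theta> * u)) \<partial>lborel)"
    by (intro nn_integral_cong) (auto simp: indicator_def ennreal_mult)
  finally show ?thesis .
qed

lemma nn_integral_powr_layer:
  assumes "0 < k" "0 \<le> z"
  shows "(\<integral>\<^sup>+t. ennreal (k * t powr (k - 1)) * indicator {0..<z} t \<partial>lborel) = ennreal (z powr k)"
proof -
  have "(\<integral>\<^sup>+t. ennreal (k * t powr (k - 1)) * indicator {0..z} t \<partial>lborel) = ennreal k * (\<integral>\<^sup>+t. ennreal (t powr (k - 1)) * indicator {0..z} t \<partial>lborel)"
    using assms by (subst nn_integral_cmult[symmetric]) (auto simp: ennreal_mult mult.assoc)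
  then show ?thesis
    unfolding nn_integral_lborel_Ico_eq_Icc using assms by (simp add: nn_integral_powr_from_0 flip: ennreal_mult)
qed

lemma (in prob_space) nn_integral_powr_layer_cake:
  fixes Z :: "'a \<Rightarrow> real"
  assumes [measurable]: "Z \<in> borel_measurable M" and "\<And>\<omega>. 0 \<le> Z \<omega>" "0 < k"
  shows "(\<integral>\<^sup>+\<omega>. ennreal (Z \<omega> powr k) \<partial>M)
    = (\<integral>\<^sup>+t. ennreal (k * t powr (k - 1)) * (emeasure M {\<omega>\<in>space M. t < Z \<omega>} * indicator {0..} t) \<partial>lborel)"
  using nn_integral_layer_cake[of Z "\<lambda>t. ennreal (k * t powr (k - 1))"] assms
  by (simp add: nn_integral_powr_layer)

section \<open>Fubini for the jump measure and the ladder height measure\<close>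

context levy_exponent begin

lemma measurable_nu_pair':
  "(\<lambda>p. (fst p, snd p)) \<in> measurable (N \<Otimes>\<^sub>M \<nu>) (N \<Otimes>\<^sub>M (borel :: real measure))"
proof (rule measurable_Pair)
  show "snd \<in> measurable (N \<Otimes>\<^sub>M \<nu>) (borel :: real measure)"
    using measurable_compose[OF measurable_snd measurable_nu[OF measurable_ident]] by simp
qed simp

lemma measurable_nn_integral_nu:
  fixes f :: "'b \<Rightarrow> real \<Rightarrow> ennreal"
  assumes "(\<lambda>(x, y). f x y) \<in> borel_measurable (N \<Otimes>\<^sub>M borel)"
  shows "(\<lambda>x. \<integral>\<^sup>+y. f x y \<partial>\<nu>) \<in> borel_measurable N"
proof (rule sigma_finite_measure.borel_measurable_nn_integral[OF sigma_finite_nu])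
  show "(\<lambda>(x, y). f x y) \<in> borel_measurable (N \<Otimes>\<^sub>M \<nu>)"
    using measurable_compose[OF measurable_nu_pair' assms] by (simp add: case_prod_beta')
qed

lemma nn_integral_nu_add_cmult:
  fixes f g :: "real \<Rightarrow> ennreal"
  assumes "f \<in> borel_measurable borel" "g \<in> borel_measurable borel"
  shows "(\<integral>\<^sup>+y. f y + a * g y \<partial>\<nu>) = (\<integral>\<^sup>+y. f y \<partial>\<nu>) + a * (\<integral>\<^sup>+y. g y \<partial>\<nu>)"
proof -
  note [measurable] = measurable_nu[OF assms(1)] measurable_nu[OF assms(2)]
  show ?thesis by (simp add: nn_integral_add nn_integral_cmult)
qed

lemma Fubini_nu:
  fixes f :: "real \<Rightarrow> real \<Rightarrow> ennreal"
  assumes "(\<lambda>(y, t). f y t) \<in> borel_measurable (borel \<Otimes>\<^sub>M borel)"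
  shows "(\<integral>\<^sup>+y. (\<integral>\<^sup>+t. f y t \<partial>lborel) \<partial>\<nu>) = (\<integral>\<^sup>+t. (\<integral>\<^sup>+y. f y t \<partial>\<nu>) \<partial>lborel)"
proof -
  interpret \<nu>: sigma_finite_measure \<nu> by (rule sigma_finite_nu)
  interpret P: pair_sigma_finite \<nu> lborel ..
  show ?thesis
  proof (rule P.Fubini'[symmetric])
    show "(\<lambda>(y, t). f y t) \<in> borel_measurable (\<nu> \<Otimes>\<^sub>M lborel)"
      using measurable_compose[OF measurable_nu_pair assms] by (simp add: case_prod_beta')
  qed
qed

text \<open>The ladder height measure is \<open>\<sigma>\<^sup>2 / 2\<close> times the Dirac measure at 0 plus the density
  \<open>\<integral> (y - u)\<^sup>+ \<nu>(dy)\<close> on the half-line. It is the image under \<open>u \<mapsto> max 0 u\<close> of the following density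
  on the line: the interval \<open>(-1, 0)\<close> collapses to the atom.\<close>

definition ladder_kernel :: "real \<Rightarrow> ennreal" where
  "ladder_kernel u = (if 0 \<le> u then \<integral>\<^sup>+y. ennreal (max 0 (y - u)) \<partial>\<nu>
     else if - 1 < u then ennreal (\<sigma>\<^sup>2 / 2) else 0)"

lemma measurable_ladder_kernel [measurable]: "ladder_kernel \<in> borel_measurable borel"
proof -
  have [measurable]: "(\<lambda>u. \<integral>\<^sup>+y. ennreal (max 0 (y - u)) \<partial>\<nu>) \<in> borel_measurable borel"
    by (rule measurable_nn_integral_nu) measurable
  show ?thesis unfolding ladder_kernel_def[abs_def] by measurable
qed

lemma nn_integral_ladder_kernel:
  fixes g :: "real \<Rightarrow> ennreal"
  assumes [measurable]: "g \<in> borel_measurable borel"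
  shows "(\<integral>\<^sup>+u. ladder_kernel u * g (max 0 u) \<partial>lborel) = ennreal (\<sigma>\<^sup>2 / 2) * g 0
    + (\<integral>\<^sup>+y. (\<integral>\<^sup>+u. ennreal (y - u) * indicator {0..y} u * g u \<partial>lborel) \<partial>\<nu>)"
proof -
  define k where "k u = (\<integral>\<^sup>+y. ennreal (max 0 (y - u)) \<partial>\<nu>)" for u
  have [measurable]: "k \<in> borel_measurable borel"
    unfolding k_def[abs_def] by (rule measurable_nn_integral_nu) measurable
  have "(\<integral>\<^sup>+u. ladder_kernel u * g (max 0 u) \<partial>lborel)
    = (\<integral>\<^sup>+u. ennreal (\<sigma>\<^sup>2 / 2) * g 0 * indicator {-1<..<0} u + k u * indicator {0..} u * g u \<partial>lborel)"
    by (intro nn_integral_cong) (auto simp: ladder_kernel_def k_def indicator_def)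
  also have "\<dots> = ennreal (\<sigma>\<^sup>2 / 2) * g 0 + (\<integral>\<^sup>+u. k u * indicator {0..} u * g u \<partial>lborel)"
    by (subst nn_integral_add) (auto simp: nn_integral_cmult_indicator)
  also have "(\<integral>\<^sup>+u. k u * indicator {0..} u * g u \<partial>lborel)
    = (\<integral>\<^sup>+u. (\<integral>\<^sup>+y. ennreal (max 0 (y - u)) * (indicator {0..} u * g u) \<partial>\<nu>) \<partial>lborel)"
  proof (rule nn_integral_cong)
    fix u :: real
    have "(\<integral>\<^sup>+y. ennreal (max 0 (y - u)) * (indicator {0..} u * g u) \<partial>\<nu>) = k u * (indicator {0..} u * g u)"
      unfolding k_def by (rule nn_integral_multc) (rule measurable_nu, measurable)
    then show "k u * indicator {0..} u * g u = (\<integral>\<^sup>+y. ennreal (max 0 (y - u)) * (indicator {0..} u * g u) \<partial>\<nu>)"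
      by (simp add: mult.assoc)
  qed
  also have "\<dots> = (\<integral>\<^sup>+y. (\<integral>\<^sup>+u. ennreal (max 0 (y - u)) * (indicator {0..} u * g u) \<partial>lborel) \<partial>\<nu>)"
    by (rule Fubini_nu[symmetric]) measurable
  also have "\<dots> = (\<integral>\<^sup>+y. (\<integral>\<^sup>+u. ennreal (y - u) * indicator {0..y} u * g u \<partial>lborel) \<partial>\<nu>)"
    by (intro nn_integral_cong) (auto simp: indicator_def max_def)
  finally show ?thesis .
qed

end

context levy_laplace_mean begin

text \<open>\<open>enn2real\<close> sends infinity to 0; for \<open>m > 0\<close> this changes the
  depth only on a null set.\<close>

definition low_real :: "'a \<Rightarrow> real" where "low_real \<omega> = enn2real (low_sup \<omega>)"

lemma measurable_low_real [measurable]: "low_real \<in> borel_measurable M"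
  unfolding low_real_def[abs_def] by measurable

lemma low_real_nonneg: "0 \<le> low_real \<omega>"
  by (simp add: low_real_def)

lemma laplace_low_real:
  assumes "0 < \<theta>" "0 < m"
  shows "expectation (\<lambda>\<omega>. exp (- \<theta> * low_real \<omega>)) * \<psi> \<theta> = \<theta> * m"
proof -
  have "expectation (\<lambda>\<omega>. exp (- \<theta> * low_real \<omega>)) = expectation (\<lambda>\<omega>. ennreal_exp_neg \<theta> (low_sup \<omega>))"
    using AE_low_sup_finite[OF assms(2)]
    by (intro integral_cong_AE) (auto elim!: eventually_mono simp: ennreal_exp_neg_def low_real_def)
  then show ?thesis using laplace_low_sup[OF assms] by simp
qed

definition low_tail :: "real \<Rightarrow> ennreal" where
  "low_tail z = emeasure M {\<omega>\<in>space M. z < low_real \<omega>} * indicator {0..} z"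

lemma measurable_low_tail [measurable]: "low_tail \<in> borel_measurable borel"
  unfolding low_tail_def[abs_def] by measurable

text \<open>Both sides define a measure in \<open>g\<close>; the Pollaczek--Khinchine formula \<open>\<phi> \<psi> = m \<theta>\<close> says that their
  Laplace transforms agree.\<close>

lemma low_tail_identity:
  assumes m: "0 < m" and [measurable]: "g \<in> borel_measurable borel"
  shows "ennreal m * (\<integral>\<^sup>+z. g z * low_tail z \<partial>lborel)
    = (\<integral>\<^sup>+\<omega>. (\<integral>\<^sup>+u. ladder_kernel u * g (low_real \<omega> + max 0 u) \<partial>lborel) \<partial>M)"
proof -
  define A where "A = density lborel (\<lambda>z. ennreal m * low_tail z)"
  define B where "B = distr (density (M \<Otimes>\<^sub>M lborel) (\<lambda>(\<omega>, u). ladder_kernel u)) borel (\<lambda>(\<omega>, u). low_real \<omega> + max 0 u)"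
  have nnA: "(\<integral>\<^sup>+z. f z \<partial>A) = ennreal m * (\<integral>\<^sup>+z. f z * low_tail z \<partial>lborel)"
    if [measurable]: "f \<in> borel_measurable borel" for f
  proof -
    have "(\<integral>\<^sup>+z. f z \<partial>A) = (\<integral>\<^sup>+z. ennreal m * (f z * low_tail z) \<partial>lborel)"
      unfolding A_def by (subst nn_integral_density) (auto simp: mult_ac)
    then show ?thesis by (simp add: nn_integral_cmult)
  qed
  have nnB: "(\<integral>\<^sup>+z. f z \<partial>B) = (\<integral>\<^sup>+\<omega>. (\<integral>\<^sup>+u. ladder_kernel u * f (low_real \<omega> + max 0 u) \<partial>lborel) \<partial>M)"
    if [measurable]: "f \<in> borel_measurable borel" for f
  proof -
    have "(\<integral>\<^sup>+z. f z \<partial>B) = (\<integral>\<^sup>+p. (\<lambda>(\<omega>, u). ladder_kernel u * f (low_real \<omega> + max 0 u)) p \<partial>(M \<Otimes>\<^sub>M lborel))"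
      unfolding B_def by (subst nn_integral_distr) (auto simp: nn_integral_density case_prod_beta')
    also have "\<dots> = (\<integral>\<^sup>+\<omega>. (\<integral>\<^sup>+u. ladder_kernel u * f (low_real \<omega> + max 0 u) \<partial>lborel) \<partial>M)"
      by (subst lborel.nn_integral_fst[symmetric]) auto
    finally show ?thesis .
  qed
  have lapA: "(\<integral>\<^sup>+z. ennreal (exp (- \<theta> * z)) \<partial>A) = ennreal (m * ((1 - expectation (\<lambda>\<omega>. exp (- \<theta> * low_real \<omega>))) / \<theta>))"
    if \<theta>: "0 < \<theta>" for \<theta>
  proof -
    have int: "integrable M (\<lambda>\<omega>. exp (- \<theta> * low_real \<omega>))"
      using \<theta> low_real_nonneg by (intro integrable_const_bound[where B=1]) auto
    have "(\<integral>\<^sup>+z. ennreal (exp (- \<theta> * z)) \<partial>A) = ennreal m * (\<integral>\<^sup>+z. ennreal (exp (- \<theta> * z)) * low_tail z \<partial>lborel)"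
      by (rule nnA) measurable
    also have "(\<integral>\<^sup>+z. ennreal (exp (- \<theta> * z)) * low_tail z \<partial>lborel)
      = (\<integral>\<^sup>+\<omega>. (\<integral>\<^sup>+t. ennreal (exp (- \<theta> * t)) * indicator {0..<low_real \<omega>} t \<partial>lborel) \<partial>M)"
      unfolding low_tail_def by (subst nn_integral_layer_cake) auto
    also have "\<dots> = (\<integral>\<^sup>+\<omega>. ennreal ((1 - exp (- \<theta> * low_real \<omega>)) / \<theta>) \<partial>M)"
      using nn_integral_exp_segment[OF \<theta> low_real_nonneg] by simp
    also have "\<dots> = ennreal (expectation (\<lambda>\<omega>. (1 - exp (- \<theta> * low_real \<omega>)) / \<theta>))"
      using int \<theta> low_real_nonneg by (intro nn_integral_eq_integral) auto
    also have "expectation (\<lambda>\<omega>. (1 - exp (- \<theta> * low_real \<omega>)) / \<theta>) = (1 - expectation (\<lambda>\<omega>. exp (- \<theta> * low_real \<omega>))) / \<theta>"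
      using int by (simp add: prob_space)
    finally show ?thesis by (simp only: ennreal_mult'[OF m_nonneg])
  qed
  have lapB: "(\<integral>\<^sup>+z. ennreal (exp (- \<theta> * z)) \<partial>B) = ennreal (expectation (\<lambda>\<omega>. exp (- \<theta> * low_real \<omega>)) * (\<sigma>\<^sup>2 / 2 + compensated_part \<theta> / \<theta>\<^sup>2))"
    if \<theta>: "0 < \<theta>" for \<theta>
  proof -
    have int: "integrable M (\<lambda>\<omega>. exp (- \<theta> * low_real \<omega>))"
      using \<theta> low_real_nonneg by (intro integrable_const_bound[where B=1]) auto
    define C where "C = (\<integral>\<^sup>+u. ladder_kernel u * ennreal (exp (- \<theta> * max 0 u)) \<partial>lborel)"
    have C: "C = ennreal (\<sigma>\<^sup>2 / 2 + compensated_part \<theta> / \<theta>\<^sup>2)"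
    proof -
      have "C = ennreal (\<sigma>\<^sup>2 / 2) * ennreal (exp (- \<theta> * 0)) + (\<integral>\<^sup>+y. (\<integral>\<^sup>+u. ennreal (y - u) * indicator {0..y} u * ennreal (exp (- \<theta> * u)) \<partial>lborel) \<partial>\<nu>)"
        unfolding C_def by (rule nn_integral_ladder_kernel) measurable
      also have "(\<integral>\<^sup>+y. (\<integral>\<^sup>+u. ennreal (y - u) * indicator {0..y} u * ennreal (exp (- \<theta> * u)) \<partial>lborel) \<partial>\<nu>)
        = (\<integral>\<^sup>+y. ennreal ((exp (- (\<theta> * y)) - 1 + \<theta> * y) / \<theta>\<^sup>2) \<partial>\<nu>)"
        using \<theta> by (intro nn_integral_cong nn_integral_compensated_segment) (auto simp: space_nu)
      also have "\<dots> = ennreal (\<integral>y. (exp (- (\<theta> * y)) - 1 + \<theta> * y) / \<theta>\<^sup>2 \<partial>\<nu>)"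
        using integrable_compensated[of \<theta>] \<theta>
        by (intro nn_integral_eq_integral) (auto simp: exp_neg_compensated_nonneg)
      also have "(\<integral>y. (exp (- (\<theta> * y)) - 1 + \<theta> * y) / \<theta>\<^sup>2 \<partial>\<nu>) = compensated_part \<theta> / \<theta>\<^sup>2"
        by (simp add: compensated_part_def)
      finally show ?thesis using compensated_part_nonneg[of \<theta>] by (simp add: ennreal_plus)
    qed
    have "(\<integral>\<^sup>+z. ennreal (exp (- \<theta> * z)) \<partial>B) = (\<integral>\<^sup>+\<omega>. (\<integral>\<^sup>+u. ladder_kernel u * ennreal (exp (- \<theta> * (low_real \<omega> + max 0 u))) \<partial>lborel) \<partial>M)"
      by (rule nnB) measurable
    also have "\<dots> = (\<integral>\<^sup>+\<omega>. ennreal (exp (- \<theta> * low_real \<omega>)) * C \<partial>M)"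
    proof (rule nn_integral_cong)
      fix \<omega>
      have "(\<integral>\<^sup>+u. ladder_kernel u * ennreal (exp (- \<theta> * (low_real \<omega> + max 0 u))) \<partial>lborel)
        = (\<integral>\<^sup>+u. ennreal (exp (- \<theta> * low_real \<omega>)) * (ladder_kernel u * ennreal (exp (- \<theta> * max 0 u))) \<partial>lborel)"
      proof (rule nn_integral_cong)
        fix u :: real
        have "exp (- \<theta> * (low_real \<omega> + max 0 u)) = exp (- \<theta> * low_real \<omega>) * exp (- \<theta> * max 0 u)"
          by (simp add: distrib_left flip: exp_add)
        then show "ladder_kernel u * ennreal (exp (- \<theta> * (low_real \<omega> + max 0 u)))
          = ennreal (exp (- \<theta> * low_real \<omega>)) * (ladder_kernel u * ennreal (exp (- \<theta> * max 0 u)))"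
          by (simp only: ennreal_mult[OF exp_ge_zero exp_ge_zero] mult_ac)
      qed
      also have "\<dots> = ennreal (exp (- \<theta> * low_real \<omega>)) * C"
        unfolding C_def by (rule nn_integral_cmult) measurable
      finally show "(\<integral>\<^sup>+u. ladder_kernel u * ennreal (exp (- \<theta> * (low_real \<omega> + max 0 u))) \<partial>lborel) = ennreal (exp (- \<theta> * low_real \<omega>)) * C" .
    qed
    also have "\<dots> = (\<integral>\<^sup>+\<omega>. ennreal (exp (- \<theta> * low_real \<omega>)) \<partial>M) * C"
      by (rule nn_integral_multc) measurable
    also have "(\<integral>\<^sup>+\<omega>. ennreal (exp (- \<theta> * low_real \<omega>)) \<partial>M) = ennreal (expectation (\<lambda>\<omega>. exp (- \<theta> * low_real \<omega>)))"
      using int by (intro nn_integral_eq_integral) auto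
    finally show ?thesis
      unfolding C using compensated_part_nonneg[of \<theta>] by (simp add: ennreal_mult Bochner_Integration.integral_nonneg)
  qed
  have "A = B"
  proof (rule laplace_unique)
    show "sets A = sets borel" "sets B = sets borel" by (simp_all add: A_def B_def)
    show "AE x in A. 0 \<le> x"
      unfolding A_def by (subst AE_density) (auto simp: low_tail_def indicator_def)
    show "AE x in B. 0 \<le> x"
      unfolding B_def using low_real_nonneg by (subst AE_distr_iff) (auto intro!: AE_I2 add_nonneg_nonneg)
    show "(\<integral>\<^sup>+x. ennreal (exp (- \<theta> * x)) \<partial>A) = (\<integral>\<^sup>+x. ennreal (exp (- \<theta> * x)) \<partial>B)" if \<theta>: "0 < \<theta>" for \<theta>
    proof -
      define \<phi> where "\<phi> = expectation (\<lambda>\<omega>. exp (- \<theta> * low_real \<omega>))"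
      have "\<phi> * \<psi> \<theta> = \<theta> * m" unfolding \<phi>_def by (rule laplace_low_real[OF \<theta> m])
      \<comment> \<open>The drift part \<open>\<phi> * m * \<theta>\<close> moves to the right;
        division by \<open>\<theta>\<^sup>2\<close> then matches \<open>lapA\<close> with
        \<open>lapB\<close>.\<close>
      then have "\<phi> * (1 / 2 * \<sigma>\<^sup>2 * \<theta>\<^sup>2 + compensated_part \<theta>) = \<theta> * m * (1 - \<phi>)"
        using \<theta> by (simp add: psi_mean algebra_simps)
      then have "\<theta> * m * (1 - \<phi>) / \<theta>\<^sup>2 = \<phi> * (1 / 2 * \<sigma>\<^sup>2 * \<theta>\<^sup>2 + compensated_part \<theta>) / \<theta>\<^sup>2" by (simp only:)
      also have "\<dots> = \<phi> * (\<sigma>\<^sup>2 / 2 + compensated_part \<theta> / \<theta>\<^sup>2)"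
        using \<theta> by (simp add: field_simps)
      also have "\<theta> * m * (1 - \<phi>) / \<theta>\<^sup>2 = m * ((1 - \<phi>) / \<theta>)"
        using \<theta> by (simp add: power2_eq_square)
      finally have "m * ((1 - \<phi>) / \<theta>) = \<phi> * (\<sigma>\<^sup>2 / 2 + compensated_part \<theta> / \<theta>\<^sup>2)" .
      then show ?thesis unfolding lapA[OF \<theta>] lapB[OF \<theta>] \<phi>_def by simp
    qed
    show "(\<integral>\<^sup>+x. ennreal (exp (- x)) \<partial>A) < \<infinity>" using lapA[of 1] by simp
  qed
  then show ?thesis using nnA[of g] nnB[of g] by simp
qed

definition low_moment :: "real \<Rightarrow> ennreal" where
  "low_moment k = (\<integral>\<^sup>+\<omega>. ennreal (low_real \<omega> powr k) \<partial>M)"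

lemma low_moment_layer:
  "0 < k \<Longrightarrow> low_moment k = (\<integral>\<^sup>+t. ennreal (k * t powr (k - 1)) * low_tail t \<partial>lborel)"
  unfolding low_moment_def low_tail_def
  by (rule nn_integral_powr_layer_cake) (auto simp: low_real_nonneg)

text \<open>Two integrations raise the order from \<open>k - 1\<close> to \<open>k + 1\<close>,
  which is where the extra power of the jump moment comes from. \<open>max 1 u\<close> avoids the
  singularity at 0 for \<open>k < 1\<close>; short jumps then cost only
  \<open>y\<^sup>2\<close>.\<close>

lemma max_1_powr_segment_le:
  assumes k: "0 < k" and y: "0 < y"
  shows "(\<integral>\<^sup>+u. ennreal (y - u) * indicator {0..y} u * ennreal (max 1 u powr (k - 1)) \<partial>lborel)
    \<le> ennreal (min 1 (y\<^sup>2)) + ennreal (1 + 1 / k) * (ennreal (y powr (k + 1)) * indicator {1..} y)"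
proof (cases "y < 1")
  case True
  have "(\<integral>\<^sup>+u. ennreal (y - u) * indicator {0..y} u * ennreal (max 1 u powr (k - 1)) \<partial>lborel) \<le> (\<integral>\<^sup>+u. ennreal y * indicator {0..y} u \<partial>lborel)"
    using True y by (intro nn_integral_mono) (auto simp: indicator_def max_def intro!: ennreal_leI)
  also have "\<dots> = ennreal (y * y)"
    using y by (simp add: nn_integral_cmult_indicator flip: ennreal_mult)
  also have "y * y = min 1 (y\<^sup>2)"
    unfolding min_one_square[OF y] using True by (simp only: if_True power2_eq_square)
  finally show ?thesis using True by simp
next
  case False
  have "(\<integral>\<^sup>+u. ennreal (y - u) * indicator {0..y} u * ennreal (max 1 u powr (k - 1)) \<partial>lborel)
    \<le> (\<integral>\<^sup>+u. ennreal y * (indicator {0..1} u + ennreal (u powr (k - 1)) * indicator {0..y} u) \<partial>lborel)"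
  proof (rule nn_integral_mono)
    fix u :: real
    have "ennreal (y - u) * ennreal (max 1 u powr (k - 1)) \<le> ennreal y * (indicator {0..1} u + ennreal (u powr (k - 1)))" if "0 \<le> u"
    proof (rule mult_mono)
      show "ennreal (max 1 u powr (k - 1)) \<le> indicator {0..1} u + ennreal (u powr (k - 1))"
        using that by (auto simp: max_def indicator_def)
    qed (use that in \<open>auto intro: ennreal_leI\<close>)
    then show "ennreal (y - u) * indicator {0..y} u * ennreal (max 1 u powr (k - 1))
      \<le> ennreal y * (indicator {0..1} u + ennreal (u powr (k - 1)) * indicator {0..y} u)"
      by (auto simp: indicator_def)
  qed
  also have "\<dots> = ennreal y * (1 + ennreal (y powr k / k))"
    using y k by (simp add: nn_integral_cmult nn_integral_add nn_integral_powr_from_0)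
  also have "\<dots> = ennreal (y * (1 + y powr k / k))"
    using y k by (simp add: ennreal_mult ennreal_plus flip: ennreal_1)
  also have "\<dots> \<le> ennreal ((1 + 1 / k) * y powr (k + 1))"
  proof (rule ennreal_leI)
    have "1 \<le> y powr k" using False k by (intro ge_one_powr_ge_zero) auto
    then have "y * (1 + y powr k / k) \<le> y * (y powr k + y powr k / k)" using y by (intro mult_left_mono) auto
    also have "\<dots> = (1 + 1 / k) * (y * y powr k)" by (simp add: algebra_simps)
    also have "y * y powr k = y powr (k + 1)" using y powr_mult_base[of y k] by (simp add: add.commute)
    finally show "y * (1 + y powr k / k) \<le> (1 + 1 / k) * y powr (k + 1)" .
  qed
  also have "\<dots> = ennreal (1 + 1 / k) * (ennreal (y powr (k + 1)) * indicator {1..} y)"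
    using False k by (simp add: ennreal_mult del: ennreal_plus)
  finally show ?thesis by (rule order_trans) simp
qed

text \<open>The tail identity trades the moment of order \<open>k\<close> for powers of order
  \<open>k - 1\<close> of depth plus ladder height. For \<open>k > 1\<close> such a power of a sum
  is bounded by a product, which calls for the moment of order \<open>k - 1\<close>; for
  \<open>k \<le> 1\<close> the power decreases and the ladder height alone suffices.\<close>

lemma low_moment_finite_step:
  assumes m: "0 < m" and k: "0 < k" and jumps: "jump_moment (k + 1) < \<infinity>"
    and prev: "1 < k \<Longrightarrow> low_moment (k - 1) < \<infinity>"
  shows "low_moment k < \<infinity>"
proof -
  define p where "p = max 0 (k - 1)"
  define R where "R \<omega> = (if 1 < k then ennreal (low_real \<omega> powr (k - 1)) else 0)" for \<omega>
  have [measurable]: "R \<in> borel_measurable M" unfolding R_def[abs_def] by measurable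
  define Q where "Q = (\<integral>\<^sup>+u. ladder_kernel u * ennreal (max 1 (max 0 u) powr (k - 1)) \<partial>lborel)"
  have Q: "Q < \<infinity>"
  proof -
    define J where "J = (\<integral>\<^sup>+y. (\<integral>\<^sup>+u. ennreal (y - u) * indicator {0..y} u * ennreal (max 1 u powr (k - 1)) \<partial>lborel) \<partial>\<nu>)"
    have "J \<le> (\<integral>\<^sup>+y. ennreal (min 1 (y\<^sup>2)) + ennreal (1 + 1 / k) * (ennreal (y powr (k + 1)) * indicator {1..} y) \<partial>\<nu>)"
      unfolding J_def using k by (intro nn_integral_mono max_1_powr_segment_le) (auto simp: space_nu)
    also have "\<dots> = (\<integral>\<^sup>+y. ennreal (min 1 (y\<^sup>2)) \<partial>\<nu>) + ennreal (1 + 1 / k) * jump_moment (k + 1)"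
      by (rule nn_integral_nu_add_cmult) measurable
    also have "\<dots> < \<infinity>" using levy_measure jumps by (simp add: ennreal_mult_less_top del: ennreal_plus)
    finally have "J < \<infinity>" .
    moreover have "Q = ennreal (\<sigma>\<^sup>2 / 2) * ennreal (max 1 0 powr (k - 1)) + J"
      unfolding Q_def J_def by (rule nn_integral_ladder_kernel) measurable
    ultimately show ?thesis by (simp add: ennreal_mult_less_top)
  qed
  \<comment> \<open>Cutting at 1 removes the singularity of the power at 0 for \<open>k < 1\<close>;
    depths below 1 contribute at most 1 to the layer-cake integral.\<close>
  define G where "G z = ennreal (k * z powr (k - 1)) * indicator {1..} z" for z :: real
  have [measurable]: "G \<in> borel_measurable borel" unfolding G_def[abs_def] by measurable
  have G: "G (low_real \<omega> + v) \<le> ennreal (k * 2 powr p) * ((1 + R \<omega>) * ennreal (max 1 v powr (k - 1)))" if v: "0 \<le> v" for \<omega> v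
  proof (cases "1 \<le> low_real \<omega> + v")
    case True
    define z where "z = low_real \<omega> + v"
    define r where "r = (if 1 < k then low_real \<omega> powr (k - 1) else 0)"
    have r: "R \<omega> = ennreal r" "0 \<le> r" by (auto simp: R_def r_def)
    have "z powr (k - 1) \<le> 2 powr p * ((1 + r) * max 1 v powr (k - 1))"
    proof (cases "1 < k")
      case k1: True
      have "z powr (k - 1) \<le> (2 * max (low_real \<omega>) v) powr (k - 1)"
        using k1 v low_real_nonneg[of \<omega>] by (intro powr_mono2) (auto simp: z_def)
      also have "\<dots> = 2 powr (k - 1) * max (low_real \<omega>) v powr (k - 1)"
        by (rule powr_mult)
      also have "max (low_real \<omega>) v powr (k - 1) \<le> (1 + r) * max 1 v powr (k - 1)"
      proof -
        have v1: "v powr (k - 1) \<le> max 1 v powr (k - 1)" using v k1 by (intro powr_mono2) auto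
        have one: "1 \<le> max 1 v powr (k - 1)" using k1 by (intro ge_one_powr_ge_zero) auto
        have "max (low_real \<omega>) v powr (k - 1) \<le> v powr (k - 1) + r" using k1 by (simp add: r_def max_def)
        also have "\<dots> \<le> max 1 v powr (k - 1) + r * max 1 v powr (k - 1)"
          using v1 mult_left_mono[OF one r(2)] by simp
        finally show ?thesis by (simp add: algebra_simps)
      qed
      finally show ?thesis using k1 by (simp add: p_def)
    next
      case k1: False
      have "z powr (k - 1) \<le> max 1 v powr (k - 1)"
        using k1 True low_real_nonneg[of \<omega>] by (intro powr_mono2') (auto simp: z_def)
      then show ?thesis using k1 by (simp add: p_def r_def)
    qed
    then have "k * z powr (k - 1) \<le> k * (2 powr p * ((1 + r) * max 1 v powr (k - 1)))"
      using k by (intro mult_left_mono) auto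
    then have "ennreal (k * z powr (k - 1)) \<le> ennreal (k * 2 powr p * ((1 + r) * max 1 v powr (k - 1)))"
      by (intro ennreal_leI) (simp add: mult.assoc)
    also have "\<dots> = ennreal (k * 2 powr p) * ((1 + R \<omega>) * ennreal (max 1 v powr (k - 1)))"
      using r k by (simp add: ennreal_mult flip: ennreal_1)
    finally show ?thesis using True by (simp add: G_def z_def)
  qed (simp add: G_def)
  have "ennreal m * (\<integral>\<^sup>+z. G z * low_tail z \<partial>lborel) = (\<integral>\<^sup>+\<omega>. (\<integral>\<^sup>+u. ladder_kernel u * G (low_real \<omega> + max 0 u) \<partial>lborel) \<partial>M)"
    by (rule low_tail_identity[OF m]) measurable
  also have "\<dots> \<le> (\<integral>\<^sup>+\<omega>. (\<integral>\<^sup>+u. ennreal (k * 2 powr p) * (1 + R \<omega>) * (ladder_kernel u * ennreal (max 1 (max 0 u) powr (k - 1))) \<partial>lborel) \<partial>M)"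
  proof (intro nn_integral_mono)
    fix \<omega> and u :: real
    have "ladder_kernel u * G (low_real \<omega> + max 0 u) \<le> ladder_kernel u * (ennreal (k * 2 powr p) * ((1 + R \<omega>) * ennreal (max 1 (max 0 u) powr (k - 1))))"
      by (intro mult_left_mono G) auto
    then show "ladder_kernel u * G (low_real \<omega> + max 0 u) \<le> ennreal (k * 2 powr p) * (1 + R \<omega>) * (ladder_kernel u * ennreal (max 1 (max 0 u) powr (k - 1)))"
      by (simp only: mult_ac)
  qed
  also have "\<dots> = (\<integral>\<^sup>+\<omega>. ennreal (k * 2 powr p) * (1 + R \<omega>) * Q \<partial>M)"
    unfolding Q_def by (intro nn_integral_cong nn_integral_cmult) measurable
  also have "\<dots> = ennreal (k * 2 powr p) * (1 + (\<integral>\<^sup>+\<omega>. R \<omega> \<partial>M)) * Q"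
    by (simp add: nn_integral_multc nn_integral_cmult nn_integral_add emeasure_space_1)
  also have "\<dots> < \<infinity>"
  proof -
    have "(\<integral>\<^sup>+\<omega>. R \<omega> \<partial>M) < \<infinity>" using prev by (cases "1 < k") (simp_all add: R_def low_moment_def)
    then show ?thesis using Q by (simp add: ennreal_mult_less_top)
  qed
  finally have fin: "(\<integral>\<^sup>+z. G z * low_tail z \<partial>lborel) < \<infinity>"
    using m by (auto simp: ennreal_mult_less_top)
  have "low_moment k \<le> (\<integral>\<^sup>+t. ennreal (k * t powr (k - 1)) * indicator {0..<1} t + G t * low_tail t \<partial>lborel)"
    unfolding low_moment_layer[OF k]
  proof (intro nn_integral_mono)
    fix t :: real
    have "low_tail t \<le> indicator {0..} t"
      using emeasure_le_1[of "{\<omega>\<in>space M. t < low_real \<omega>}"] by (auto simp: low_tail_def indicator_def)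
    then show "ennreal (k * t powr (k - 1)) * low_tail t \<le> ennreal (k * t powr (k - 1)) * indicator {0..<1} t + G t * low_tail t"
      using mult_left_mono[of "low_tail t" "indicator {0..} t" "ennreal (k * t powr (k - 1))"]
      by (cases "t < 1") (auto simp: G_def indicator_def split: if_splits)
  qed
  also have "\<dots> = ennreal (1 powr k) + (\<integral>\<^sup>+z. G z * low_tail z \<partial>lborel)"
    using k by (subst nn_integral_add) (auto simp: nn_integral_powr_layer)
  also have "\<dots> < \<infinity>" using fin by simp
  finally show ?thesis .
qed

text \<open>Induction on an integer bound for \<open>k\<close>, lowering the order by 1 at each
  step; jump moments of lower order are smaller because only \<open>y \<ge> 1\<close>
  enters.\<close>

lemma low_moment_finite:
  assumes m: "0 < m" and k: "0 < k" and jumps: "jump_moment (k + 1) < \<infinity>"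
  shows "low_moment k < \<infinity>"
proof -
  have "low_moment k < \<infinity>" if "0 < k" "k \<le> real n" "jump_moment (k + 1) < \<infinity>" for n k
    using that
  proof (induction n arbitrary: k)
    case (Suc n)
    show ?case
    proof (rule low_moment_finite_step[OF m Suc.prems(1,3)])
      assume k: "1 < k"
      have "jump_moment (k - 1 + 1) \<le> jump_moment (k + 1)"
        by (intro nn_integral_mono) (auto simp: indicator_def intro!: ennreal_leI powr_mono)
      then show "low_moment (k - 1) < \<infinity>" using Suc k by (intro Suc.IH) auto
    qed
  qed simp
  then show ?thesis using real_arch_simple[of k] k jumps by blast
qed

text \<open>On an event of positive probability the depth is at most \<open>R\<close>. For jumps
  \<open>y \<ge> 4 * R\<close> and ladder heights in \<open>{y / 4..y / 2}\<close> all quantities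
  are then comparable to \<open>y\<close>, and the tail identity bounds the jump moment.\<close>

lemma jump_moment_finite_of_low_moment:
  assumes m: "0 < m" and k: "0 < k" and fin: "low_moment k < \<infinity>"
  shows "jump_moment (k + 1) < \<infinity>"
proof -
  define G where "G z = ennreal (k * z powr (k - 1))" for z :: real
  have [measurable]: "G \<in> borel_measurable borel" unfolding G_def[abs_def] by measurable
  obtain R where R: "1 \<le> R" "0 < prob {\<omega>\<in>space M. low_real \<omega> \<le> R}"
  proof -
    have "(\<lambda>n. prob {\<omega>\<in>space M. low_real \<omega> \<le> real n}) \<longlonglongrightarrow> prob (\<Union>n. {\<omega>\<in>space M. low_real \<omega> \<le> real n})"
      by (intro finite_Lim_measure_incseq) (auto simp: incseq_def)
    also have "(\<Union>n. {\<omega>\<in>space M. low_real \<omega> \<le> real n}) = space M"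
      using real_arch_simple by auto
    finally have "\<forall>\<^sub>F n in sequentially. 0 < prob {\<omega>\<in>space M. low_real \<omega> \<le> real n}"
      by (intro order_tendstoD(1)[of _ 1]) (auto simp: prob_space)
    moreover have "\<forall>\<^sub>F n in sequentially. (1::nat) \<le> n" by (rule eventually_ge_at_top)
    ultimately have "\<forall>\<^sub>F n in sequentially. 0 < prob {\<omega>\<in>space M. low_real \<omega> \<le> real n} \<and> 1 \<le> n" by eventually_elim simp
    then obtain n where "0 < prob {\<omega>\<in>space M. low_real \<omega> \<le> real n}" "1 \<le> n" by (auto simp: eventually_sequentially)
    then show thesis using that[of "real n"] by simp
  qed
  \<comment> \<open>The two terms cover \<open>z powr (k - 1)\<close> increasing and decreasing for
    \<open>y / 4 \<le> z \<le> y\<close>. The 8 in \<open>c''\<close> is the product of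
    \<open>y - u \<ge> y / 2\<close> and the interval length \<open>y / 4\<close>.\<close>
  define c' where "c' = min 1 ((1 / 4) powr (k - 1))"
  have c': "0 < c'" by (simp add: c'_def)
  define c'' where "c'' = k * c' / 8"
  have c'': "0 < c''" using c' k by (simp add: c''_def)
  have inner: "ennreal (c'' * y powr (k + 1)) \<le> (\<integral>\<^sup>+u. ennreal (y - u) * indicator {0..y} u * G (low_real \<omega> + u) \<partial>lborel)"
    if y: "4 * R \<le> y" and \<omega>: "low_real \<omega> \<le> R" for y \<omega>
  proof -
    have y0: "0 < y" using y R by simp
    have "y powr (k + 1) = y * (y * y powr (k - 1))"
      using y0 powr_mult_base[of y "k - 1"] powr_mult_base[of y k] by (simp add: add.commute)
    then have "c'' * y powr (k + 1) = (y / 2 * (k * (c' * y powr (k - 1)))) * (y / 2 - y / 4)"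
      by (simp add: c''_def)
    then have "ennreal (c'' * y powr (k + 1)) = ennreal ((y / 2 * (k * (c' * y powr (k - 1)))) * (y / 2 - y / 4))"
      by (simp only:)
    also have "\<dots> = ennreal (y / 2 * (k * (c' * y powr (k - 1)))) * ennreal (y / 2 - y / 4)"
      using y0 k c' by (intro ennreal_mult) auto
    also have "\<dots> = (\<integral>\<^sup>+u. ennreal (y / 2 * (k * (c' * y powr (k - 1)))) * indicator {y / 4..y / 2} u \<partial>lborel)"
      using y0 by (subst nn_integral_cmult_indicator) auto
    also have "\<dots> \<le> (\<integral>\<^sup>+u. ennreal (y - u) * indicator {0..y} u * G (low_real \<omega> + u) \<partial>lborel)"
    proof (rule nn_integral_mono)
      fix u :: real
      show "ennreal (y / 2 * (k * (c' * y powr (k - 1)))) * indicator {y / 4..y / 2} u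
        \<le> ennreal (y - u) * indicator {0..y} u * G (low_real \<omega> + u)"
      proof (cases "u \<in> {y / 4..y / 2}")
        case True
        define z where "z = low_real \<omega> + u"
        have z: "y / 4 \<le> z" "z \<le> y" using True y \<omega> low_real_nonneg[of \<omega>] by (auto simp: z_def)
        have "c' * y powr (k - 1) \<le> z powr (k - 1)"
        proof (cases "1 \<le> k")
          case k1: True
          have "c' * y powr (k - 1) \<le> (1 / 4) powr (k - 1) * y powr (k - 1)" by (intro mult_right_mono) (auto simp: c'_def)
          also have "\<dots> = (1 / 4 * y) powr (k - 1)" by (rule powr_mult[symmetric])
          also have "\<dots> \<le> z powr (k - 1)" using z y0 k1 by (intro powr_mono2) auto
          finally show ?thesis .
        next
          case k1: False
          have "c' * y powr (k - 1) \<le> 1 * y powr (k - 1)" by (intro mult_right_mono) (auto simp: c'_def)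
          also have "\<dots> \<le> z powr (k - 1)" using z y0 k1 by (simp add: powr_mono2')
          finally show ?thesis .
        qed
        then have "y / 2 * (k * (c' * y powr (k - 1))) \<le> (y - u) * (k * z powr (k - 1))"
          using True y0 k c' by (intro mult_mono) auto
        then show ?thesis
          using True y0 k by (simp add: G_def z_def ennreal_leI flip: ennreal_mult)
      qed simp
    qed
    finally show ?thesis .
  qed
  define S where "S = (\<integral>\<^sup>+y. ennreal (c'' * y powr (k + 1)) * indicator {4 * R..} y \<partial>\<nu>)"
  have "emeasure M {\<omega>\<in>space M. low_real \<omega> \<le> R} * S = (\<integral>\<^sup>+\<omega>. S * indicator {\<omega>\<in>space M. low_real \<omega> \<le> R} \<omega> \<partial>M)"
    by (simp add: nn_integral_cmult_indicator mult.commute)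
  also have "\<dots> \<le> (\<integral>\<^sup>+\<omega>. (\<integral>\<^sup>+u. ladder_kernel u * G (low_real \<omega> + max 0 u) \<partial>lborel) \<partial>M)"
  proof (rule nn_integral_mono)
    fix \<omega>
    have "S \<le> (\<integral>\<^sup>+u. ladder_kernel u * G (low_real \<omega> + max 0 u) \<partial>lborel)" if "low_real \<omega> \<le> R"
    proof -
      have "S \<le> (\<integral>\<^sup>+y. (\<integral>\<^sup>+u. ennreal (y - u) * indicator {0..y} u * G (low_real \<omega> + u) \<partial>lborel) \<partial>\<nu>)"
        unfolding S_def using inner[OF _ that] by (intro nn_integral_mono) (auto simp: indicator_def)
      also have "\<dots> \<le> (\<integral>\<^sup>+u. ladder_kernel u * G (low_real \<omega> + max 0 u) \<partial>lborel)"
        by (subst nn_integral_ladder_kernel[where g="\<lambda>u. G (low_real \<omega> + u)"]) auto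
      finally show ?thesis .
    qed
    then show "S * indicator {\<omega>\<in>space M. low_real \<omega> \<le> R} \<omega> \<le> (\<integral>\<^sup>+u. ladder_kernel u * G (low_real \<omega> + max 0 u) \<partial>lborel)"
      by (auto simp: indicator_def)
  qed
  also have "\<dots> = ennreal m * (\<integral>\<^sup>+z. G z * low_tail z \<partial>lborel)"
    by (rule low_tail_identity[OF m, symmetric]) measurable
  also have "\<dots> < \<infinity>"
    using fin unfolding low_moment_layer[OF k] G_def by (simp add: ennreal_mult_less_top)
  finally have S: "S < \<infinity>" using R(2) by (auto simp: ennreal_mult_less_top emeasure_eq_measure)
  have "ennreal c'' * jump_moment (k + 1) = (\<integral>\<^sup>+y. ennreal c'' * (ennreal (y powr (k + 1)) * indicator {1..} y) \<partial>\<nu>)"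
    by (rule nn_integral_cmult[symmetric]) (rule measurable_nu, measurable)
  \<comment> \<open>Jumps between 1 and \<open>4 * R\<close> have bounded powers and finite total
    mass.\<close>
  also have "\<dots> \<le> (\<integral>\<^sup>+y. ennreal (c'' * y powr (k + 1)) * indicator {4 * R..} y + ennreal (c'' * (4 * R) powr (k + 1)) * ennreal (min 1 (y\<^sup>2)) \<partial>\<nu>)"
  proof (rule nn_integral_mono)
    fix y assume "y \<in> space \<nu>"
    then have y: "0 < y" by (simp add: space_nu)
    show "ennreal c'' * (ennreal (y powr (k + 1)) * indicator {1..} y) \<le>
      ennreal (c'' * y powr (k + 1)) * indicator {4 * R..} y + ennreal (c'' * (4 * R) powr (k + 1)) * ennreal (min 1 (y\<^sup>2))"
    proof (cases "1 \<le> y \<and> y < 4 * R")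
      case True
      then have "c'' * y powr (k + 1) \<le> c'' * (4 * R) powr (k + 1)"
        using k c'' by (intro mult_left_mono powr_mono2) auto
      then show ?thesis using True y c'' by (simp add: min_one_square ennreal_leI flip: ennreal_mult)
    next
      case False
      then show ?thesis using y c'' R by (auto simp: indicator_def ennreal_mult)
    qed
  qed
  also have "\<dots> = S + ennreal (c'' * (4 * R) powr (k + 1)) * (\<integral>\<^sup>+y. ennreal (min 1 (y\<^sup>2)) \<partial>\<nu>)"
    unfolding S_def by (rule nn_integral_nu_add_cmult) measurable
  also have "\<dots> < \<infinity>" using S levy_measure by (simp add: ennreal_mult_less_top)
  finally show ?thesis using c'' by (auto simp: ennreal_mult_less_top)
qed

end

section \<open>Late passage and conditional moments\<close>

context walk begin

text \<open>The first \<open>N\<close> steps are independent of the next \<open>n\<close>, and the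
  depth of the later block has the law of \<open>low 0 n\<close> by shift invariance.\<close>

lemma prob_block:
  "prob {\<omega>\<in>space M. (low 0 N \<omega> \<le> x \<and> (\<Sum>i<N. \<xi> i \<omega>) \<le> y) \<and> z < low N n \<omega>}
    = prob {\<omega>\<in>space M. low 0 N \<omega> \<le> x \<and> (\<Sum>i<N. \<xi> i \<omega>) \<le> y} * prob {\<omega>\<in>space M. z < low 0 n \<omega>}"
proof -
  define f where "f v = (walk_low v 0 N, \<Sum>i<N. v i)" for v :: "nat \<Rightarrow> real"
  \<comment> \<open>The dummy coordinate gives \<open>g\<close> the same type as \<open>f\<close>,
    as \<open>indep_var\<close> requires.\<close>
  define g where "g v = (walk_low v N n, 0 :: real)" for v :: "nat \<Rightarrow> real"
  define F where "F \<omega> = (low 0 N \<omega>, \<Sum>i<N. \<xi> i \<omega>)" for \<omega>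
  have [measurable]: "g \<in> measurable (PiM {N..<N + n} (\<lambda>_. borel)) (borel \<Otimes>\<^sub>M borel)"
    unfolding g_def[abs_def] by (intro measurable_Pair measurable_walk_low) auto
  have [measurable]: "f \<in> measurable (PiM {..<N} (\<lambda>_. borel)) (borel \<Otimes>\<^sub>M borel)"
    unfolding f_def[abs_def] by (intro measurable_Pair measurable_walk_low borel_measurable_sum measurable_component_singleton) auto
  have "indep_var (PiM {..<N} (\<lambda>_. borel)) (\<lambda>\<omega>. restrict (\<lambda>i. \<xi> i \<omega>) {..<N})
      (PiM {N..<N + n} (\<lambda>_. borel)) (\<lambda>\<omega>. restrict (\<lambda>i. \<xi> i \<omega>) {N..<N + n})"
    by (rule indep_var_restrict[OF indep_steps[of "N + n"]]) auto
  then have "indep_var (borel \<Otimes>\<^sub>M borel) (f \<circ> (\<lambda>\<omega>. restrict (\<lambda>i. \<xi> i \<omega>) {..<N}))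
      (borel \<Otimes>\<^sub>M borel) (g \<circ> (\<lambda>\<omega>. restrict (\<lambda>i. \<xi> i \<omega>) {N..<N + n}))"
    by (rule indep_var_compose) measurable
  moreover have "f \<circ> (\<lambda>\<omega>. restrict (\<lambda>i. \<xi> i \<omega>) {..<N}) = F"
    by (auto simp: f_def F_def low_def fun_eq_iff intro!: walk_low_cong)
  moreover have "g \<circ> (\<lambda>\<omega>. restrict (\<lambda>i. \<xi> i \<omega>) {N..<N + n}) = (\<lambda>\<omega>. (low N n \<omega>, 0))"
    by (auto simp: g_def low_def fun_eq_iff intro!: walk_low_cong)
  ultimately have ind: "indep_var (borel \<Otimes>\<^sub>M borel) F (borel \<Otimes>\<^sub>M borel) (\<lambda>\<omega>. (low N n \<omega>, 0))" by simp
  have "prob ((\<lambda>\<omega>. (F \<omega>, (low N n \<omega>, 0))) -` (({..x} \<times> {..y}) \<times> ({z<..} \<times> (UNIV :: real set))) \<inter> space M)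
    = prob (F -` ({..x} \<times> {..y}) \<inter> space M) * prob ((\<lambda>\<omega>. (low N n \<omega>, 0)) -` ({z<..} \<times> (UNIV :: real set)) \<inter> space M)"
    by (rule indep_varD[OF ind]) auto
  moreover have "(\<lambda>\<omega>. (F \<omega>, (low N n \<omega>, 0))) -` (({..x} \<times> {..y}) \<times> ({z<..} \<times> (UNIV :: real set))) \<inter> space M
    = {\<omega>\<in>space M. (low 0 N \<omega> \<le> x \<and> (\<Sum>i<N. \<xi> i \<omega>) \<le> y) \<and> z < low N n \<omega>}"
    by (auto simp: F_def)
  moreover have "(\<lambda>\<omega>. (low N n \<omega>, 0)) -` ({z<..} \<times> (UNIV :: real set)) \<inter> space M = low N n -` {z<..} \<inter> space M"
    by auto
  moreover have "F -` ({..x} \<times> {..y}) \<inter> space M = {\<omega>\<in>space M. low 0 N \<omega> \<le> x \<and> (\<Sum>i<N. \<xi> i \<omega>) \<le> y}"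
    by (auto simp: F_def)
  moreover have "prob (low N n -` {z<..} \<inter> space M) = prob {\<omega>\<in>space M. z < low 0 n \<omega>}"
  proof -
    have "prob (low N n -` {z<..} \<inter> space M) = measure (distr M borel (low N n)) {z<..}"
      by (simp add: measure_distr)
    also have "\<dots> = measure (distr M borel (low 0 n)) {z<..}" by (subst distr_low) simp
    also have "\<dots> = prob (low 0 n -` {z<..} \<inter> space M)" by (simp add: measure_distr)
    also have "low 0 n -` {z<..} \<inter> space M = {\<omega>\<in>space M. z < low 0 n \<omega>}" by auto
    finally show ?thesis .
  qed
  ultimately show ?thesis by simp
qed

end

context levy_laplace begin

text \<open>If \<open>X\<close> stays above \<open>-x\<close> up to time \<open>t\<close>, ends below \<open>y\<close>, and the increments after \<open>t\<close>
  later fall below \<open>-(x + y)\<close>, then the passage happens after \<open>t\<close>.\<close>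

lemma passage_time_lower:
  assumes t: "0 < t" and x: "0 \<le> x" and xy: "0 \<le> x + y"
    and p: "0 \<le> p" "p \<le> prob {\<omega>\<in>space M. low_sup \<omega> \<le> ennreal x} - prob {\<omega>\<in>space M. y < X t \<omega>}"
  shows "p * prob {\<omega>\<in>space M. ennreal (x + y) < low_sup \<omega>}
    \<le> prob {\<omega>\<in>space M. ennreal t \<le> passage_below X x \<omega> \<and> passage_below X x \<omega> < \<infinity>}"
proof -
  define h where "h n = t / 2 ^ n" for n :: nat
  have h: "0 < h n" for n using t by (simp add: h_def)
  note [measurable] = walk.measurable_low[OF walk_steps[OF h]] walk.measurable_step[OF walk_steps[OF h]]
  have Xt [measurable]: "X t \<in> borel_measurable M" using t by (auto intro: measurable_X)
  define P where "P = {\<omega>\<in>space M. ennreal t \<le> passage_below X x \<omega> \<and> passage_below X x \<omega> < \<infinity>}"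
  have [measurable]: "P \<in> sets M" unfolding P_def by measurable
  define E1 where "E1 n = {\<omega>\<in>space M. grid_low (h n) 0 (2 ^ n) \<omega> \<le> x \<and> (\<Sum>i<2 ^ n. steps (h n) i \<omega>) \<le> y}" for n
  define E2 where "E2 n = {\<omega>\<in>space M. x + y < grid_low (h n) 0 (4 ^ n) \<omega>}" for n
  define E where "E n = {\<omega>\<in>space M. (grid_low (h n) 0 (2 ^ n) \<omega> \<le> x \<and> (\<Sum>i<2 ^ n. steps (h n) i \<omega>) \<le> y) \<and> x + y < grid_low (h n) (2 ^ n) (4 ^ n) \<omega>}" for n
  define S where "S = {\<omega>\<in>space M. ennreal (x + y) < low_sup \<omega>}"
  have [measurable]: "E1 n \<in> sets M" "E2 n \<in> sets M" "E n \<in> sets M" "S \<in> sets M" for n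
    unfolding E1_def E2_def E_def S_def by measurable
  have prob_E: "prob (E n) = prob (E1 n) * prob (E2 n)" for n
    unfolding E_def E1_def E2_def by (rule walk.prob_block[OF walk_steps[OF h]])
  have sum: "(\<Sum>i<2 ^ n. steps (h n) i \<omega>) = X t \<omega> - X 0 \<omega>" for n \<omega>
    using sum_steps[of "h n" 0 \<omega> "2 ^ n"] by (simp add: h_def)
  have p_E1: "p \<le> prob (E1 n)" for n
  proof -
    have "AE \<omega> in M. \<omega> \<in> {\<omega>\<in>space M. low_sup \<omega> \<le> ennreal x} \<longrightarrow> \<omega> \<in> E1 n \<union> {\<omega>\<in>space M. y < X t \<omega>}"
      using start
    proof eventually_elim
      case (elim \<omega>)
      have "grid_low (h n) 0 (2 ^ n) \<omega> \<le> x" if "low_sup \<omega> \<le> ennreal x"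
        unfolding grid_low_le_iff[OF h x]
      proof (intro allI impI)
        fix k
        have "ennreal (- X (real (0 + k) * h n) \<omega>) \<le> low_sup \<omega>"
          unfolding low_sup_def using h[of n] by (intro SUP_upper) auto
        also note that
        finally show "X (real 0 * h n) \<omega> - x \<le> X (real (0 + k) * h n) \<omega>" using x elim by (simp add: ennreal_le_iff)
      qed
      then show ?case using elim by (auto simp: E1_def sum)
    qed
    then have "prob {\<omega>\<in>space M. low_sup \<omega> \<le> ennreal x} \<le> prob (E1 n \<union> {\<omega>\<in>space M. y < X t \<omega>})"
      by (intro finite_measure_mono_AE) auto
    also have "\<dots> \<le> prob (E1 n) + prob {\<omega>\<in>space M. y < X t \<omega>}" by (intro measure_Un_le) auto
    finally show ?thesis using p by simp
  qed
  \<comment> \<open>Only one-sided limits are available: points of \<open>S\<close> eventually lie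
    in \<open>E2 n\<close>, and points outside \<open>P\<close> eventually leave \<open>E n\<close>.
    \<open>min\<close> with \<open>S\<close> and \<open>max\<close> with \<open>P\<close> turn these
    into genuine limits.\<close>
  have lower: "(\<lambda>n. expectation (\<lambda>\<omega>. min (indicat_real (E2 n) \<omega>) (indicat_real S \<omega>))) \<longlonglongrightarrow> expectation (indicat_real S)"
  proof (rule integral_dominated_convergence[where w="\<lambda>_. 1"])
    show "AE \<omega> in M. (\<lambda>n. min (indicat_real (E2 n) \<omega>) (indicat_real S \<omega>)) \<longlonglongrightarrow> (indicat_real S \<omega>)"
      using start AE_space
    proof eventually_elim
      case (elim \<omega>)
      show ?case
      proof (cases "\<omega> \<in> S")
        case True
        then have "\<forall>\<^sub>F n in sequentially. ennreal (x + y) < ennreal (grid_low (h n) 0 (4 ^ n) \<omega>)"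
          using order_tendstoD(1)[OF grid_low_tendsto[OF elim(2,1) t], of "ennreal (x + y)"] by (simp add: S_def h_def)
        then have "\<forall>\<^sub>F n in sequentially. min (indicat_real (E2 n) \<omega>) (indicat_real S \<omega>) = (indicat_real S \<omega>)"
          by eventually_elim (use elim True xy in \<open>simp add: E2_def ennreal_less_iff\<close>)
        then show ?thesis by (rule tendsto_eventually)
      qed simp
    qed
    show "AE \<omega> in M. norm (min (indicat_real (E2 n) \<omega>) (indicat_real S \<omega>)) \<le> 1" for n
      by (intro AE_I2) (simp add: indicator_def)
  qed auto
  have upper: "(\<lambda>n. expectation (\<lambda>\<omega>. max (indicat_real (E n) \<omega>) (indicat_real P \<omega>))) \<longlonglongrightarrow> expectation (indicat_real P)"
  proof (rule integral_dominated_convergence[where w="\<lambda>_. 1"])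
    show "AE \<omega> in M. (\<lambda>n. max (indicat_real (E n) \<omega>) (indicat_real P \<omega>)) \<longlonglongrightarrow> (indicat_real P \<omega>)"
      using start AE_space
    proof eventually_elim
      case (elim \<omega>)
      show ?case
      proof (cases "\<omega> \<in> P")
        case False
        \<comment> \<open>Outside \<open>P\<close> there is either no passage, whereas
          \<open>E n\<close> forces one, or a passage before \<open>t\<close>, which every fine grid
          detects within its first \<open>2 ^ n\<close> steps.\<close>
        have "\<forall>\<^sub>F n in sequentially. \<omega> \<notin> E n"
        proof (cases "passage_below X x \<omega> < \<infinity>")
          case inf: False
          have "\<omega> \<notin> E n" for n
          proof
            assume "\<omega> \<in> E n"
            then have y: "X t \<omega> \<le> y" and "\<not> grid_low (h n) (2 ^ n) (4 ^ n) \<omega> \<le> x + y"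
              using elim by (auto simp: E_def sum)
            then obtain k where "X (real (2 ^ n + k) * h n) \<omega> < X (real (2 ^ n) * h n) \<omega> - (x + y)"
              unfolding grid_low_le_iff[OF h xy] by (auto simp: not_le)
            moreover have "real (2 ^ n) * h n = t" by (simp add: h_def)
            ultimately have "X (real (2 ^ n + k) * h n) \<omega> < - x" using y by (simp only:)
            moreover have "0 < real (2 ^ n + k) * h n" using h[of n] by (intro mult_pos_pos) (auto simp: add_pos_nonneg)
            ultimately have "passage_below X x \<omega> \<le> ennreal (real (2 ^ n + k) * h n)" by (intro passage_below_le)
            then show False using inf by (auto simp: less_top[symmetric] top_unique)
          qed
          then show ?thesis by simp
        next
          case True
          with False elim have "passage_below X x \<omega> < ennreal t" by (auto simp: P_def)
          then obtain s where s: "0 < s" "X s \<omega> < - x" "s < t"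
            by (auto simp: passage_below_def INF_less_iff ennreal_less_iff)
          have ts: "0 < t - s" using s by simp
          obtain N k where k: "0 < k" "s < real k * (t / 2 ^ N)" "real k * (t / 2 ^ N) < s + (t - s)" "X (real k * (t / 2 ^ N)) \<omega> < - x"
            by (rule grid_dense[OF elim(2) t less_imp_le[OF s(1)] s(2) ts])
          have "\<omega> \<notin> E n" if n: "N \<le> n" for n
          proof -
            define K where "K = k * 2 ^ (n - N)"
            have pow: "(2::real) ^ n = 2 ^ N * 2 ^ (n - N)" using n by (simp flip: power_add)
            have K: "real K * h n = real k * (t / 2 ^ N)" by (simp add: K_def h_def pow)
            have "real k * t < t * 2 ^ N" using k(3) by (simp add: field_simps)
            then have "real k < 2 ^ N" using t by simp
            then have "real K < 2 ^ n" unfolding pow K_def by simp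
            then have "real K < real (2 ^ n)" by simp
            then have "K \<le> 2 ^ n" by (simp only: of_nat_less_iff less_imp_le)
            then have "\<not> grid_low (h n) 0 (2 ^ n) \<omega> \<le> x"
              using k(4) K elim unfolding grid_low_le_iff[OF h x] by (auto intro!: exI[of _ K])
            then show ?thesis by (simp add: E_def)
          qed
          then show ?thesis by (auto simp: eventually_sequentially)
        qed
        then have "\<forall>\<^sub>F n in sequentially. max (indicat_real (E n) \<omega>) (indicat_real P \<omega>) = (indicat_real P \<omega>)"
          by eventually_elim simp
        then show ?thesis by (rule tendsto_eventually)
      qed (simp add: indicator_def)
    qed
    show "AE \<omega> in M. norm (max (indicat_real (E n) \<omega>) (indicat_real P \<omega>) :: real) \<le> 1" for n
      by (intro AE_I2) (simp add: indicator_def)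
  qed auto
  have "p * expectation (indicat_real S) \<le> expectation (indicat_real P)"
  proof (rule LIMSEQ_le[OF tendsto_mult[OF tendsto_const lower] upper], intro exI allI impI)
    fix n :: nat
    have "expectation (\<lambda>\<omega>. min (indicat_real (E2 n) \<omega>) (indicat_real S \<omega>)) \<le> expectation (indicat_real (E2 n))"
      by (intro integral_mono integrable_const_bound[where B=1]) (auto simp: indicator_def)
    then have "p * expectation (\<lambda>\<omega>. min (indicat_real (E2 n) \<omega>) (indicat_real S \<omega>)) \<le> p * prob (E2 n)"
      using p(1) by (intro mult_left_mono) auto
    also have "\<dots> \<le> prob (E1 n) * prob (E2 n)" by (intro mult_right_mono p_E1) auto
    also have "\<dots> = expectation (indicat_real (E n))" by (simp add: prob_E)
    also have "\<dots> \<le> expectation (\<lambda>\<omega>. max (indicat_real (E n) \<omega>) (indicat_real P \<omega>))"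
      by (intro integral_mono integrable_const_bound[where B=1]) (auto simp: indicator_def)
    finally show "p * expectation (\<lambda>\<omega>. min (indicat_real (E2 n) \<omega>) (indicat_real S \<omega>)) \<le> expectation (\<lambda>\<omega>. max (indicat_real (E n) \<omega>) (indicat_real P \<omega>))" .
  qed
  then show ?thesis by (simp add: S_def P_def)
qed

text \<open>Infinite passage times become 0, so for \<open>k > 0\<close> the power moment
  automatically runs over the event of passage only.\<close>

definition finite_passage :: "real \<Rightarrow> 'a \<Rightarrow> real" where
  "finite_passage x \<omega> = enn2real (passage_below X x \<omega>)"

lemma measurable_finite_passage [measurable]: "finite_passage x \<in> borel_measurable M"
  unfolding finite_passage_def[abs_def] by measurable

lemma cond_passage_moment_finite_iff:
  assumes k: "0 < k"
  shows "cond_passage_moment M X x k < \<infinity> \<longleftrightarrow> (\<integral>\<^sup>+\<omega>. ennreal (finite_passage x \<omega> powr k) \<partial>M) < \<infinity>"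
proof -
  define A where "A = {\<omega>\<in>space M. passage_below X x \<omega> < \<infinity>}"
  have [measurable]: "A \<in> sets M" unfolding A_def by measurable
  define N where "N = (\<integral>\<^sup>+\<omega>. time_power (passage_below X x \<omega>) k * indicator A \<omega> \<partial>M)"
  have N: "N = (\<integral>\<^sup>+\<omega>. ennreal (finite_passage x \<omega> powr k) \<partial>M)"
    unfolding N_def finite_passage_def using k
    by (intro nn_integral_cong) (auto simp: A_def time_power_def indicator_def less_top)
  have cond: "cond_passage_moment M X x k = N / emeasure M A"
    unfolding cond_passage_moment_def A_def[symmetric] N_def by (rule nn_integral_uniform_measure) measurable
  have "N / emeasure M A < \<infinity> \<longleftrightarrow> N < \<infinity>"
  proof
    assume *: "N < \<infinity>"
    show "N / emeasure M A < \<infinity>"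
    proof (cases "emeasure M A = 0")
      \<comment> \<open>If passage has probability 0, the numerator vanishes as well, and the
        quotient is 0 by convention.\<close>
      case True
      then have "A \<in> null_sets M" by auto
      then have "AE \<omega> in M. \<omega> \<notin> A" by (rule AE_not_in)
      then have "N = 0" unfolding N_def by (subst nn_integral_0_iff_AE) (auto elim!: eventually_mono)
      then show ?thesis by simp
    next
      case False
      then show ?thesis using * by (simp add: less_top[symmetric] ennreal_divide_eq_top_iff)
    qed
  next
    assume *: "N / emeasure M A < \<infinity>"
    have "emeasure M A \<noteq> \<infinity>" by (simp add: emeasure_eq_measure)
    then have "inverse (emeasure M A) \<noteq> 0" by simp
    with * show "N < \<infinity>" by (auto simp: divide_ennreal_def ennreal_mult_less_top)
  qed
  then show ?thesis unfolding cond N .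
qed

end

context levy_laplace_mean begin

lemma psi_pos: "0 < m \<Longrightarrow> 0 < \<theta> \<Longrightarrow> 0 < \<psi> \<theta>"
  using psi_ge[of \<theta>] mult_pos_pos[of m \<theta>] by linarith

lemma prob_low_sup_eq:
  assumes "0 < m" "0 \<le> a"
  shows "prob {\<omega>\<in>space M. low_sup \<omega> \<le> ennreal a} = prob {\<omega>\<in>space M. low_real \<omega> \<le> a}"
    and "prob {\<omega>\<in>space M. ennreal a < low_sup \<omega>} = prob {\<omega>\<in>space M. a < low_real \<omega>}"
proof -
  have *: "AE \<omega> in M. low_sup \<omega> = ennreal (low_real \<omega>)"
    using AE_low_sup_finite[OF assms(1)] by eventually_elim (simp add: low_real_def)
  show "prob {\<omega>\<in>space M. low_sup \<omega> \<le> ennreal a} = prob {\<omega>\<in>space M. low_real \<omega> \<le> a}"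
    using * assms by (intro measure_eq_AE) (auto elim!: eventually_mono simp: ennreal_le_iff)
  show "prob {\<omega>\<in>space M. ennreal a < low_sup \<omega>} = prob {\<omega>\<in>space M. a < low_real \<omega>}"
    using * assms low_real_nonneg by (intro measure_eq_AE) (auto elim!: eventually_mono simp: ennreal_less_iff)
qed

text \<open>Pointwise, \<open>exp (- \<theta> * w)\<close> is at most 1 for \<open>w \<le> x\<close>
  and at most \<open>exp (- \<theta> * x)\<close> beyond; the transform of the depth is
  explicit.\<close>

lemma prob_low_real_ge:
  assumes m: "0 < m" and \<theta>: "0 < \<theta>"
  shows "\<theta> * m / \<psi> \<theta> - exp (- \<theta> * x) \<le> prob {\<omega>\<in>space M. low_real \<omega> \<le> x}"
proof -
  have "expectation (\<lambda>\<omega>. exp (- \<theta> * low_real \<omega>)) \<le> expectation (\<lambda>\<omega>. indicator {\<omega>\<in>space M. low_real \<omega> \<le> x} \<omega> + exp (- \<theta> * x))"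
  proof (rule integral_mono)
    show "integrable M (\<lambda>\<omega>. exp (- \<theta> * low_real \<omega>))"
      using \<theta> low_real_nonneg by (intro integrable_const_bound[where B=1]) auto
    show "exp (- \<theta> * low_real \<omega>) \<le> indicator {\<omega>\<in>space M. low_real \<omega> \<le> x} \<omega> + exp (- \<theta> * x)" if "\<omega> \<in> space M" for \<omega>
      using that \<theta> low_real_nonneg[of \<omega>] by (auto simp: indicator_def intro: order_trans[of _ 1])
  qed (simp add: emeasure_eq_measure)
  also have "\<dots> = prob {\<omega>\<in>space M. low_real \<omega> \<le> x} + exp (- \<theta> * x)"
    by (simp add: emeasure_eq_measure prob_space)
  also have "expectation (\<lambda>\<omega>. exp (- \<theta> * low_real \<omega>)) = \<theta> * m / \<psi> \<theta>"
    using laplace_low_real[OF \<theta> m] psi_pos[OF m \<theta>] by (simp add: field_simps)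
  finally show ?thesis by simp
qed

text \<open>For \<open>x > 0\<close> quadratic growth keeps the transform above
  \<open>m / (C * \<theta>)\<close>, which beats \<open>exp (- \<theta> * x)\<close> for large
  \<theta>. At \<open>x = 0\<close> linear growth gives the bound \<open>m / C\<close> uniformly
  over positive levels, and continuity from above passes to 0.\<close>

lemma prob_low_real_pos:
  assumes m: "0 < m" and x: "admissible_level M X x"
  shows "0 < prob {\<omega>\<in>space M. low_real \<omega> \<le> x}"
proof (cases "x = 0")
  case False
  with x have x0: "0 < x" by (simp add: admissible_level_def)
  obtain C where C: "0 < C" "\<And>t. 1 \<le> t \<Longrightarrow> \<psi> t \<le> C * t\<^sup>2" using psi_upper by auto
  have "((\<lambda>\<theta>. \<theta> * exp (- \<theta> * x)) \<longlongrightarrow> 0) at_top" using x0 by real_asymp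
  then have "\<forall>\<^sub>F \<theta> in at_top. \<theta> * exp (- \<theta> * x) < m / C" using m C(1) by (intro order_tendstoD(2)) auto
  then obtain N where N: "\<And>\<theta>. N \<le> \<theta> \<Longrightarrow> \<theta> * exp (- \<theta> * x) < m / C" by (auto simp: eventually_at_top_linorder)
  define \<theta> where "\<theta> = max N 1"
  have \<theta>: "1 \<le> \<theta>" "\<theta> * exp (- \<theta> * x) < m / C" using N[of \<theta>] by (auto simp: \<theta>_def)
  have "exp (- \<theta> * x) < m / (C * \<theta>)" using \<theta> C(1) by (simp add: field_simps)
  also have "\<dots> \<le> \<theta> * m / \<psi> \<theta>"
    using C(2)[OF \<theta>(1)] C(1) \<theta>(1) psi_pos[OF m, of \<theta>] mult_left_mono[OF C(2)[OF \<theta>(1)], of m] m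
    by (simp add: field_simps power2_eq_square)
  finally show ?thesis using prob_low_real_ge[OF m, of \<theta> x] \<theta>(1) by linarith
next
  case True
  with x have "\<not> unbounded_variation_paths M X" by (simp add: admissible_level_def)
  then obtain C where C: "\<And>\<theta>. 1 \<le> \<theta> \<Longrightarrow> \<psi> \<theta> \<le> C * \<theta>" using psi_linear_bound by blast
  have C0: "0 < C" using C[of 1] psi_pos[OF m, of 1] by simp
  have le: "m / C \<le> prob {\<omega>\<in>space M. low_real \<omega> \<le> \<epsilon>}" if \<epsilon>: "0 < \<epsilon>" for \<epsilon>
  proof -
    have lim: "((\<lambda>\<theta>. m / C - exp (- \<theta> * \<epsilon>)) \<longlongrightarrow> m / C) at_top" using \<epsilon> by real_asymp
    have "\<forall>\<^sub>F \<theta> in at_top. m / C - exp (- \<theta> * \<epsilon>) \<le> prob {\<omega>\<in>space M. low_real \<omega> \<le> \<epsilon>}"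
      using eventually_ge_at_top[of 1]
    proof eventually_elim
      case (elim \<theta>)
      have "m / C \<le> \<theta> * m / \<psi> \<theta>"
        using C[OF elim] C0 psi_pos[OF m, of \<theta>] elim mult_left_mono[OF C[OF elim], of m] m by (simp add: field_simps)
      then show ?case using prob_low_real_ge[OF m, of \<theta> \<epsilon>] elim by linarith
    qed
    with lim show ?thesis by (rule tendsto_upperbound) simp
  qed
  have "(\<lambda>n. prob {\<omega>\<in>space M. low_real \<omega> \<le> 1 / real (Suc n)}) \<longlonglongrightarrow> prob (\<Inter>n. {\<omega>\<in>space M. low_real \<omega> \<le> 1 / real (Suc n)})"
  proof (rule finite_Lim_measure_decseq)
    show "decseq (\<lambda>n. {\<omega>\<in>space M. low_real \<omega> \<le> 1 / real (Suc n)})"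
    proof (intro decseq_SucI subsetI)
      fix n \<omega> assume *: "\<omega> \<in> {\<omega>\<in>space M. low_real \<omega> \<le> 1 / real (Suc (Suc n))}"
      have "1 / real (Suc (Suc n)) \<le> 1 / real (Suc n)" by (rule frac_le) auto
      with * show "\<omega> \<in> {\<omega>\<in>space M. low_real \<omega> \<le> 1 / real (Suc n)}" by simp
    qed
  qed auto
  also have "(\<Inter>n. {\<omega>\<in>space M. low_real \<omega> \<le> 1 / real (Suc n)}) = {\<omega>\<in>space M. low_real \<omega> \<le> 0}"
  proof (intro equalityI subsetI)
    fix \<omega> assume *: "\<omega> \<in> (\<Inter>n. {\<omega>\<in>space M. low_real \<omega> \<le> 1 / real (Suc n)})"
    have "low_real \<omega> \<le> 0"
    proof (rule ccontr)
      assume "\<not> low_real \<omega> \<le> 0"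
      then obtain n where "inverse (real (Suc n)) < low_real \<omega>" using reals_Archimedean[of "low_real \<omega>"] by auto
      moreover have "low_real \<omega> \<le> 1 / real (Suc n)" using * by blast
      ultimately show False by (simp add: inverse_eq_divide)
    qed
    then show "\<omega> \<in> {\<omega>\<in>space M. low_real \<omega> \<le> 0}" using * by auto
  qed (auto intro: order_trans)
  finally have "m / C \<le> prob {\<omega>\<in>space M. low_real \<omega> \<le> 0}"
    by (rule LIMSEQ_le_const) (use le in auto)
  moreover have "0 < m / C" using m C0 by simp
  ultimately show ?thesis unfolding True by linarith
qed

text \<open>The passage estimate is applied at \<open>2 t\<close>, so that \<open>2 t \<le> \<tau>\<close> implies the strict \<open>t < \<tau>\<close> of the
  layer-cake formula.\<close>

lemma low_moment_finite_of_finite_passage: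
  assumes m: "0 < m" and x: "admissible_level M X x" and k: "0 < k"
    and fin: "(\<integral>\<^sup>+\<omega>. ennreal (finite_passage x \<omega> powr k) \<partial>M) < \<infinity>"
  shows "low_moment k < \<infinity>"
proof -
  have x0: "0 \<le> x" using x by (simp add: admissible_level_def)
  \<comment> \<open>The extra 1 makes Markov's inequality bound the probability of
    \<open>X (2 * t) > 2 * K * t\<close> by \<open>exp (- (2 * t))\<close>. \<open>p\<close> is half
    the probability of depth at most \<open>x\<close>; from \<open>t0\<close> on the other half
    absorbs this tail.\<close>
  define K where "K = \<psi> 1 + 1"
  have K: "0 < K" using psi_nonneg[of 1] by (simp add: K_def)
  define p where "p = prob {\<omega>\<in>space M. low_real \<omega> \<le> x} / 2"
  have p: "0 < p" using prob_low_real_pos[OF m x] by (simp add: p_def)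
  define t0 where "t0 = max 1 (- ln p)"
  have key: "p * prob {\<omega>\<in>space M. x + 2 * K * t < low_real \<omega>} \<le> prob {\<omega>\<in>space M. t < finite_passage x \<omega>}"
    if t: "t0 \<le> t" for t
  proof -
    have t1: "0 < t" "- ln p \<le> t" using t by (auto simp: t0_def)
    have tail: "prob {\<omega>\<in>space M. 2 * K * t < X (2 * t) \<omega>} \<le> p"
    proof -
      have [measurable]: "X (2 * t) \<in> borel_measurable M" using t1 by (auto intro: measurable_X)
      have "prob {\<omega>\<in>space M. 2 * K * t < X (2 * t) \<omega>} \<le> prob {\<omega>\<in>space M. - (- (2 * K * t)) \<le> X (2 * t) \<omega>}"
        by (intro finite_measure_mono) auto
      also have "\<dots> \<le> exp (1 * - (2 * K * t) + 2 * t * \<psi> 1)" using t1 by (intro prob_level_bound) auto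
      also have "\<dots> = exp (- (2 * t))" by (simp add: K_def algebra_simps)
      also have "\<dots> \<le> exp (ln p)" using t1 by simp
      finally show ?thesis using p by simp
    qed
    have "p * prob {\<omega>\<in>space M. ennreal (x + 2 * K * t) < low_sup \<omega>}
      \<le> prob {\<omega>\<in>space M. ennreal (2 * t) \<le> passage_below X x \<omega> \<and> passage_below X x \<omega> < \<infinity>}"
    proof (rule passage_time_lower)
      show "p \<le> prob {\<omega>\<in>space M. low_sup \<omega> \<le> ennreal x} - prob {\<omega>\<in>space M. 2 * K * t < X (2 * t) \<omega>}"
        using tail unfolding prob_low_sup_eq(1)[OF m x0] p_def by simp
    qed (use t1 x0 K p in auto)
    also have "\<dots> \<le> prob {\<omega>\<in>space M. t < finite_passage x \<omega>}"
    proof (rule finite_measure_mono)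
      show "{\<omega>\<in>space M. ennreal (2 * t) \<le> passage_below X x \<omega> \<and> passage_below X x \<omega> < \<infinity>} \<subseteq> {\<omega>\<in>space M. t < finite_passage x \<omega>}"
      proof safe
        fix \<omega> assume "ennreal (2 * t) \<le> passage_below X x \<omega>" "passage_below X x \<omega> < \<infinity>"
        then have "2 * t \<le> finite_passage x \<omega>"
          unfolding finite_passage_def using enn2real_mono[of "ennreal (2 * t)" "passage_below X x \<omega>"] t1 by simp
        then show "t < finite_passage x \<omega>" using t1 by simp
      qed
    qed measurable
    finally show ?thesis
      using prob_low_sup_eq(2)[OF m, of "x + 2 * K * t"] x0 K t1 by simp
  qed
  \<comment> \<open>The excess depth rescaled to time units, so that \<open>t < Z \<omega>\<close>
    is exactly the event bounded in \<open>key\<close>.\<close>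
  define Z where "Z \<omega> = max 0 ((low_real \<omega> - x) / (2 * K))" for \<omega>
  have [measurable]: "Z \<in> borel_measurable M" unfolding Z_def[abs_def] by measurable
  have Z0: "0 \<le> Z \<omega>" for \<omega> by (simp add: Z_def)
  have Z_iff: "t < Z \<omega> \<longleftrightarrow> x + 2 * K * t < low_real \<omega>" if "0 \<le> t" for t \<omega>
    using that K by (auto simp: Z_def less_max_iff_disj field_simps)
  have "(\<integral>\<^sup>+\<omega>. ennreal (Z \<omega> powr k) \<partial>M) = (\<integral>\<^sup>+t. ennreal (k * t powr (k - 1)) * (emeasure M {\<omega>\<in>space M. t < Z \<omega>} * indicator {0..} t) \<partial>lborel)"
    using k Z0 by (intro nn_integral_powr_layer_cake) auto
  also have "\<dots> \<le> (\<integral>\<^sup>+t. ennreal (k * t powr (k - 1)) * indicator {0..<t0} t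
    + ennreal (1 / p) * (ennreal (k * t powr (k - 1)) * (emeasure M {\<omega>\<in>space M. t < finite_passage x \<omega>} * indicator {0..} t)) \<partial>lborel)"
  proof (rule nn_integral_mono)
    fix t :: real
    show "ennreal (k * t powr (k - 1)) * (emeasure M {\<omega>\<in>space M. t < Z \<omega>} * indicator {0..} t)
      \<le> ennreal (k * t powr (k - 1)) * indicator {0..<t0} t
        + ennreal (1 / p) * (ennreal (k * t powr (k - 1)) * (emeasure M {\<omega>\<in>space M. t < finite_passage x \<omega>} * indicator {0..} t))"
    proof (cases "t < t0")
      case True
      have "ennreal (k * t powr (k - 1)) * (emeasure M {\<omega>\<in>space M. t < Z \<omega>} * indicator {0..} t) \<le> ennreal (k * t powr (k - 1)) * (1 * indicator {0..} t)"
        by (intro mult_left_mono mult_right_mono emeasure_le_1) auto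
      also have "\<dots> = ennreal (k * t powr (k - 1)) * indicator {0..<t0} t" using True by (auto simp: indicator_def)
      finally show ?thesis by (rule order_trans) simp
    next
      case False
      then have t: "t0 \<le> t" "0 \<le> t" by (auto simp: t0_def)
      have "prob {\<omega>\<in>space M. t < Z \<omega>} \<le> 1 / p * prob {\<omega>\<in>space M. t < finite_passage x \<omega>}"
        using key[OF t(1)] p unfolding Z_iff[OF t(2)] by (simp add: field_simps)
      then have "emeasure M {\<omega>\<in>space M. t < Z \<omega>} \<le> ennreal (1 / p) * emeasure M {\<omega>\<in>space M. t < finite_passage x \<omega>}"
        using p by (simp add: emeasure_eq_measure ennreal_leI flip: ennreal_mult)
      then have "ennreal (k * t powr (k - 1)) * emeasure M {\<omega>\<in>space M. t < Z \<omega>}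
        \<le> ennreal (k * t powr (k - 1)) * (ennreal (1 / p) * emeasure M {\<omega>\<in>space M. t < finite_passage x \<omega>})"
        by (intro mult_left_mono) auto
      then show ?thesis using False t by (simp add: mult_ac)
    qed
  qed
  also have "\<dots> = (\<integral>\<^sup>+t. ennreal (k * t powr (k - 1)) * indicator {0..<t0} t \<partial>lborel)
    + ennreal (1 / p) * (\<integral>\<^sup>+t. ennreal (k * t powr (k - 1)) * (emeasure M {\<omega>\<in>space M. t < finite_passage x \<omega>} * indicator {0..} t) \<partial>lborel)"
    by (subst nn_integral_add) (auto simp: nn_integral_cmult)
  also have "\<dots> = ennreal (t0 powr k) + ennreal (1 / p) * (\<integral>\<^sup>+\<omega>. ennreal (finite_passage x \<omega> powr k) \<partial>M)"
    using k nn_integral_powr_layer_cake[of "finite_passage x" k]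
    by (simp add: nn_integral_powr_layer t0_def finite_passage_def[abs_def])
  also have "\<dots> < \<infinity>" using fin by (simp add: ennreal_mult_less_top)
  finally have finZ: "(\<integral>\<^sup>+\<omega>. ennreal (Z \<omega> powr k) \<partial>M) < \<infinity>" .
  have "low_moment k \<le> (\<integral>\<^sup>+\<omega>. ennreal ((2 * x) powr k) + ennreal ((4 * K) powr k) * ennreal (Z \<omega> powr k) \<partial>M)"
    unfolding low_moment_def
  proof (rule nn_integral_mono)
    fix \<omega>
    have "low_real \<omega> \<le> x + 2 * K * Z \<omega>"
      using K by (auto simp: Z_def max_def field_simps)
    also have "\<dots> \<le> max (2 * x) (4 * K * Z \<omega>)" by (simp add: max_def)
    finally have "low_real \<omega> powr k \<le> max (2 * x) (4 * K * Z \<omega>) powr k"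
      using k low_real_nonneg by (intro powr_mono2) auto
    also have "\<dots> \<le> (2 * x) powr k + (4 * K * Z \<omega>) powr k" by (simp add: max_def)
    also have "(4 * K * Z \<omega>) powr k = (4 * K) powr k * Z \<omega> powr k" by (rule powr_mult)
    finally have "ennreal (low_real \<omega> powr k) \<le> ennreal ((2 * x) powr k + (4 * K) powr k * Z \<omega> powr k)" by (rule ennreal_leI)
    then show "ennreal (low_real \<omega> powr k) \<le> ennreal ((2 * x) powr k) + ennreal ((4 * K) powr k) * ennreal (Z \<omega> powr k)"
      by (simp add: ennreal_mult)
  qed
  also have "\<dots> = ennreal ((2 * x) powr k) + ennreal ((4 * K) powr k) * (\<integral>\<^sup>+\<omega>. ennreal (Z \<omega> powr k) \<partial>M)"
    by (simp add: nn_integral_add nn_integral_cmult emeasure_space_1)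
  also have "\<dots> < \<infinity>" using finZ by (simp add: ennreal_mult_less_top)
  finally show ?thesis .
qed

text \<open>Removing half of the drift leaves the positive slope \<open>m / 2\<close> and the same
  \<nu>, so all results on the depth apply to the slower process with the same jump moments.\<close>

lemma drift_change:
  assumes m: "0 < m"
  shows "levy_laplace_mean M (\<lambda>t \<omega>. X t \<omega> - m / 2 * t) (c - m / 2) \<sigma> \<nu> (\<lambda>\<theta>. \<psi> \<theta> - m / 2 * \<theta>) (m / 2)"
proof -
  define Y where "Y t \<omega> = X t \<omega> - m / 2 * t" for t \<omega>
  define \<eta> where "\<eta> \<theta> = \<psi> \<theta> - m / 2 * \<theta>" for \<theta>
  have Y_diff: "Y s \<omega> - Y t \<omega> = X s \<omega> - X t \<omega> - m / 2 * (s - t)" for s t \<omega>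
    by (simp add: Y_def right_diff_distrib)
  interpret Y: levy_laplace M Y "c - m / 2" \<sigma> \<nu> \<eta>
  proof unfold_locales
    fix t :: real assume t: "0 \<le> t"
    note [measurable] = measurable_X[OF t]
    show "Y t \<in> borel_measurable M" unfolding Y_def[abs_def] by measurable
  next
    fix \<omega> and t :: real assume "\<omega> \<in> space M" "0 \<le> t"
    then show "((\<lambda>s. Y s \<omega>) \<longlongrightarrow> Y t \<omega>) (at_right t)"
      unfolding Y_def by (intro tendsto_intros right_continuous)
  next
    fix \<omega> and t :: real assume "\<omega> \<in> space M" "0 < t"
    then obtain l where "((\<lambda>s. X s \<omega>) \<longlongrightarrow> l) (at_left t)" using left_limits by blast
    then have "((\<lambda>s. Y s \<omega>) \<longlongrightarrow> l - m / 2 * t) (at_left t)"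
      unfolding Y_def by (intro tendsto_intros)
    then show "\<exists>l. ((\<lambda>s. Y s \<omega>) \<longlongrightarrow> l) (at_left t)" ..
  next
    fix n :: nat and u :: "nat \<Rightarrow> real" assume u: "0 \<le> u 0" "\<forall>i<n. u i < u (Suc i)"
    show "indep_vars (\<lambda>_. borel) (\<lambda>i \<omega>. Y (u (Suc i)) \<omega> - Y (u i) \<omega>) {..<n}"
      unfolding Y_diff
      by (rule indep_vars_compose2[OF independent_increments[of u n, OF u], where Y="\<lambda>i x. x - m / 2 * (u (Suc i) - u i)"]) simp
  next
    fix s h :: real assume sh: "0 \<le> s" "0 \<le> h"
    then have [measurable]: "X (s + h) \<in> borel_measurable M" "X s \<in> borel_measurable M" "X h \<in> borel_measurable M" "X 0 \<in> borel_measurable M"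
      by (auto intro: measurable_X)
    have "distr M borel (\<lambda>\<omega>. Y (s + h) \<omega> - Y s \<omega>) = distr (distr M borel (\<lambda>\<omega>. X (s + h) \<omega> - X s \<omega>)) borel (\<lambda>x. x - m / 2 * h)"
      unfolding Y_diff by (subst distr_distr) (auto simp: comp_def)
    also have "\<dots> = distr (distr M borel (\<lambda>\<omega>. X h \<omega> - X 0 \<omega>)) borel (\<lambda>x. x - m / 2 * h)"
      using stationary_increments[OF sh] by simp
    also have "\<dots> = distr M borel (\<lambda>\<omega>. Y h \<omega> - Y 0 \<omega>)"
      unfolding Y_diff by (subst distr_distr) (auto simp: comp_def)
    finally show "distr M borel (\<lambda>\<omega>. Y (s + h) \<omega> - Y s \<omega>) = distr M borel (\<lambda>\<omega>. Y h \<omega> - Y 0 \<omega>)" .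
  next
    fix \<theta> :: real assume "0 \<le> \<theta>"
    then show "\<eta> \<theta> = (c - m / 2) * \<theta> + 1 / 2 * \<sigma>\<^sup>2 * \<theta>\<^sup>2 + (\<integral>y. (exp (- \<theta> * y) - 1 + \<theta> * y * indicator {y. y < 1} y) \<partial>\<nu>)"
      unfolding \<eta>_def by (simp add: psi algebra_simps)
  next
    show "AE \<omega> in M. Y 0 \<omega> = 0" using start by eventually_elim (simp add: Y_def)
  next
    show "laplace_exponent M Y \<eta>"
      unfolding laplace_exponent_def
    proof (intro allI impI conjI)
      fix \<theta> t :: real assume \<theta>: "0 \<le> \<theta>" and t: "0 < t"
      have eq: "exp (\<theta> * Y t \<omega>) = exp (- (\<theta> * m / 2 * t)) * exp (\<theta> * X t \<omega>)" for \<omega>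
        by (simp add: Y_def algebra_simps flip: exp_add)
      show "integrable M (\<lambda>\<omega>. exp (\<theta> * Y t \<omega>))"
        unfolding eq by (intro integrable_mult_right integrable_exp \<theta> t)
      have "expectation (\<lambda>\<omega>. exp (\<theta> * Y t \<omega>)) = exp (- (\<theta> * m / 2 * t)) * exp (t * \<psi> \<theta>)"
        unfolding eq using \<theta> t by (simp add: expectation_exp)
      also have "\<dots> = exp (t * \<eta> \<theta>)" by (simp add: \<eta>_def algebra_simps flip: exp_add)
      finally show "\<eta> \<theta> = 1 / t * ln (expectation (\<lambda>\<omega>. exp (\<theta> * Y t \<omega>)))" using t by simp
    qed
  qed (rule sets_nu levy_measure)+
  have "((\<lambda>\<theta>. ereal (Y.psi' \<theta>)) \<longlongrightarrow> ereal (m / 2)) (at_right 0)"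
  proof -
    have "((\<lambda>\<theta>. psi' \<theta> - m / 2) \<longlongrightarrow> m - m / 2) (at_right 0)"
      using deriv_psi_tendsto_at_0plus by (intro tendsto_intros) (simp add: deriv_psi_0plus)
    then show ?thesis by (simp add: Y.psi'_def psi'_def algebra_simps)
  qed
  then have deriv: "deriv_at_0plus \<eta> = ereal (m / 2)"
    using tendsto_unique[OF _ Y.deriv_psi_tendsto_at_0plus] by simp
  have "levy_laplace_mean M Y (c - m / 2) \<sigma> \<nu> \<eta> (m / 2)"
    by unfold_locales
      (use m big_jump_mean_finite integrable_compensated deriv in \<open>auto simp: \<eta>_def psi_mean algebra_simps\<close>)
  then show ?thesis by (simp add: Y_def[abs_def] \<eta>_def[abs_def])
qed

text \<open>On a finite passage the drifted process \<open>X\<^sub>t - m t / 2\<close> is below \<open>- m t / 2\<close>, so the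
  passage time is at most \<open>2 / m\<close> times the all-time depth of the drifted process.\<close>

lemma finite_passage_moment_finite:
  assumes m: "0 < m" and x: "0 \<le> x" and k: "0 < k"
    and jumps: "jump_moment (k + 1) < \<infinity>"
  shows "(\<integral>\<^sup>+\<omega>. ennreal (finite_passage x \<omega> powr k) \<partial>M) < \<infinity>"
proof -
  interpret D: levy_laplace_mean M "\<lambda>t \<omega>. X t \<omega> - m / 2 * t" "c - m / 2" \<sigma> \<nu> "\<lambda>\<theta>. \<psi> \<theta> - m / 2 * \<theta>" "m / 2"
    by (rule drift_change[OF m])
  have m2: "0 < m / 2" using m by simp
  have le: "AE \<omega> in M. finite_passage x \<omega> \<le> 2 / m * D.low_real \<omega>"
    using D.AE_low_sup_finite[OF m2]
  proof eventually_elim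
    case (elim \<omega>)
    show ?case
    proof (cases "passage_below X x \<omega>")
      case top
      then show ?thesis using m D.low_real_nonneg[of \<omega>] by (simp add: finite_passage_def)
    next
      case (real T)
      then have "passage_below X x \<omega> < \<infinity>" by simp
      then obtain s where s: "0 < s" "X s \<omega> < - x"
        by (auto simp: passage_below_def INF_less_iff)
      have "ennreal T \<le> ennreal s" using passage_below_le[OF s] real by simp
      then have "T \<le> s" using s(1) by (simp add: ennreal_le_iff)
      then have "m / 2 * T \<le> m / 2 * s" using m by simp
      also have "\<dots> \<le> - (X s \<omega> - m / 2 * s)" using s x by simp
      finally have "ennreal (m / 2 * T) \<le> ennreal (- (X s \<omega> - m / 2 * s))" by (rule ennreal_leI)
      also have "\<dots> \<le> D.low_sup \<omega>" unfolding D.low_sup_def using s by (intro SUP_upper) simp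
      also have "D.low_sup \<omega> = ennreal (D.low_real \<omega>)"
        unfolding D.low_real_def by (rule ennreal_enn2real[symmetric]) (use elim in simp)
      finally have "ennreal (m / 2 * T) \<le> ennreal (D.low_real \<omega>)" .
      then have "m / 2 * T \<le> D.low_real \<omega>" using D.low_real_nonneg[of \<omega>] by (simp add: ennreal_le_iff)
      then show ?thesis using real m by (simp add: finite_passage_def field_simps)
    qed
  qed
  have "(\<integral>\<^sup>+\<omega>. ennreal (finite_passage x \<omega> powr k) \<partial>M) \<le> (\<integral>\<^sup>+\<omega>. ennreal ((2 / m) powr k) * ennreal (D.low_real \<omega> powr k) \<partial>M)"
  proof (rule nn_integral_mono_AE)
    show "AE \<omega> in M. ennreal (finite_passage x \<omega> powr k) \<le> ennreal ((2 / m) powr k) * ennreal (D.low_real \<omega> powr k)"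
      using le
    proof eventually_elim
      case (elim \<omega>)
      have "finite_passage x \<omega> powr k \<le> (2 / m * D.low_real \<omega>) powr k"
        using elim k by (intro powr_mono2) (auto simp: finite_passage_def)
      also have "\<dots> = (2 / m) powr k * D.low_real \<omega> powr k" by (rule powr_mult)
      finally show ?case by (simp add: ennreal_leI flip: ennreal_mult)
    qed
  qed
  also have "\<dots> = ennreal ((2 / m) powr k) * D.low_moment k"
    unfolding D.low_moment_def by (rule nn_integral_cmult) measurable
  also have "\<dots> < \<infinity>" using D.low_moment_finite[OF m2 k jumps] by (simp add: ennreal_mult_less_top)
  finally show ?thesis .
qed

lemma cond_passage_moment_finite_iff_jump_moment:
  assumes m: "0 < m" and x: "admissible_level M X x" and k: "0 < k"
  shows "cond_passage_moment M X x k < \<infinity> \<longleftrightarrow> jump_moment (k + 1) < \<infinity>"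
proof -
  have "0 \<le> x" using x by (simp add: admissible_level_def)
  then show ?thesis
    unfolding cond_passage_moment_finite_iff[OF k]
    using finite_passage_moment_finite[OF m _ k] low_moment_finite_of_finite_passage[OF m x k]
      jump_moment_finite_of_low_moment[OF m k] by blast
qed

text \<open>The weighted Fubini argument covers \<open>l < 1\<close>. For \<open>l = 1\<close> the
  order \<open>k\<close> is at least 1 and hence above the threshold 1/2.\<close>

lemma passage_moment_infinite_jump:
  assumes m: "m = 0" "\<not> pure_drift M X" and x: "admissible_level M X x"
    and k: "0 < l" "l \<le> 1" "l \<le> k"
    and jumps: "jump_moment (l + 1) = \<infinity>"
  shows "passage_moment M X x k = \<infinity>"
proof (cases "l < 1")
  case True
  have "passage_moment M X x l = \<infinity>"
    using jump_moment_finite_of_passage_moment[OF m(1) psi_1_pos[OF m] x k(1) True] jumps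
    by (auto simp: less_top[symmetric])
  then show ?thesis using k by (intro passage_moment_infinite_mono[of l k])
next
  case False
  then show ?thesis
    using passage_moment_infinite_gt_half[OF m(1) psi_1_pos[OF m] x, of k] k by simp
qed

end

theorem theorem3p1:
  fixes M :: "'a measure" and X :: "real \<Rightarrow> 'a \<Rightarrow> real"
    and c \<sigma> :: real and \<nu> :: "real measure" and \<psi> :: "real \<Rightarrow> real"
  assumes levy: "spectrally_negative_levy_process M X"
    and start: "AE \<omega> in M. X 0 \<omega> = 0"
    and not_drift: "\<not> pure_drift M X"
    and sets_nu: "sets \<nu> = sets (restrict_space borel {0<..})"
    and levy_measure: "(\<integral>\<^sup>+y. ennreal (min 1 (y\<^sup>2)) \<partial>\<nu>) < \<infinity>"
    and exponent: "laplace_exponent M X \<psi>"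
    and psi: "\<And>\<theta>. 0 \<le> \<theta> \<Longrightarrow>
      \<psi> \<theta> = c * \<theta> + 1 / 2 * \<sigma>\<^sup>2 * \<theta>\<^sup>2
        + (\<integral>y. (exp (- \<theta> * y) - 1 + \<theta> * y * indicator {y. y < 1} y) \<partial>\<nu>)"
  shows
    "(deriv_at_0plus \<psi> < 0 \<longrightarrow>
       (\<forall>x. admissible_level M X x \<longrightarrow>
          (\<exists>q>0. (\<integral>\<^sup>+\<omega>. exp_time q (passage_below X x \<omega>) \<partial>M) < \<infinity>)) \<and>
       (\<forall>x \<kappa>. admissible_level M X x \<and> 0 \<le> \<kappa> \<longrightarrow> passage_moment M X x \<kappa> < \<infinity>))
     \<and>
     (deriv_at_0plus \<psi> > 0 \<longrightarrow>
       (\<forall>x \<kappa>. admissible_level M X x \<and> 0 < \<kappa> \<longrightarrow>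
          (cond_passage_moment M X x \<kappa> < \<infinity> \<longleftrightarrow>
           (\<integral>\<^sup>+y\<in>{1..}. ennreal (y powr (\<kappa> + 1)) \<partial>\<nu>) < \<infinity>)))
     \<and>
     (deriv_at_0plus \<psi> = 0 \<longrightarrow>
       (\<forall>\<kappa>'. 0 < \<kappa>' \<and> \<kappa>' \<le> 1 \<and> (\<integral>\<^sup>+y\<in>{1..}. ennreal (y powr (\<kappa>' + 1)) \<partial>\<nu>) = \<infinity> \<longrightarrow>
          (\<forall>x \<kappa>. admissible_level M X x \<and> \<kappa>' \<le> \<kappa> \<longrightarrow> passage_moment M X x \<kappa> = \<infinity>)) \<and>
       (deriv2_at_0plus \<psi> < \<infinity> \<longrightarrow>
          (\<forall>x \<kappa>. admissible_level M X x \<and> 1 / 2 < \<kappa> \<longrightarrow> passage_moment M X x \<kappa> = \<infinity>)) \<and>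
       (\<forall>x \<kappa>. admissible_level M X x \<and> 1 \<le> \<kappa> \<longrightarrow> passage_moment M X x \<kappa> = \<infinity>))"
proof -
  interpret levy_process M X using levy by (rule spectrally_negative_levy_process.axioms)
  interpret levy_laplace M X c \<sigma> \<nu> \<psi>
    using sets_nu levy_measure psi start exponent by unfold_locales
  \<comment> \<open>In both remaining regimes the slope is a non-negative real number, so \<psi>
    takes its fully compensated form.\<close>
  have mean: "\<exists>m. deriv_at_0plus \<psi> = ereal m \<and> levy_laplace_mean M X c \<sigma> \<nu> \<psi> m" if nonneg: "0 \<le> deriv_at_0plus \<psi>"
  proof -
    obtain m where m: "deriv_at_0plus \<psi> = ereal m" "big_jump_mean < \<infinity>"
      "\<And>\<theta>. 0 \<le> \<theta> \<Longrightarrow> integrable \<nu> (\<lambda>y. exp (- (\<theta> * y)) - 1 + \<theta> * y)"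
      "\<And>\<theta>. 0 \<le> \<theta> \<Longrightarrow> \<psi> \<theta> = m * \<theta> + 1 / 2 * \<sigma>\<^sup>2 * \<theta>\<^sup>2 + compensated_part \<theta>"
      using psi_nonneg_deriv[OF nonneg] by blast
    have "0 \<le> m" using nonneg m(1) by simp
    then have "levy_laplace_mean M X c \<sigma> \<nu> \<psi> m" using m by unfold_locales
    with m(1) show ?thesis by blast
  qed
  show ?thesis
  proof (intro conjI impI allI)
    assume "deriv_at_0plus \<psi> < 0"
    then obtain \<theta> where \<theta>: "0 < \<theta>" "\<psi> \<theta> < 0" using psi_neg by blast
    show "\<exists>q>0. (\<integral>\<^sup>+\<omega>. exp_time q (passage_below X x \<omega>) \<partial>M) < \<infinity>" for x
      by (rule exp_moment_finite[OF \<theta>])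
    show "passage_moment M X x \<kappa> < \<infinity>" if "admissible_level M X x \<and> 0 \<le> \<kappa>" for x \<kappa>
      using that by (intro moments_finite[OF \<theta>]) auto
  next
    fix x \<kappa> :: real assume pos: "deriv_at_0plus \<psi> > 0" and x: "admissible_level M X x \<and> 0 < \<kappa>"
    obtain m where m: "deriv_at_0plus \<psi> = ereal m" "levy_laplace_mean M X c \<sigma> \<nu> \<psi> m"
      using mean pos by (meson less_imp_le)
    have "0 < m" using pos m(1) by simp
    then show "cond_passage_moment M X x \<kappa> < \<infinity> \<longleftrightarrow> (\<integral>\<^sup>+y\<in>{1..}. ennreal (y powr (\<kappa> + 1)) \<partial>\<nu>) < \<infinity>"
      using levy_laplace_mean.cond_passage_moment_finite_iff_jump_moment[OF m(2)] x by blast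
  next
    assume zero: "deriv_at_0plus \<psi> = 0"
    obtain m where m: "deriv_at_0plus \<psi> = ereal m" "levy_laplace_mean M X c \<sigma> \<nu> \<psi> m"
      using mean zero by auto
    have m0: "m = 0" using zero m(1) by simp
    interpret levy_laplace_mean M X c \<sigma> \<nu> \<psi> m by (rule m(2))
    note half = passage_moment_infinite_gt_half[OF m0 psi_1_pos[OF m0 not_drift]]
    show "passage_moment M X x \<kappa> = \<infinity>"
      if "0 < \<kappa>' \<and> \<kappa>' \<le> 1 \<and> (\<integral>\<^sup>+y\<in>{1..}. ennreal (y powr (\<kappa>' + 1)) \<partial>\<nu>) = \<infinity>"
        and "admissible_level M X x \<and> \<kappa>' \<le> \<kappa>" for \<kappa>' x \<kappa>
      using that by (intro passage_moment_infinite_jump[OF m0 not_drift, of x \<kappa>' \<kappa>]) auto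
    show "passage_moment M X x \<kappa> = \<infinity>" if "admissible_level M X x \<and> 1 / 2 < \<kappa>" for x \<kappa>
      using that half by blast
    show "passage_moment M X x \<kappa> = \<infinity>" if "admissible_level M X x \<and> 1 \<le> \<kappa>" for x \<kappa>
      using that by (intro half) auto
  qed
qed

end
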